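(* Let $T>0$ be arbitrary, let $\nu>0$, and let $(\mathbf{u},p)$ be a smooth solution on $[0,T]\times\overline{\Omega}$ of the time-dependent incompressible Stokes problem $$\mathbf{u}_t-\nu\Delta\mathbf{u}+\nabla p=\mathbf{f},\qquad \nabla\cdot\mathbf{u}=0 \quad\text{in } (0,T]\times\Omega,$$ with $\mathbf{u}=\mathbf{0}$ on $\partial\Omega$ and $\mathbf{u}(0,\cdot)=\mathbf{u}_0$ (with $\mathbf{u}_0$ divergence-free). Let $(\mathbf{V}_h,Q_h)$ be a conforming, inf-sup stable, pressure-robust pair of finite element spaces, and let $(\mathbf{u}_h,p_h)$ with $(\mathbf{u}_h(t),p_h(t))\in \mathbf{V}_h\times Q_h$ solve the semi-discrete problem: for all $t\in(0,T]$ and all $(\mathbf{v}_h,q_h)\in\mathbf{V}_h\times Q_h$, $$(\dot{\mathbf{u}}_h,\mathbf{v}_h)+\nu(\nabla\mathbf{u}_h,\nabla\mathbf{v}_h)-(p_h,\nabla\cdot\mathbf{v}_h)+(\nabla\cdot\mathbf{u}_h,q_h)=(\mathbf{f},\mathbf{v}_h),$$ with initial value $\mathbf{u}_h(0)=\mathbb{P}_h(\mathbf{u}_0)$. Set $\mathbf{e}_h(t):=\mathbf{u}_h(t)-\mathbb{P}_h(\mathbf{u}(t))$. Then $$\|\mathbf{e}_h(T)\|_0^2+\nu\int_0^T\|\nabla\mathbf{e}_h(t)\|_0^2\,dt\;\le\;\nu\int_0^T\big\|\nabla\big(\mathbb{S}_h(\mathbf{u}(t))-\mathbb{P}_h(\mathbf{u}(t))\big)\big\|_0^2\,dt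 .$$
   Context: $\Omega\subset\mathbb{R}^d$, $d\in\{2,3\}$, is a bounded convex (polygonal/polyhedral) domain with a shape-regular triangulation. $(\cdot,\cdot)$ is the $L^2(\Omega)$ inner product (of scalar, vector or matrix fields) and $\|\cdot\|_0$ the corresponding norm. The pressure $p$ is normalized to have zero mean. Conforming: $\mathbf{V}_h\subset H^1_0(\Omega)^d$ and $Q_h\subset L^2_0(\Omega)=\{q\in L^2(\Omega):\int_\Omega q=0\}$ are finite-dimensional (finite element) spaces. Inf-sup stable: the Babuska--Brezzi condition holds, i.e. there is $\beta>0$ with $\sup_{\mathbf{0}\neq\mathbf{v}_h\in\mathbf{V}_h}(\nabla\cdot\mathbf{v}_h,q_h)/\|\nabla\mathbf{v}_h\|_0\ge\beta\|q_h\|_0$ for all $q_h\in Q_h$. The discretely divergence-free space is $\mathbf{V}_h^0:=\{\mathbf{v}_h\in\mathbf{V}_h:(\nabla\cdot\mathbf{v}_h,q_h)=0\ \ \forall q_h\in Q_h\}$. Pressure-robust means (in this conforming setting, e.g. for divergence-free Scott--Vogelius elements) that discretely divergence-free functions are $L^2$-orthogonal to gradients: $(\nabla q,\mathbf{v}_h)=-(q,\nabla\cdot\mathbf{v}_h)=0$ for all $q\in H^1(\Omega)$ and all $\mathbf{v}_h\in\mathbf{V}_h^0$; equivalently, $\nabla\cdot\mathbf{v}_h=0$ for all $\mathbf{v}_h\in\mathbf{V}_h^0$. The discrete Helmholtz--Hodge projection $\mathbb{P}_h(\mathbf{w})\in\mathbf{V}_h^0$ of $\mathbf{w}\in L^2(\Omega)^d$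 is defined by $(\mathbb{P}_h(\mathbf{w}),\mathbf{v}_h)=(\mathbf{w},\mathbf{v}_h)$ for all $\mathbf{v}_h\in\mathbf{V}_h^0$. The discrete Stokes projection $\mathbb{S}_h(\mathbf{w})\in\mathbf{V}_h^0$ of $\mathbf{w}\in H^1(\Omega)^d$ is defined by $(\nabla\mathbb{S}_h(\mathbf{w}),\nabla\mathbf{v}_h)=(\nabla\mathbf{w},\nabla\mathbf{v}_h)$ for all $\mathbf{v}_h\in\mathbf{V}_h^0$. The semi-discrete velocity $t\mapsto\mathbf{u}_h(t)\in\mathbf{V}_h$ is understood to be continuous on $[0,T]$ and continuously differentiable in time, with $\dot{\mathbf{u}}_h$ its time derivative. *)

theory Defs
  imports "HOL-Analysis.Analysis"
begin

text \<open>The class $C^k$ on an \<^emph>\<open>open\<close> set; the derivatives are the unrestricted ones.\<close>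

primrec Ck_on :: "nat \<Rightarrow> 'a::euclidean_space set \<Rightarrow> ('a \<Rightarrow> 'b::real_normed_vector) \<Rightarrow> bool" where
  "Ck_on 0 S f \<longleftrightarrow> continuous_on S f"
| "Ck_on (Suc k) S f \<longleftrightarrow>
     (\<forall>x\<in>S. f differentiable (at x)) \<and>
     (\<forall>b\<in>Basis. Ck_on k S (\<lambda>x. frechet_derivative f (at x) b))"

definition smooth_on :: "'a::euclidean_space set \<Rightarrow> ('a \<Rightarrow> 'b::real_normed_vector) \<Rightarrow> bool" where
  "smooth_on S f \<longleftrightarrow> (\<forall>k. Ck_on k S f)"

text \<open>Smoothness on a closed set $K$, i.e. up to its boundary: $f$ agrees on $K$ with a
  $C^\infty$ function defined on an open neighbourhood of $K$.\<close>

definition smooth_up_to :: "'a::euclidean_space set \<Rightarrow> ('a \<Rightarrow> 'b::real_normed_vector) \<Rightarrow> bool" where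
  "smooth_up_to K f \<longleftrightarrow>
     (\<exists>U g. open U \<and> K \<subseteq> U \<and> smooth_on U g \<and> (\<forall>x\<in>K. g x = f x))"

definition partial :: "'n \<Rightarrow> (real^'n \<Rightarrow> 'b::real_normed_vector) \<Rightarrow> real^'n \<Rightarrow> 'b" where
  "partial j f x = frechet_derivative f (at x) (axis j 1)"

definition grad :: "(real^'n \<Rightarrow> real) \<Rightarrow> real^'n \<Rightarrow> real^'n" where
  "grad f x = (\<chi> j. partial j f x)"

definition divergence :: "(real^'n \<Rightarrow> real^'n) \<Rightarrow> real^'n \<Rightarrow> real" where
  "divergence v x = (\<Sum>j\<in>UNIV. partial j v x $ j)"

definition laplacian :: "(real^'n \<Rightarrow> 'b::real_normed_vector) \<Rightarrow> real^'n \<Rightarrow> 'b" where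
  "laplacian f x = (\<Sum>j\<in>UNIV. partial j (partial j f) x)"

text \<open>Elements of $L^2(\Omega)$ are represented by functions on the whole space; only their
  values almost everywhere on \<open>\<Omega>\<close> matter. The inner product on \<open>real^'n^'n\<close> is the Frobenius
  inner product, so \<open>l2_inner\<close> and \<open>l2_norm\<close> serve scalar, vector and matrix fields alike.\<close>

definition L2 :: "(real^'n) set \<Rightarrow> (real^'n \<Rightarrow> 'b::euclidean_space) set" where
  "L2 \<Omega> = {f. f \<in> borel_measurable (lebesgue_on \<Omega>) \<and>
               integrable (lebesgue_on \<Omega>) (\<lambda>x. (norm (f x))\<^sup>2)}"

definition l2_inner ::
    "(real^'n) set \<Rightarrow> (real^'n \<Rightarrow> 'b::euclidean_space) \<Rightarrow> (real^'n \<Rightarrow> 'b) \<Rightarrow> real" where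
  "l2_inner \<Omega> f g = (LINT x|lebesgue_on \<Omega>. f x \<bullet> g x)"

definition l2_norm :: "(real^'n) set \<Rightarrow> (real^'n \<Rightarrow> 'b::euclidean_space) \<Rightarrow> real" where
  "l2_norm \<Omega> f = sqrt (l2_inner \<Omega> f f)"

definition L2_zero_mean :: "(real^'n) set \<Rightarrow> (real^'n \<Rightarrow> real) set" where
  "L2_zero_mean \<Omega> = {q \<in> L2 \<Omega>. (LINT x|lebesgue_on \<Omega>. q x) = 0}"

definition test_function :: "(real^'n) set \<Rightarrow> (real^'n \<Rightarrow> real) \<Rightarrow> bool" where
  "test_function \<Omega> \<phi> \<longleftrightarrow>
     smooth_on UNIV \<phi> \<and> compact (closure {x. \<phi> x \<noteq> 0}) \<and> closure {x. \<phi> x \<noteq> 0} \<subseteq> \<Omega>"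

definition has_weak_gradient ::
    "(real^'n) set \<Rightarrow> (real^'n \<Rightarrow> real) \<Rightarrow> (real^'n \<Rightarrow> real^'n) \<Rightarrow> bool" where
  "has_weak_gradient \<Omega> f g \<longleftrightarrow> f \<in> L2 \<Omega> \<and> g \<in> L2 \<Omega> \<and>
     (\<forall>\<phi> j. test_function \<Omega> \<phi> \<longrightarrow>
        (LINT x|lebesgue_on \<Omega>. f x * partial j \<phi> x) =
        - (LINT x|lebesgue_on \<Omega>. g x $ j * \<phi> x))"

definition H1 :: "(real^'n) set \<Rightarrow> (real^'n \<Rightarrow> real) set" where
  "H1 \<Omega> = {f. \<exists>g. has_weak_gradient \<Omega> f g}"

text \<open>The weak gradient is unique only up to null sets; a representative is chosen.\<close>

definition weak_grad :: "(real^'n) set \<Rightarrow> (real^'n \<Rightarrow> real) \<Rightarrow> real^'n \<Rightarrow> real^'n" where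
  "weak_grad \<Omega> f = (SOME g. has_weak_gradient \<Omega> f g)"

text \<open>$H^1_0(\Omega)$ is the closure of $C_c^\infty(\Omega)$ in the norm of $H^1(\Omega)$.\<close>

definition H1_0 :: "(real^'n) set \<Rightarrow> (real^'n \<Rightarrow> real) set" where
  "H1_0 \<Omega> = {f \<in> H1 \<Omega>. \<forall>\<epsilon>>0. \<exists>\<phi>. test_function \<Omega> \<phi> \<and>
     (l2_norm \<Omega> (\<lambda>x. f x - \<phi> x))\<^sup>2 +
     (l2_norm \<Omega> (\<lambda>x. weak_grad \<Omega> f x - grad \<phi> x))\<^sup>2 < \<epsilon>}"

definition H1_0_vec :: "(real^'n) set \<Rightarrow> (real^'n \<Rightarrow> real^'n) set" where
  "H1_0_vec \<Omega> = {v. \<forall>i. (\<lambda>x. v x $ i) \<in> H1_0 \<Omega>}"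

definition weak_grad_vec :: "(real^'n) set \<Rightarrow> (real^'n \<Rightarrow> real^'n) \<Rightarrow> real^'n \<Rightarrow> real^'n^'n" where
  "weak_grad_vec \<Omega> v x = (\<chi> i. weak_grad \<Omega> (\<lambda>y. v y $ i) x)"

definition weak_div :: "(real^'n) set \<Rightarrow> (real^'n \<Rightarrow> real^'n) \<Rightarrow> real^'n \<Rightarrow> real" where
  "weak_div \<Omega> v x = trace (weak_grad_vec \<Omega> v x)"

definition finite_dim_space :: "('a \<Rightarrow> 'b::real_vector) set \<Rightarrow> bool" where
  "finite_dim_space V \<longleftrightarrow>
     (\<exists>(N::nat) \<phi>. V = {v. \<exists>c::nat \<Rightarrow> real. v = (\<lambda>x. \<Sum>i<N. c i *\<^sub>R \<phi> i x)})"

definition conforming_pair ::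
    "(real^'n) set \<Rightarrow> (real^'n \<Rightarrow> real^'n) set \<Rightarrow> (real^'n \<Rightarrow> real) set \<Rightarrow> bool" where
  "conforming_pair \<Omega> V Q \<longleftrightarrow>
     finite_dim_space V \<and> V \<subseteq> H1_0_vec \<Omega> \<and>
     finite_dim_space Q \<and> Q \<subseteq> L2_zero_mean \<Omega>"

text \<open>The supremum is taken in the extended reals to avoid the unspecified real supremum of
  the empty set (which occurs when \<open>V\<close> is the zero space).\<close>

definition inf_sup_stable ::
    "(real^'n) set \<Rightarrow> (real^'n \<Rightarrow> real^'n) set \<Rightarrow> (real^'n \<Rightarrow> real) set \<Rightarrow> bool" where
  "inf_sup_stable \<Omega> V Q \<longleftrightarrow>
     (\<exists>\<beta>>0. \<forall>q\<in>Q.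
        (SUP v \<in> {v \<in> V. \<not> (AE x in lebesgue_on \<Omega>. v x = 0)}.
           ereal (l2_inner \<Omega> (weak_div \<Omega> v) q / l2_norm \<Omega> (weak_grad_vec \<Omega> v)))
        \<ge> ereal (\<beta> * l2_norm \<Omega> q))"

definition discrete_div_free ::
    "(real^'n) set \<Rightarrow> (real^'n \<Rightarrow> real^'n) set \<Rightarrow> (real^'n \<Rightarrow> real) set
      \<Rightarrow> (real^'n \<Rightarrow> real^'n) set" where
  "discrete_div_free \<Omega> V Q = {v \<in> V. \<forall>q\<in>Q. l2_inner \<Omega> (weak_div \<Omega> v) q = 0}"

definition pressure_robust ::
    "(real^'n) set \<Rightarrow> (real^'n \<Rightarrow> real^'n) set \<Rightarrow> (real^'n \<Rightarrow> real) set \<Rightarrow> bool" where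
  "pressure_robust \<Omega> V Q \<longleftrightarrow>
     (\<forall>q\<in>H1 \<Omega>. \<forall>v\<in>discrete_div_free \<Omega> V Q. l2_inner \<Omega> (weak_grad \<Omega> q) v = 0)"

text \<open>Both projections are determined up to null sets of \<open>\<Omega>\<close>, since elements of \<open>V\<close> are
  representatives of $H^1_0$ classes; hence the choice operator rather than \<open>THE\<close>.\<close>

definition helmholtz_proj ::
    "(real^'n) set \<Rightarrow> (real^'n \<Rightarrow> real^'n) set \<Rightarrow> (real^'n \<Rightarrow> real) set
      \<Rightarrow> (real^'n \<Rightarrow> real^'n) \<Rightarrow> (real^'n \<Rightarrow> real^'n)" where
  "helmholtz_proj \<Omega> V Q w =
     (SOME z. z \<in> discrete_div_free \<Omega> V Q \<and>
        (\<forall>v\<in>discrete_div_free \<Omega> V Q. l2_inner \<Omega> z v = l2_inner \<Omega> w v))"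

definition stokes_proj ::
    "(real^'n) set \<Rightarrow> (real^'n \<Rightarrow> real^'n) set \<Rightarrow> (real^'n \<Rightarrow> real) set
      \<Rightarrow> (real^'n \<Rightarrow> real^'n) \<Rightarrow> (real^'n \<Rightarrow> real^'n)" where
  "stokes_proj \<Omega> V Q w =
     (SOME z. z \<in> discrete_div_free \<Omega> V Q \<and>
        (\<forall>v\<in>discrete_div_free \<Omega> V Q.
           l2_inner \<Omega> (weak_grad_vec \<Omega> z) (weak_grad_vec \<Omega> v) =
           l2_inner \<Omega> (weak_grad_vec \<Omega> w) (weak_grad_vec \<Omega> v)))"

text \<open>Continuity and differentiability of a curve in a finite-dimensional subspace of
  $L^2(\Omega)$. They are expressed in the $L^2$ norm; all norms on such a space are
  equivalent, and the formulation does not depend on the chosen representatives.\<close>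

definition l2_continuous_on ::
    "(real^'n) set \<Rightarrow> real set \<Rightarrow> (real \<Rightarrow> real^'n \<Rightarrow> 'b::euclidean_space) \<Rightarrow> bool" where
  "l2_continuous_on \<Omega> I w \<longleftrightarrow>
     (\<forall>t\<in>I. ((\<lambda>s. l2_norm \<Omega> (\<lambda>x. w s x - w t x)) \<longlongrightarrow> 0) (at t within I))"

definition has_l2_derivative ::
    "(real^'n) set \<Rightarrow> (real \<Rightarrow> real^'n \<Rightarrow> 'b::euclidean_space) \<Rightarrow> (real^'n \<Rightarrow> 'b)
      \<Rightarrow> real \<Rightarrow> real set \<Rightarrow> bool" where
  "has_l2_derivative \<Omega> w w' t I \<longleftrightarrow> w' \<in> L2 \<Omega> \<and>
     ((\<lambda>s. l2_norm \<Omega> (\<lambda>x. (w s x - w t x) /\<^sub>R (s - t) - w' x)) \<longlongrightarrow> 0) (at t within I)"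

definition smooth_stokes_solution ::
    "(real^'n) set \<Rightarrow> real \<Rightarrow> real \<Rightarrow> (real \<Rightarrow> real^'n \<Rightarrow> real^'n) \<Rightarrow> (real^'n \<Rightarrow> real^'n)
      \<Rightarrow> (real \<Rightarrow> real^'n \<Rightarrow> real^'n) \<Rightarrow> (real \<Rightarrow> real^'n \<Rightarrow> real) \<Rightarrow> bool" where
  "smooth_stokes_solution \<Omega> T \<nu> f u0 u p \<longleftrightarrow>
     smooth_up_to ({0..T} \<times> closure \<Omega>) (\<lambda>(t, x). u t x) \<and>
     smooth_up_to ({0..T} \<times> closure \<Omega>) (\<lambda>(t, x). p t x) \<and>
     (\<forall>t\<in>{0<..T}. \<forall>x\<in>\<Omega>.
        vector_derivative (\<lambda>s. u s x) (at t within {0..T})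
          - \<nu> *\<^sub>R laplacian (u t) x + grad (p t) x = f t x \<and>
        divergence (u t) x = 0) \<and>
     (\<forall>t\<in>{0<..T}. \<forall>x\<in>frontier \<Omega>. u t x = 0) \<and>
     (\<forall>x\<in>\<Omega>. u 0 x = u0 x) \<and>
     (\<forall>t\<in>{0..T}. (LINT x|lebesgue_on \<Omega>. p t x) = 0)"

text \<open>\<open>duh\<close> is the time derivative of \<open>uh\<close>.\<close>

definition semidiscrete_stokes_solution ::
    "(real^'n) set \<Rightarrow> real \<Rightarrow> real \<Rightarrow> (real \<Rightarrow> real^'n \<Rightarrow> real^'n) \<Rightarrow> (real^'n \<Rightarrow> real^'n)
      \<Rightarrow> (real^'n \<Rightarrow> real^'n) set \<Rightarrow> (real^'n \<Rightarrow> real) set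
      \<Rightarrow> (real \<Rightarrow> real^'n \<Rightarrow> real^'n) \<Rightarrow> (real \<Rightarrow> real^'n \<Rightarrow> real^'n)
      \<Rightarrow> (real \<Rightarrow> real^'n \<Rightarrow> real) \<Rightarrow> bool" where
  "semidiscrete_stokes_solution \<Omega> T \<nu> f u0 V Q uh duh ph \<longleftrightarrow>
     (\<forall>t\<in>{0..T}. uh t \<in> V) \<and>
     (\<forall>t\<in>{0<..T}. ph t \<in> Q) \<and>
     l2_continuous_on \<Omega> {0..T} uh \<and>
     (\<forall>t\<in>{0<..T}. has_l2_derivative \<Omega> uh (duh t) t {0..T}) \<and>
     l2_continuous_on \<Omega> {0<..T} duh \<and>
     (\<forall>t\<in>{0<..T}. \<forall>v\<in>V. \<forall>q\<in>Q.
        l2_inner \<Omega> (duh t) v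
          + \<nu> * l2_inner \<Omega> (weak_grad_vec \<Omega> (uh t)) (weak_grad_vec \<Omega> v)
          - l2_inner \<Omega> (ph t) (weak_div \<Omega> v)
          + l2_inner \<Omega> (weak_div \<Omega> (uh t)) q
        = l2_inner \<Omega> (f t) v) \<and>
     (AE x in lebesgue_on \<Omega>. uh 0 x = helmholtz_proj \<Omega> V Q u0 x)"

end

theory Submission
  imports Defs "HOL-Computational_Algebra.Polynomial"
begin

text \<open>Test both the continuous and the semi-discrete equation with discretely divergence-free
  functions. Pressure-robustness removes the continuous pressure, the constraint removes the
  discrete one, and the time derivative of the projection $P_h u$ acts on such functions like
  $u_t$. Hence the error $e_h$ satisfies
  $\frac12 \frac{d}{dt}\|e_h\|^2 + \nu\|\nabla e_h\|^2 = \nu(\nabla(S_h u - P_h u), \nabla e_h)$,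
  and Young's inequality and integration in time, starting from $e_h(0) = 0$ in $L^2$, give the bound.

  Weak gradients are arbitrary representatives here, so linearity of the weak gradient already needs its
  uniqueness almost everywhere, i.e. the fundamental lemma of the calculus of variations.\<close>

section \<open>Smooth bump functions on boxes\<close>

text \<open>Both projections and the weak gradient are values of a choice operator, made separately
  at every time, so no regularity in time can be read off the functions \<open>P (u t)\<close>,
  \<open>S (u t)\<close> or \<open>weak_grad_vec \<Omega> (u t)\<close> themselves. Time dependence
  is therefore tracked only through scalar products with finitely many fixed elements of
  \<open>V0\<close>: a family \<open>e\<close> orthonormal, up to null functions, for the L2
  product, and a family \<open>d\<close> of the same kind for the product of gradients. Against such
  elements \<open>u t\<close> may replace \<open>P (u t)\<close> in the first product and
  \<open>S (u t)\<close> in the second. Products with the smooth \<open>u t\<close> are governed by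
  dominated convergence, and both integrands of the estimate become polynomials in continuous scalar
  functions. This also gives the integrability that the conclusion asserts.

  The second obstacle is that elements of \<open>V\<close> are functions and not classes: a nonzero
  function may have norm zero, so the forms are only positive semidefinite. Orthonormalisation and
  Riesz representation are carried out modulo the kernel of the form, and every functional used has
  to be shown to vanish on that kernel.\<close>

definition flat :: "real poly \<Rightarrow> real \<Rightarrow> real" where
  "flat p s = (if s > 0 then poly p (1 / s) * exp (- (1 / s)) else 0)"

lemma tendsto_poly_exp_neg:
  fixes p :: "real poly"
  shows "((\<lambda>y. poly p y * exp (- y)) \<longlongrightarrow> 0) at_top"
proof -
  have "((\<lambda>y. \<Sum>i\<le>degree p. coeff p i * (y ^ i / exp y)) \<longlongrightarrow> (\<Sum>i\<le>degree p. coeff p i * 0)) at_top"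
    by (intro tendsto_sum tendsto_mult tendsto_const tendsto_power_div_exp_0)
  moreover have "(\<lambda>y. \<Sum>i\<le>degree p. coeff p i * (y ^ i / exp y)) = (\<lambda>y. poly p y * exp (- y))"
    by (auto simp: poly_altdef exp_minus sum_distrib_right divide_inverse mult.assoc)
  ultimately show ?thesis by simp
qed

lemma flat_tendsto_0: "(flat p \<longlongrightarrow> 0) (at 0)"
proof -
  have "((\<lambda>s. poly p (1 / s) * exp (- (1 / s))) \<longlongrightarrow> 0) (at_right 0)"
    by (rule filterlim_compose[OF tendsto_poly_exp_neg, of "\<lambda>s. 1 / s"])
       (use filterlim_inverse_at_top_right in \<open>simp add: divide_inverse\<close>)
  then have "(flat p \<longlongrightarrow> 0) (at_right 0)"
    by (rule Lim_transform_eventually) (auto simp: flat_def eventually_at_right_field intro: exI[of _ 1])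
  moreover have "(flat p \<longlongrightarrow> 0) (at_left 0)"
    by (rule Lim_transform_eventually[OF tendsto_const])
       (auto simp: flat_def eventually_at_left_field intro: exI[of _ "-1"])
  ultimately show ?thesis by (simp add: filterlim_split_at)
qed

text \<open>The chain rule with y = 1/s: the derivative of p(y) exp(-y) in s is y^2 (p(y) - p'(y))
  exp(-y). The functions \<open>flat p\<close> thus form a family closed under differentiation,
  which turns smoothness into an induction over polynomials.\<close>

definition flat_deriv :: "real poly \<Rightarrow> real poly" where
  "flat_deriv p = [:0, 0, 1:] * (p - pderiv p)"

lemma DERIV_flat: "(flat p has_real_derivative flat (flat_deriv p) s) (at s)"
proof -
  consider "s > 0" | "s < 0" | "s = 0" by linarith
  then show ?thesis
  proof cases
    case 1
    have "((\<lambda>s. poly p (1 / s) * exp (- (1 / s))) has_real_derivative flat (flat_deriv p) s) (at s)"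
      using 1
      by (auto intro!: derivative_eq_intros DERIV_chain'[where g = "poly p", OF _ poly_DERIV]
          simp: flat_def flat_deriv_def field_simps power2_eq_square)
    then show ?thesis
      by (rule DERIV_cong_ev[THEN iffD1, rotated -1])
         (use 1 eventually_gt_at_top in \<open>auto simp: flat_def intro!: eventually_mono[OF eventually_nhds_in_open[of "{0<..}"]]\<close>)
  next
    case 2
    have "((\<lambda>s. 0) has_real_derivative flat (flat_deriv p) s) (at s)"
      using 2 by (auto simp: flat_def)
    then show ?thesis
      by (rule DERIV_cong_ev[THEN iffD1, rotated -1])
         (use 2 in \<open>auto simp: flat_def intro!: eventually_mono[OF eventually_nhds_in_open[of "{..<0}"]]\<close>)
  next
    case 3
    \<comment> \<open>The difference quotient of \<open>flat p\<close> at 0 is again of the same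
      family: the factor 1/h multiplies the polynomial by its variable.\<close>
    have "(flat ([:0, 1:] * p) \<longlongrightarrow> 0) (at 0)" by (rule flat_tendsto_0)
    then have "((\<lambda>h. (flat p (0 + h) - flat p 0) / h) \<longlongrightarrow> 0) (at 0)"
      by (rule Lim_transform_eventually) (auto simp: flat_def eventually_at intro: exI[of _ 1])
    then show ?thesis using 3 by (simp add: DERIV_def flat_def)
  qed
qed

section \<open>Algebra of C^k functions\<close>

lemma Ck_on_Suc_imp: "Ck_on (Suc k) S f \<Longrightarrow> Ck_on k S f"
proof (induction k arbitrary: f)
  case 0
  then show ?case
    by (auto intro!: continuous_at_imp_continuous_on differentiable_imp_continuous_within)
next
  case (Suc k)
  then show ?case by (metis Ck_on.simps(2))
qed

lemma Ck_on_const: "Ck_on k S (\<lambda>x. c)"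
  by (induction k arbitrary: c) auto

lemma Ck_on_add:
  "Ck_on k UNIV f \<Longrightarrow> Ck_on k UNIV g \<Longrightarrow> Ck_on k UNIV (\<lambda>x. f x + g x)"
proof (induction k arbitrary: f g)
  case 0
  then show ?case by (auto intro: continuous_intros)
next
  case (Suc k)
  have D: "frechet_derivative (\<lambda>x. f x + g x) (at x)
      = (\<lambda>b. frechet_derivative f (at x) b + frechet_derivative g (at x) b)" for x
    using Suc.prems
    by (intro frechet_derivative_at[symmetric] has_derivative_add)
       (auto simp: frechet_derivative_works)
  show ?case using Suc by (auto simp: D)
qed

lemma Ck_on_mult:
  fixes f g :: "'a::euclidean_space \<Rightarrow> real"
  shows "Ck_on k UNIV f \<Longrightarrow> Ck_on k UNIV g \<Longrightarrow> Ck_on k UNIV (\<lambda>x. f x * g x)"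
proof (induction k arbitrary: f g)
  case 0
  then show ?case by (auto intro: continuous_intros)
next
  case (Suc k)
  have D: "frechet_derivative (\<lambda>x. f x * g x) (at x)
      = (\<lambda>b. f x * frechet_derivative g (at x) b + frechet_derivative f (at x) b * g x)" for x
    using Suc.prems
    by (intro frechet_derivative_at[symmetric] has_derivative_mult)
       (auto simp: frechet_derivative_works)
  \<comment> \<open>The product rule leaves undifferentiated factors behind; they have to be
    downgraded to class k before the induction hypothesis applies to them.\<close>
  have "Ck_on k UNIV f" "Ck_on k UNIV g" using Suc.prems by (auto intro: Ck_on_Suc_imp simp del: Ck_on.simps)
  then show ?case using Suc.prems by (auto simp: D intro!: Ck_on_add Suc.IH)
qed

lemma Ck_on_prod:
  fixes f :: "'i \<Rightarrow> 'a::euclidean_space \<Rightarrow> real"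
  assumes "\<And>i. i \<in> I \<Longrightarrow> Ck_on k UNIV (f i)"
  shows "Ck_on k UNIV (\<lambda>x. \<Prod>i\<in>I. f i x)"
  using assms
  by (induction I rule: infinite_finite_induct) (simp_all add: Ck_on_const Ck_on_mult)

text \<open>The polynomial is generalised in the induction because each derivative replaces
  \<open>p\<close> by \<open>flat_deriv p\<close>, up to the constant factor contributed by the
  affine map.\<close>

lemma Ck_on_flat_affine:
  fixes a :: "'a::euclidean_space"
  shows "Ck_on k UNIV (\<lambda>x. flat p (a \<bullet> x + c))"
proof (induction k arbitrary: p)
  case 0
  have "continuous_on UNIV (flat p)"
    by (meson DERIV_flat DERIV_isCont continuous_at_imp_continuous_on)
  then have "continuous_on UNIV (flat p \<circ> (\<lambda>x. a \<bullet> x + c))"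
    by (intro continuous_on_compose continuous_intros) (auto intro: continuous_on_subset)
  then show ?case by (simp add: o_def)
next
  case (Suc k)
  have D: "((\<lambda>x. flat p (a \<bullet> x + c)) has_derivative (\<lambda>b. (a \<bullet> b) * flat (flat_deriv p) (a \<bullet> x + c))) (at x)" for x
    by (rule DERIV_flat[THEN DERIV_compose_FDERIV, THEN has_derivative_eq_rhs])
       (auto intro!: derivative_eq_intros)
  have "Ck_on k UNIV (\<lambda>x. (a \<bullet> b) * flat (flat_deriv p) (a \<bullet> x + c))" for b
    by (intro Ck_on_mult Ck_on_const Suc)
  moreover have "(\<lambda>x. flat p (a \<bullet> x + c)) differentiable (at x)" for x
    using D by (auto simp: differentiable_def)
  ultimately show ?case by (simp flip: frechet_derivative_at[OF D])
qed

text \<open>For each coordinate there is one factor exp(-1/s) per face of the box. The support stays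
  in the closed box for all \<open>k\<close>, while growing \<open>k\<close> steepens the faces, so
  that the bumps tend to the indicator of the open box with values between 0 and 1.\<close>

definition box_bump :: "nat \<Rightarrow> real^'n \<Rightarrow> real^'n \<Rightarrow> real^'n \<Rightarrow> real" where
  "box_bump k a b x =
     (\<Prod>i\<in>UNIV. flat 1 (real k * (x $ i - a $ i)) * flat 1 (real k * (b $ i - x $ i)))"

lemma flat_1_bounds: "0 \<le> flat 1 s" "flat 1 s \<le> 1"
  by (auto simp: flat_def)

lemma box_bump_bounds: "0 \<le> box_bump k a b x" "box_bump k a b x \<le> 1"
  unfolding box_bump_def
  by (auto intro!: prod_nonneg prod_le_1 mult_le_one simp: flat_1_bounds)

lemma box_bump_outside: "x \<notin> box a b \<Longrightarrow> box_bump k a b x = 0"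
proof -
  assume "x \<notin> box a b"
  then obtain i where "x $ i \<le> a $ i \<or> b $ i \<le> x $ i" by (auto simp: mem_box_cart not_less)
  then show ?thesis
    unfolding box_bump_def
    by (intro prod_zero[OF _ bexI[of _ i]]) (auto simp: flat_def zero_less_mult_iff)
qed

lemma flat_1_tendsto: "s > 0 \<Longrightarrow> (\<lambda>k. flat 1 (real k * s)) \<longlonglongrightarrow> 1"
proof -
  assume s: "s > 0"
  have "(\<lambda>k. exp (- (1 / (real k * s)))) \<longlonglongrightarrow> exp (- 0)"
  proof (intro tendsto_exp tendsto_minus)
    have "(\<lambda>k. (1 / s) * (1 / real k)) \<longlonglongrightarrow> (1 / s) * 0"
      by (intro tendsto_mult tendsto_const lim_1_over_n)
    then show "(\<lambda>k. 1 / (real k * s)) \<longlonglongrightarrow> 0" by (simp add: field_simps)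
  qed
  then show ?thesis
    \<comment> \<open>The index k = 0 has to be left out: there \<open>flat\<close> is 0, but the
      exponential formula gives 1 because 1/0 is 0.\<close>
    by (rule Lim_transform_eventually[OF _ eventually_mono[OF eventually_gt_at_top[of 0]], THEN tendsto_eq_rhs])
       (auto simp: flat_def s)
qed

lemma box_bump_tendsto: "(\<lambda>k. box_bump k a b x) \<longlonglongrightarrow> indicator (box a b) x"
proof (cases "x \<in> box a b")
  case True
  have "(\<lambda>k. box_bump k a b x) \<longlonglongrightarrow> (\<Prod>i\<in>(UNIV::'a set). 1 * 1)"
    unfolding box_bump_def using True
    by (intro tendsto_prod tendsto_mult flat_1_tendsto) (auto simp: mem_box_cart)
  then show ?thesis using True by simp
qed (simp add: box_bump_outside)

lemma test_function_box_bump: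
  assumes "cbox a b \<subseteq> \<Omega>"
  shows "test_function \<Omega> (box_bump k a b)"
proof -
  have eq: "box_bump k a b = (\<lambda>x. \<Prod>i\<in>UNIV. flat 1 ((real k *\<^sub>R axis i 1) \<bullet> x + (- real k * a $ i))
      * flat 1 ((- real k *\<^sub>R axis i 1) \<bullet> x + real k * b $ i))"
    by (auto simp: box_bump_def fun_eq_iff inner_axis' algebra_simps)
  have "smooth_on UNIV (box_bump k a b)"
    unfolding smooth_on_def eq by (intro allI Ck_on_prod Ck_on_mult Ck_on_flat_affine)
  moreover have "{x. box_bump k a b x \<noteq> 0} \<subseteq> cbox a b"
    using box_bump_outside box_subset_cbox by blast
  then have "closure {x. box_bump k a b x \<noteq> 0} \<subseteq> cbox a b"
    by (rule closure_minimal) (rule closed_cbox)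
  ultimately show ?thesis using assms
    unfolding test_function_def
    by (metis bounded_cbox bounded_subset closed_closure compact_eq_bounded_closed order_trans)
qed

section \<open>Weak derivatives against test functions\<close>

lemma integral_box_eq_0:
  fixes h :: "real^'n \<Rightarrow> real"
  assumes "open \<Omega>" "integrable (lebesgue_on \<Omega>) h"
    and h: "\<And>\<phi>. test_function \<Omega> \<phi> \<Longrightarrow> (LINT x|lebesgue_on \<Omega>. h x * \<phi> x) = 0"
    and sub: "cbox a b \<subseteq> \<Omega>"
  shows "(LINT x:box a b|lebesgue. h x) = 0"
proof -
  have \<Omega>: "\<Omega> \<in> sets lebesgue" using assms(1) by simp
  have [measurable]: "h \<in> borel_measurable (lebesgue_on \<Omega>)" using assms(2) by simp
  have bump_meas: "box_bump k a b \<in> borel_measurable (lebesgue_on \<Omega>)" for k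
  proof -
    have "Ck_on 0 UNIV (box_bump k a b)"
      using test_function_box_bump[OF sub, of k] unfolding test_function_def smooth_on_def by blast
    then show ?thesis
      by (intro continuous_imp_measurable_on_sets_lebesgue \<Omega>) (auto intro: continuous_on_subset)
  qed
  have box_meas: "indicat_real (box a b) \<in> borel_measurable (lebesgue_on \<Omega>)"
    by (intro measurable_restrict_space1 borel_measurable_indicator) simp
  \<comment> \<open>The bumps are admissible test functions, so every member of this sequence is 0;
    they take values in [0, 1], so \<open>h\<close> itself dominates.\<close>
  have "(\<lambda>k. LINT x|lebesgue_on \<Omega>. h x * box_bump k a b x)
      \<longlonglongrightarrow> (LINT x|lebesgue_on \<Omega>. h x * indicator (box a b) x)"
  proof (rule integral_dominated_convergence[where w = "\<lambda>x. \<bar>h x\<bar>"])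
    show "AE x in lebesgue_on \<Omega>. (\<lambda>k. h x * box_bump k a b x) \<longlonglongrightarrow> h x * indicator (box a b) x"
      by (intro AE_I2 tendsto_mult tendsto_const box_bump_tendsto)
    show "AE x in lebesgue_on \<Omega>. norm (h x * box_bump k a b x) \<le> \<bar>h x\<bar>" for k
      by (intro AE_I2) (simp add: abs_mult mult_left_le box_bump_bounds)
  qed (use assms(2) bump_meas box_meas in auto)
  then have "(LINT x|lebesgue_on \<Omega>. h x * indicator (box a b) x) = 0"
    using h[OF test_function_box_bump[OF sub]] by (simp add: LIMSEQ_const_iff)
  moreover have "(\<lambda>x. indicator \<Omega> x *\<^sub>R (h x * indicator (box a b) x)) = (\<lambda>x. indicator (box a b) x *\<^sub>R h x)"
    using sub box_subset_cbox[of a b] by (auto simp: indicator_def fun_eq_iff)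
  ultimately show ?thesis
    using \<Omega> integral_restrict_space[of \<Omega> lebesgue "\<lambda>x. h x * indicator (box a b) x"]
    by (simp add: set_lebesgue_integral_def)
qed

text \<open>Open boxes are stable under intersection and generate the Borel sets, so the sets over
  which \<open>F\<close> integrates to zero, which form a Dynkin system, include all Borel sets. The
  hypothesis on the total integral serves the complements.\<close>

lemma AE_zero_if_box_integrals_zero:
  fixes F :: "'a::euclidean_space \<Rightarrow> real"
  assumes F: "integrable lebesgue F"
    and box: "\<And>a b. (LINT x:box a b|lebesgue. F x) = 0"
    and total: "(LINT x|lebesgue. F x) = 0"
  shows "AE x in lebesgue. F x = 0"
proof -
  have borel: "(LINT x:A|lebesgue. F x) = 0" if "A \<in> sets borel" for A
  proof -
    have "Int_stable (range (\<lambda>(a, b). box a b :: 'a set))"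
      by (auto simp: Int_stable_def box_Int_box)
    moreover have "range (\<lambda>(a, b). box a b :: 'a set) \<subseteq> Pow UNIV" by simp
    moreover have "A \<in> sigma_sets UNIV (range (\<lambda>(a, b). box a b))"
      using that by (simp add: borel_eq_box)
    ultimately show ?thesis
    proof (induction rule: sigma_sets_induct_disjoint)
      case (compl A)
      have A: "A \<in> sets borel" using compl(1) by (simp add: borel_eq_box)
      have "(LINT x|lebesgue. indicator (UNIV - A) x *\<^sub>R F x)
          = (LINT x|lebesgue. F x - indicator A x *\<^sub>R F x)"
        by (rule Bochner_Integration.integral_cong) (auto simp: indicator_def)
      also have "\<dots> = (LINT x|lebesgue. F x) - (LINT x|lebesgue. indicator A x *\<^sub>R F x)"
        using A F by (intro Bochner_Integration.integral_diff integrable_mult_indicator) auto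
      finally show ?case using compl(2) total by (simp add: set_lebesgue_integral_def)
    next
      case (union A)
      have A: "A i \<in> sets borel" for i using union(2) by (auto simp: borel_eq_box)
      have "(LINT x:(\<Union>i. A i)|lebesgue. F x) = (\<Sum>i. LINT x:A i|lebesgue. F x)"
      proof (rule lebesgue_integral_countable_add)
        show "set_integrable lebesgue (\<Union>i. A i) F"
          unfolding set_integrable_def using A F by (intro integrable_mult_indicator) auto
      qed (use A union(1) in \<open>auto simp: disjoint_family_on_def\<close>)
      then show ?case using union(3) by simp
    qed (auto simp: box, simp add: set_lebesgue_integral_def)
  qed
  interpret leb: sigma_finite_measure "lebesgue :: 'a measure"
  proof -
    obtain A :: "'a set set" where "countable A" "A \<subseteq> sets lborel" "\<Union>A = space lborel"
      "\<forall>a\<in>A. emeasure lborel a \<noteq> \<infinity>"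
      using lborel.sigma_finite_countable by auto
    then show "sigma_finite_measure (lebesgue :: 'a measure)"
      by (intro sigma_finite_measure.intro exI[of _ A]) auto
  qed
  show ?thesis
  proof (rule leb.density_zero[OF F])
    fix A :: "'a set" assume "A \<in> sets lebesgue"
    \<comment> \<open>A Lebesgue set differs from a Borel set by a null set, which does not change
      the integral.\<close>
    then obtain S N N' where A: "A = S \<union> N" "N \<subseteq> N'" "N' \<in> null_sets lborel" "S \<in> sets lborel"
      by (rule sets_completionE)
    then have "N \<in> null_sets lebesgue"
      by (meson completion.complete2 null_sets_completionI)
    then have "AE x in lebesgue. x \<notin> N" by (rule AE_not_in)
    then have ae: "AE x in lebesgue. indicator A x *\<^sub>R F x = indicator S x *\<^sub>R F x"
      by eventually_elim (auto simp: A(1) indicator_def)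
    have "(LINT x:A|lebesgue. F x) = (LINT x:S|lebesgue. F x)"
      unfolding set_lebesgue_integral_def
      using A(4) \<open>A \<in> sets lebesgue\<close> F ae
      by (intro integral_cong_AE borel_measurable_integrable integrable_mult_indicator) auto
    then show "(LINT x:A|lebesgue. F x) = 0" using borel A(4) by simp
  qed
qed

text \<open>The claim is local: on a box whose closure lies in \<open>\<Omega>\<close>, cut
  \<open>h\<close> off by the indicator of the box. The integral of the result over any other box is
  an integral of \<open>h\<close> over the intersection, again a box inside \<open>\<Omega>\<close>.
  By Lindelof countably many such boxes cover \<open>\<Omega>\<close>, so the exceptional null sets
  can be united.\<close>

lemma fundamental_lemma_calculus_of_variations:
  fixes h :: "real^'n \<Rightarrow> real"
  assumes "open \<Omega>" "integrable (lebesgue_on \<Omega>) h"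
    and h: "\<And>\<phi>. test_function \<Omega> \<phi> \<Longrightarrow> (LINT x|lebesgue_on \<Omega>. h x * \<phi> x) = 0"
  shows "AE x in lebesgue_on \<Omega>. h x = 0"
proof -
  have \<Omega>: "\<Omega> \<in> sets lebesgue" using assms(1) by simp
  have on_box: "AE x in lebesgue. x \<in> box p q \<longrightarrow> h x = 0" if sub: "cbox p q \<subseteq> \<Omega>" for p q
  proof -
    let ?F = "\<lambda>x. indicator (box p q) x *\<^sub>R h x"
    have sub': "box p q \<subseteq> \<Omega>" using sub box_subset_cbox by blast
    have "integrable lebesgue (\<lambda>x. indicator (box p q) x *\<^sub>R (indicator \<Omega> x *\<^sub>R h x))"
      using assms(2) \<Omega>
      by (intro integrable_mult_indicator integrable_restrict_space[THEN iffD1]) simp_all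
    also have "(\<lambda>x. indicator (box p q) x *\<^sub>R (indicator \<Omega> x *\<^sub>R h x)) = ?F"
      using sub' by (auto simp: indicator_def fun_eq_iff)
    finally have int: "integrable lebesgue ?F" .
    have "(LINT x:box a b|lebesgue. ?F x) = 0" for a b
    proof -
      have box: "box a b \<inter> box p q = box (\<chi> i. max (a $ i) (p $ i)) (\<chi> i. min (b $ i) (q $ i))"
        by (auto simp: mem_box_cart)
      have "(LINT x:box a b|lebesgue. ?F x) = (LINT x:box a b \<inter> box p q|lebesgue. h x)"
        unfolding set_lebesgue_integral_def
        by (rule Bochner_Integration.integral_cong) (auto simp: indicator_def)
      also have "\<dots> = 0"
      proof (cases "box a b \<inter> box p q = {}")
        case False
        have "cbox (\<chi> i. max (a $ i) (p $ i)) (\<chi> i. min (b $ i) (q $ i)) \<subseteq> cbox p q"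
          by (auto simp: mem_box_cart)
        then show ?thesis unfolding box
          using sub by (intro integral_box_eq_0[OF assms]) auto
      qed (simp add: set_lebesgue_integral_def)
      finally show ?thesis .
    qed
    moreover have "(LINT x|lebesgue. ?F x) = 0"
      using integral_box_eq_0[OF assms sub] by (simp add: set_lebesgue_integral_def)
    ultimately have "AE x in lebesgue. ?F x = 0"
      using int by (intro AE_zero_if_box_integrals_zero) auto
    then show ?thesis by eventually_elim (auto simp: indicator_def)
  qed
  obtain D where D: "D \<subseteq> {box p q | p q. cbox p q \<subseteq> \<Omega>}" "countable D"
    "\<Union>D = \<Union>{box p q | p q. cbox p q \<subseteq> \<Omega>}"
    by (rule Lindelof[of "{box p q | p q. cbox p q \<subseteq> \<Omega>}"]) auto
  have cover: "\<Omega> \<subseteq> \<Union>D"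
  proof
    fix x assume "x \<in> \<Omega>"
    then obtain a b where "cbox a b \<subseteq> \<Omega>" "x \<in> box a b"
      using assms(1) open_contains_cbox by metis
    then show "x \<in> \<Union>D" unfolding D(3) by blast
  qed
  have "AE x in lebesgue. \<forall>B\<in>D. x \<in> B \<longrightarrow> h x = 0"
    using D(1) on_box by (intro AE_ball_countable[THEN iffD2] D(2)) blast
  then have "AE x in lebesgue. x \<in> \<Omega> \<longrightarrow> h x = 0"
    by eventually_elim (use cover in blast)
  then show ?thesis using \<Omega> by (simp add: AE_restrict_space_iff)
qed

section \<open>Integration by parts against test functions\<close>

lemma integral_partial_eq_0:
  fixes F :: "real^'n \<Rightarrow> real"
  assumes diff: "\<And>x. F differentiable (at x)"
    and cont: "continuous_on UNIV (partial j F)"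
    and supp: "bounded {x. F x \<noteq> 0}"
  shows "(LINT x|lebesgue. partial j F x) = 0"
proof -
  let ?e = "axis j 1 :: real^'n"
  obtain r where r: "\<And>x. F x \<noteq> 0 \<Longrightarrow> norm x \<le> r"
    using supp by (auto simp: bounded_iff)
  \<comment> \<open>The margin 2 is spent in two equal parts. Steps have length at most 1, so
    outside the ball of radius r + 1 both values in the difference quotient vanish; inside it the
    mean value theorem evaluates the derivative at distance at most r + 2.\<close>
  obtain M where M: "\<And>x. norm x \<le> r + 2 \<Longrightarrow> \<bar>partial j F x\<bar> \<le> M"
  proof -
    have "compact (partial j F ` cball 0 (r + 2))"
      by (intro compact_continuous_image continuous_on_subset[OF cont]) auto
    then obtain M where "\<forall>y\<in>partial j F ` cball 0 (r + 2). norm y \<le> M"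
      using compact_imp_bounded bounded_iff by metis
    then show ?thesis by (intro that[of M]) auto
  qed
  have contF: "continuous_on UNIV F"
    using diff by (auto intro!: continuous_at_imp_continuous_on differentiable_imp_continuous_within)
  then have [measurable]: "F \<in> borel_measurable borel" by (rule borel_measurable_continuous_onI)
  have [measurable]: "partial j F \<in> borel_measurable borel" by (rule borel_measurable_continuous_onI[OF cont])
  have line: "((\<lambda>s. F (x + s *\<^sub>R ?e)) has_real_derivative partial j F (x + s *\<^sub>R ?e)) (at s)" for x s
  proof -
    have "((\<lambda>s. F (x + s *\<^sub>R ?e)) has_derivative (\<lambda>h. frechet_derivative F (at (x + s *\<^sub>R ?e)) (h *\<^sub>R ?e))) (at s)"
      by (rule has_derivative_compose[OF _ diff[unfolded frechet_derivative_works]])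
         (auto intro!: derivative_eq_intros)
    moreover have "frechet_derivative F (at (x + s *\<^sub>R ?e)) (h *\<^sub>R ?e) = h * partial j F (x + s *\<^sub>R ?e)" for h
      using linear_frechet_derivative[OF diff] by (simp add: partial_def linear_scale)
    ultimately show ?thesis
      by (simp add: has_field_derivative_def mult_commute_abs)
  qed
  define h where "h = (\<lambda>n. 1 / real (Suc n))"
  have h: "0 < h n" "h n \<le> 1" for n by (auto simp: h_def)
  \<comment> \<open>Translation invariance makes every integral of a difference quotient vanish. The
    quotients are dominated by a constant on a ball and converge to the partial derivative, so its
    integral vanishes too.\<close>
  let ?G = "\<lambda>n x. (F (x + h n *\<^sub>R ?e) - F x) / h n"
  have bound: "\<bar>?G n x\<bar> \<le> M * indicator (cball 0 (r + 1)) x" for n x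
  proof (cases "norm x \<le> r + 1")
    case True
    obtain z where z: "0 < z" "z < h n"
      "F (x + h n *\<^sub>R ?e) - F (x + 0 *\<^sub>R ?e) = (h n - 0) * partial j F (x + z *\<^sub>R ?e)"
      using MVT2[of 0 "h n" "\<lambda>s. F (x + s *\<^sub>R ?e)", OF h(1)[of n] line] by blast
    have "norm (x + z *\<^sub>R ?e) \<le> norm x + norm (z *\<^sub>R ?e)" by (rule norm_triangle_ineq)
    also have "\<dots> \<le> r + 2" using True z h(2)[of n] by (simp add: norm_axis_1)
    finally have "\<bar>partial j F (x + z *\<^sub>R ?e)\<bar> \<le> M" by (rule M)
    then show ?thesis using True z(3) h(1)[of n] by simp
  next
    case False
    have "norm x \<le> norm (x + h n *\<^sub>R ?e) + norm (h n *\<^sub>R ?e)"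
      by (metis add_diff_cancel norm_triangle_ineq4)
    then have "norm (x + h n *\<^sub>R ?e) > r" using False h[of n] by (simp add: norm_axis_1)
    then have "F (x + h n *\<^sub>R ?e) = 0" "F x = 0" using r False by force+
    then show ?thesis using False by simp
  qed
  have lim: "(\<lambda>n. ?G n x) \<longlonglongrightarrow> partial j F x" for x
  proof -
    have "((\<lambda>s. (F (x + s *\<^sub>R ?e) - F x) / s) \<longlongrightarrow> partial j F x) (at 0)"
      using line[of x 0] by (simp add: DERIV_def)
    moreover have "filterlim h (at 0) sequentially"
      unfolding filterlim_at h_def using LIMSEQ_inverse_real_of_nat by (auto simp: divide_inverse)
    ultimately show ?thesis by (rule filterlim_compose)
  qed
  have intF: "integrable lborel F"
  proof -
    have "integrable lborel (\<lambda>x. indicator (cball 0 r) x *\<^sub>R F x)"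
      by (intro borel_integrable_compact continuous_on_subset[OF contF]) auto
    also have "(\<lambda>x. indicator (cball 0 r) x *\<^sub>R F x) = F"
      using r by (auto simp: indicator_def fun_eq_iff)
    finally show ?thesis .
  qed
  have trans: "integrable lborel (\<lambda>x. F (x + c))" "(LINT x|lborel. F (x + c)) = (LINT x|lborel. F x)" for c
  proof -
    have "integrable (distr lborel borel ((+) c)) F" using intF by (simp add: lborel_distr_plus)
    then show "integrable lborel (\<lambda>x. F (x + c))" by (subst (asm) integrable_distr_eq) (auto simp: add.commute)
    have "(LINT x|distr lborel borel ((+) c). F x) = (LINT x|lborel. F (c + x))"
      by (rule integral_distr) auto
    then show "(LINT x|lborel. F (x + c)) = (LINT x|lborel. F x)" by (simp add: lborel_distr_plus add.commute)
  qed
  have zero: "(LINT x|lborel. ?G n x) = 0" for n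
    using trans[of "h n *\<^sub>R ?e"] intF by simp
  have "(\<lambda>n. LINT x|lborel. ?G n x) \<longlonglongrightarrow> (LINT x|lborel. partial j F x)"
  proof (rule integral_dominated_convergence[where w = "\<lambda>x. M * indicator (cball 0 (r + 1)) x"])
    show "integrable lborel (\<lambda>x. M * indicator (cball 0 (r + 1)) x)"
      by (intro integrable_mult_right integrable_real_indicator) (use emeasure_bounded_finite[OF bounded_cball] in auto)
  qed (use bound lim in auto)
  then have "(LINT x|lborel. partial j F x) = 0" unfolding zero by (simp add: LIMSEQ_const_iff)
  then show ?thesis by (simp add: integral_completion)
qed

lemma integrable_on_compact_support:
  fixes f :: "'a::euclidean_space \<Rightarrow> real"
  assumes "open \<Omega>" "continuous_on \<Omega> f" "compact K" "K \<subseteq> \<Omega>" "\<And>x. x \<in> \<Omega> \<Longrightarrow> x \<notin> K \<Longrightarrow> f x = 0"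
  shows "integrable (lebesgue_on \<Omega>) f"
proof -
  have "integrable lborel (\<lambda>x. indicator K x *\<^sub>R f x)"
    by (intro borel_integrable_compact continuous_on_subset[OF assms(2)] assms)
  then have "integrable lebesgue (\<lambda>x. indicator K x *\<^sub>R f x)"
    by (simp only: integrable_completion borel_measurable_integrable)
  also have "(\<lambda>x. indicator K x *\<^sub>R f x) = (\<lambda>x. indicator \<Omega> x *\<^sub>R f x)"
    using assms by (auto simp: indicator_def fun_eq_iff)
  finally show ?thesis
    using assms(1) by (subst integrable_restrict_space) auto
qed

lemma test_functionD:
  assumes "test_function \<Omega> \<phi>"
  shows "\<phi> differentiable (at x)" "continuous_on S \<phi>" "continuous_on S (partial j \<phi>)"
    and "x \<notin> closure {x. \<phi> x \<noteq> 0} \<Longrightarrow> \<phi> x = 0"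
    and "x \<notin> closure {x. \<phi> x \<noteq> 0} \<Longrightarrow> partial j \<phi> x = 0"
proof -
  have C: "Ck_on 0 UNIV \<phi>" "Ck_on (Suc 0) UNIV \<phi>"
    using assms unfolding test_function_def smooth_on_def by blast+
  then show "\<phi> differentiable (at x)" by simp
  show "continuous_on S \<phi>" using C(1) by (auto intro: continuous_on_subset)
  have "axis j (1::real) \<in> Basis" by (simp add: axis_in_Basis_iff)
  then have "continuous_on UNIV (partial j \<phi>)"
    using C(2) by (auto simp: partial_def[abs_def])
  then show "continuous_on S (partial j \<phi>)" by (rule continuous_on_subset) auto
  show "\<phi> x = 0" if "x \<notin> closure {x. \<phi> x \<noteq> 0}"
    using that closure_subset[of "{x. \<phi> x \<noteq> 0}"] by auto
  show "partial j \<phi> x = 0" if "x \<notin> closure {x. \<phi> x \<noteq> 0}"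
  proof -
    have "(\<phi> has_derivative (\<lambda>h. 0)) (at x)"
    proof (rule has_derivative_transform_within_open)
      show "((\<lambda>x. 0) has_derivative (\<lambda>h. 0)) (at x)" by simp
      show "open (- closure {x. \<phi> x \<noteq> 0})" by (intro open_Compl closed_closure)
      show "0 = \<phi> y" if "y \<in> - closure {x. \<phi> x \<noteq> 0}" for y
        using that closure_subset[of "{x. \<phi> x \<noteq> 0}"] by auto
    qed (use that in auto)
    then show ?thesis by (simp add: partial_def flip: frechet_derivative_at)
  qed
qed

text \<open>The product of the two functions, extended by zero, is C^1 on the whole space:
  \<open>\<Omega>\<close> and the complement of the support of \<open>\<phi>\<close> are open, cover
  everything, and the extension is visibly C^1 on each. Hence \<open>\<psi>\<close> may be arbitrary
  near the boundary of \<open>\<Omega>\<close> and outside.\<close>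

lemma integration_by_parts_test_function:
  fixes \<psi> :: "real^'n \<Rightarrow> real"
  assumes \<Omega>: "open \<Omega>" and diff: "\<And>x. x \<in> \<Omega> \<Longrightarrow> \<psi> differentiable (at x)"
    and cont: "continuous_on \<Omega> (partial j \<psi>)" and \<phi>: "test_function \<Omega> \<phi>"
  shows "(LINT x|lebesgue_on \<Omega>. \<psi> x * partial j \<phi> x) = - (LINT x|lebesgue_on \<Omega>. partial j \<psi> x * \<phi> x)"
proof -
  define K where "K = closure {x. \<phi> x \<noteq> 0}"
  have K: "compact K" "K \<subseteq> \<Omega>" using \<phi> by (auto simp: test_function_def K_def)
  then have "open (- K)" by (intro open_Compl compact_imp_closed)
  have out: "\<phi> x = 0" "partial j \<phi> x = 0" if "x \<notin> K" for x
    using test_functionD(4,5)[OF \<phi>] that unfolding K_def by blast+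
  have cont\<psi>: "continuous_on \<Omega> \<psi>"
    using diff by (auto intro!: continuous_at_imp_continuous_on differentiable_imp_continuous_within)
  define F where "F x = (if x \<in> \<Omega> then \<psi> x * \<phi> x else 0)" for x
  define F' where "F' x = (if x \<in> \<Omega> then \<psi> x * partial j \<phi> x + partial j \<psi> x * \<phi> x else 0)" for x
  have in\<Omega>: "(F has_derivative (\<lambda>h. \<psi> x * frechet_derivative \<phi> (at x) h + frechet_derivative \<psi> (at x) h * \<phi> x)) (at x)"
    if "x \<in> \<Omega>" for x
  proof (rule has_derivative_transform_within_open[OF _ \<Omega> that])
    have "(\<psi> has_derivative frechet_derivative \<psi> (at x)) (at x)"
      "(\<phi> has_derivative frechet_derivative \<phi> (at x)) (at x)"
      using diff[OF that] test_functionD(1)[OF \<phi>] frechet_derivative_works by blast+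
    then show "((\<lambda>x. \<psi> x * \<phi> x) has_derivative (\<lambda>h. \<psi> x * frechet_derivative \<phi> (at x) h + frechet_derivative \<psi> (at x) h * \<phi> x)) (at x)"
      by (rule has_derivative_mult)
  qed (simp add: F_def)
  have outK: "(F has_derivative (\<lambda>h. 0)) (at x)" if "x \<in> - K" for x
  proof (rule has_derivative_transform_within_open[OF _ \<open>open (- K)\<close> that])
    show "((\<lambda>x. 0) has_derivative (\<lambda>h. 0)) (at x)" by simp
  qed (simp add: F_def out)
  have diffF: "F differentiable (at x)" for x
    using in\<Omega>[of x] outK[of x] K(2) by (auto simp: differentiable_def)
  have partF: "partial j F = F'"
  proof
    fix x show "partial j F x = F' x"
    proof (cases "x \<in> \<Omega>")
      case True
      then show ?thesis by (simp add: partial_def F'_def frechet_derivative_at[OF in\<Omega>, symmetric])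
    next
      case False
      then have "x \<in> - K" using K by auto
      then show ?thesis using False by (simp add: partial_def F'_def frechet_derivative_at[OF outK, symmetric])
    qed
  qed
  have int1: "continuous_on \<Omega> (\<lambda>x. \<psi> x * partial j \<phi> x)"
    by (intro continuous_intros cont\<psi> test_functionD[OF \<phi>])
  have int2: "continuous_on \<Omega> (\<lambda>x. partial j \<psi> x * \<phi> x)"
    by (intro continuous_intros cont test_functionD[OF \<phi>])
  have "continuous_on (\<Omega> \<union> (- K)) F'"
  proof (rule continuous_on_open_Un[OF \<Omega> \<open>open (- K)\<close>])
    show "continuous_on \<Omega> F'"
      by (rule continuous_on_eq[OF continuous_on_add[OF int1 int2]]) (simp add: F'_def)
    show "continuous_on (- K) F'"
      by (rule continuous_on_eq[OF continuous_on_const[of _ 0]]) (simp add: F'_def out)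
  qed
  moreover have "\<Omega> \<union> (- K) = UNIV" using K by auto
  ultimately have "continuous_on UNIV (partial j F)" by (simp add: partF)
  moreover have "{x. F x \<noteq> 0} \<subseteq> K" using out(1) by (auto simp: F_def)
  then have "bounded {x. F x \<noteq> 0}" using K(1) bounded_subset compact_imp_bounded by blast
  ultimately have "(LINT x|lebesgue. F' x) = 0"
    using integral_partial_eq_0[OF diffF, of j] by (simp add: partF)
  then have "(LINT x|lebesgue_on \<Omega>. \<psi> x * partial j \<phi> x + partial j \<psi> x * \<phi> x) = 0"
    using \<Omega> unfolding F'_def by (subst (asm) Lebesgue_Measure.integral_restrict_UNIV) auto
  moreover have "integrable (lebesgue_on \<Omega>) (\<lambda>x. \<psi> x * partial j \<phi> x)"
    "integrable (lebesgue_on \<Omega>) (\<lambda>x. partial j \<psi> x * \<phi> x)"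
    using \<Omega> K int1 int2 by (auto intro: integrable_on_compact_support simp: out)
  ultimately show ?thesis by simp
qed

section \<open>Degenerate inner products on finite-dimensional function spaces\<close>

text \<open>The laws are demanded on a carrier \<open>W\<close> only, since the integral defining
  the L2 product is additive only where it converges. Definiteness is absent on purpose: functions
  that vanish almost everywhere are null for the form without being zero.\<close>

locale semi_inner_space =
  fixes W :: "('a \<Rightarrow> 'b::real_vector) set" and B :: "('a \<Rightarrow> 'b) \<Rightarrow> ('a \<Rightarrow> 'b) \<Rightarrow> real"
  assumes zero_mem: "(\<lambda>x. 0) \<in> W"
    and add_mem: "f \<in> W \<Longrightarrow> g \<in> W \<Longrightarrow> (\<lambda>x. f x + g x) \<in> W"
    and scale_mem: "f \<in> W \<Longrightarrow> (\<lambda>x. c *\<^sub>R f x) \<in> W"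
    and B_add: "f \<in> W \<Longrightarrow> g \<in> W \<Longrightarrow> h \<in> W \<Longrightarrow> B (\<lambda>x. f x + g x) h = B f h + B g h"
    and B_scale: "f \<in> W \<Longrightarrow> h \<in> W \<Longrightarrow> B (\<lambda>x. c *\<^sub>R f x) h = c * B f h"
    and B_commute: "f \<in> W \<Longrightarrow> g \<in> W \<Longrightarrow> B f g = B g f"
    and B_nonneg: "f \<in> W \<Longrightarrow> 0 \<le> B f f"
begin

lemma diff_mem: "f \<in> W \<Longrightarrow> g \<in> W \<Longrightarrow> (\<lambda>x. f x - g x) \<in> W"
  using add_mem[of f "\<lambda>x. (-1) *\<^sub>R g x"] scale_mem[of g "-1"] by simp

lemma sum_mem: "(\<And>i. i \<in> I \<Longrightarrow> f i \<in> W) \<Longrightarrow> (\<lambda>x. \<Sum>i\<in>I. f i x) \<in> W"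
  by (induction I rule: infinite_finite_induct) (auto simp: zero_mem add_mem)

lemma B_zero: "h \<in> W \<Longrightarrow> B (\<lambda>x. 0) h = 0"
  using B_scale[OF zero_mem, of h 0] by simp

lemma B_diff: "f \<in> W \<Longrightarrow> g \<in> W \<Longrightarrow> h \<in> W \<Longrightarrow> B (\<lambda>x. f x - g x) h = B f h - B g h"
proof -
  assume fgh: "f \<in> W" "g \<in> W" "h \<in> W"
  have "B (\<lambda>x. f x + (-1) *\<^sub>R g x) h = B f h + B (\<lambda>x. (-1) *\<^sub>R g x) h"
    by (intro B_add fgh scale_mem)
  also have "B (\<lambda>x. (-1) *\<^sub>R g x) h = (-1) * B g h" by (intro B_scale fgh)
  finally show ?thesis by simp
qed

lemma B_sum:
  "(\<And>i. i \<in> I \<Longrightarrow> f i \<in> W) \<Longrightarrow> h \<in> W \<Longrightarrow> B (\<lambda>x. \<Sum>i\<in>I. f i x) h = (\<Sum>i\<in>I. B (f i) h)"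
proof (induction I rule: infinite_finite_induct)
  case (insert i I)
  have "B (\<lambda>x. f i x + (\<Sum>i\<in>I. f i x)) h = B (f i) h + B (\<lambda>x. \<Sum>i\<in>I. f i x) h"
    using insert.prems by (intro B_add sum_mem) auto
  then show ?case using insert by simp
qed (auto simp: B_zero)

lemma B_diff_right: "f \<in> W \<Longrightarrow> g \<in> W \<Longrightarrow> h \<in> W \<Longrightarrow> B h (\<lambda>x. f x - g x) = B h f - B h g"
  by (simp add: B_diff B_commute[of h] diff_mem)

lemma B_scale_right: "f \<in> W \<Longrightarrow> h \<in> W \<Longrightarrow> B h (\<lambda>x. c *\<^sub>R f x) = c * B h f"
  by (simp add: B_scale B_commute[of h] scale_mem)

lemma Cauchy_Schwarz:
  assumes f: "f \<in> W" and g: "g \<in> W"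
  shows "(B f g)\<^sup>2 \<le> B f f * B g g"
proof -
  have quad: "0 \<le> B f f - 2 * t * B f g + t\<^sup>2 * B g g" for t
  proof -
    let ?h = "\<lambda>x. f x - t *\<^sub>R g x"
    have tg: "(\<lambda>x. t *\<^sub>R g x) \<in> W" by (rule scale_mem[OF g])
    then have h: "?h \<in> W" by (rule diff_mem[OF f])
    have "B ?h ?h = B f ?h - t * B g ?h"
      using f g tg h by (simp add: B_diff B_scale)
    also have "\<dots> = B f f - t * B f g - t * (B g f - t * B g g)"
      using f g tg by (simp add: B_diff_right B_scale_right)
    also have "\<dots> = B f f - 2 * t * B f g + t\<^sup>2 * B g g"
      using B_commute[OF f g] by (simp add: algebra_simps power2_eq_square)
    finally show ?thesis using B_nonneg[OF h] by simp
  qed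
  show ?thesis
  proof (cases "B g g = 0")
    case True
    have "B f g = 0"
    proof (rule ccontr)
      assume "B f g \<noteq> 0"
      \<comment> \<open>With \<open>B g g = 0\<close> the quadratic in t degenerates to an affine
        function; this t gives it the value -1.\<close>
      then show False using quad[of "(B f f + 1) / (2 * B f g)"] True by simp
    qed
    then show ?thesis using True by simp
  next
    case False
    then have "B g g > 0" using B_nonneg[OF g] by simp
    \<comment> \<open>The minimiser of the quadratic.\<close>
    then show ?thesis using quad[of "B f g / B g g"]
      by (simp add: field_simps power2_eq_square)
  qed
qed

text \<open>Null functions are orthogonal to all of \<open>W\<close>, so they are invisible to the
  form. All arguments modulo its kernel rest on this.\<close>

lemma B_null: "f \<in> W \<Longrightarrow> g \<in> W \<Longrightarrow> B f f = 0 \<Longrightarrow> B f g = 0"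
  using Cauchy_Schwarz[of f g] by simp

end

section \<open>Gram-Schmidt and Riesz representation modulo the kernel\<close>

definition fun_span :: "nat \<Rightarrow> (nat \<Rightarrow> 'a \<Rightarrow> 'b::real_vector) \<Rightarrow> ('a \<Rightarrow> 'b) set" where
  "fun_span N \<phi> = {v. \<exists>c. v = (\<lambda>x. \<Sum>i<N. c i *\<^sub>R \<phi> i x)}"

lemma fun_span_mem:
  fixes \<phi> :: "nat \<Rightarrow> 'a \<Rightarrow> 'b::real_vector"
  shows "(\<lambda>x. 0) \<in> fun_span N \<phi>"
    and "f \<in> fun_span N \<phi> \<Longrightarrow> g \<in> fun_span N \<phi> \<Longrightarrow> (\<lambda>x. f x + g x) \<in> fun_span N \<phi>"
    and "f \<in> fun_span N \<phi> \<Longrightarrow> (\<lambda>x. a *\<^sub>R f x) \<in> fun_span N \<phi>"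
proof -
  show "(\<lambda>x. 0) \<in> fun_span N \<phi>"
    unfolding fun_span_def by (intro CollectI exI[of _ "\<lambda>_. 0"]) simp
next
  assume fg: "f \<in> fun_span N \<phi>" "g \<in> fun_span N \<phi>"
  obtain c c' where "f = (\<lambda>x. \<Sum>i<N. c i *\<^sub>R \<phi> i x)" "g = (\<lambda>x. \<Sum>i<N. c' i *\<^sub>R \<phi> i x)"
    using fg unfolding fun_span_def by blast
  then show "(\<lambda>x. f x + g x) \<in> fun_span N \<phi>" unfolding fun_span_def
    by (intro CollectI exI[of _ "\<lambda>i. c i + c' i"]) (simp add: scaleR_add_left sum.distrib)
next
  assume f: "f \<in> fun_span N \<phi>"
  obtain c where "f = (\<lambda>x. \<Sum>i<N. c i *\<^sub>R \<phi> i x)" using f unfolding fun_span_def by blast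
  then show "(\<lambda>x. a *\<^sub>R f x) \<in> fun_span N \<phi>" unfolding fun_span_def
    by (intro CollectI exI[of _ "\<lambda>i. a * c i"]) (simp add: scaleR_sum_right)
qed

lemma (in semi_inner_space) restrict:
  assumes "U \<subseteq> W" "(\<lambda>x. 0) \<in> U" "\<And>f g. f \<in> U \<Longrightarrow> g \<in> U \<Longrightarrow> (\<lambda>x. f x + g x) \<in> U"
    "\<And>c f. f \<in> U \<Longrightarrow> (\<lambda>x. c *\<^sub>R f x) \<in> U"
  shows "semi_inner_space U B"
  using assms by unfold_locales (auto simp: B_add B_scale subset_iff intro: B_commute B_nonneg)

text \<open>Gram--Schmidt for a form that may be degenerate: the expansion holds up to the kernel
  of \<open>B\<close>, i.e. inside \<open>B\<close>.\<close>

lemma Gram_Schmidt: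
  assumes "semi_inner_space W B" "W \<subseteq> fun_span N \<phi>"
  shows "\<exists>M d. (\<forall>k<M::nat. d k \<in> W) \<and>
    (\<forall>v\<in>W. \<forall>w\<in>W. B v w = (\<Sum>k<M. B v (d k) * B (d k) w))"
  using assms
proof (induction N arbitrary: W)
  case 0
  interpret semi_inner_space W B by fact
  have "v = (\<lambda>x. 0)" if "v \<in> W" for v using that 0(2) by (auto simp: fun_span_def)
  then have "B v w = 0" if "v \<in> W" "w \<in> W" for v w using B_zero that by metis
  then show ?case by (intro exI[of _ "0::nat"]) auto
next
  case (Suc N)
  interpret semi_inner_space W B by fact
  \<comment> \<open>\<open>U\<close> collects the elements of \<open>W\<close> that the first N
    generators can express. If it is not all of \<open>W\<close>, it has codimension one, and a
    single function \<open>w0\<close> outside it completes it.\<close>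
  define U where "U = W \<inter> fun_span N \<phi>"
  have U: "semi_inner_space U B"
    by (rule restrict) (auto simp: U_def zero_mem add_mem scale_mem fun_span_mem)
  have "U \<subseteq> fun_span N \<phi>" by (simp add: U_def)
  from Suc.IH[OF U this] obtain M d where Md: "\<forall>k<M::nat. d k \<in> U"
    "\<forall>v\<in>U. \<forall>w\<in>U. B v w = (\<Sum>k<M. B v (d k) * B (d k) w)" by blast
  then have d: "\<And>k. k < M \<Longrightarrow> d k \<in> U"
    and expand: "\<And>v w. v \<in> U \<Longrightarrow> w \<in> U \<Longrightarrow> B v w = (\<Sum>k<M. B v (d k) * B (d k) w)" by blast+
  have dW: "d k \<in> W" if "k < M" for k using d that by (auto simp: U_def)
  show ?case
  proof (cases "W \<subseteq> U")
    case True
    then have "U = W" by (auto simp: U_def)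
    then show ?thesis using Md by blast
  next
    case False
    then obtain w0 where w0: "w0 \<in> W" "w0 \<notin> U" by blast
    obtain c where c: "w0 = (\<lambda>x. \<Sum>i<Suc N. c i *\<^sub>R \<phi> i x)"
      using Suc.prems(2) w0 by (auto simp: fun_span_def)
    have c0: "c N \<noteq> 0" using w0 c by (auto simp: U_def fun_span_def)
    \<comment> \<open>The orthogonal projection onto \<open>U\<close> expressed by the family
      obtained so far, and the residual of \<open>w0\<close> under it.\<close>
    define P where "P v x = (\<Sum>k<M. B v (d k) *\<^sub>R d k x)" for v x
    define r where "r x = w0 x - P w0 x" for x
    have PU: "P v \<in> U" for v
      unfolding P_def by (rule semi_inner_space.sum_mem[OF U])
        (auto intro: semi_inner_space.scale_mem[OF U] d)
    have PW: "P v \<in> W" for v using PU by (auto simp: U_def)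
    have r: "r \<in> W" unfolding r_def by (intro diff_mem w0 PW)
    have BP: "B (P v) w = (\<Sum>k<M. B v (d k) * B (d k) w)" if "w \<in> W" for v w
      unfolding P_def using that by (subst B_sum) (auto simp: B_scale dW intro: scale_mem)
    \<comment> \<open>For a degenerate form \<open>P\<close> need not fix \<open>U\<close>
      pointwise. Still \<open>u\<close> and \<open>P u\<close> differ by a null function, so it is
      enough to test \<open>r\<close> with \<open>P u\<close>.\<close>
    have orth: "B r u = 0" if "u \<in> U" for u
    proof -
      have u: "u \<in> W" using that by (simp add: U_def)
      let ?s = "\<lambda>x. u x - P u x"
      have s: "?s \<in> U" using that PU semi_inner_space.diff_mem[OF U] by blast
      have sW: "?s \<in> W" using s by (simp add: U_def)
      have null: "B ?s y = 0" if "y \<in> U" for y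
      proof -
        have "y \<in> W" using that by (simp add: U_def)
        then show ?thesis using u PW expand[OF \<open>u \<in> U\<close> that] by (simp add: B_diff BP)
      qed
      have "B r ?s = 0"
        using B_null[OF sW r null[OF s]] B_commute[OF r sW] by simp
      then have "B r u = B r (P u)" using u PW r by (simp add: B_diff_right)
      also have "\<dots> = B (P u) r" by (rule B_commute[OF r PW])
      also have "\<dots> = B (P u) w0 - B (P u) (P w0)"
        unfolding r_def by (intro B_diff_right w0 PW)
      also have "\<dots> = B (P u) w0 - B (P w0) (P u)" using B_commute[OF PW PW] by simp
      also have "\<dots> = (\<Sum>k<M. B u (d k) * B (d k) w0) - (\<Sum>k<M. B w0 (d k) * B (d k) (P u))"
        by (simp only: BP w0 PW)
      also have "(\<Sum>k<M. B w0 (d k) * B (d k) (P u)) = (\<Sum>k<M. B w0 (d k) * B u (d k))"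
      proof (rule sum.cong[OF refl])
        fix k assume "k \<in> {..<M}"
        then have k: "d k \<in> U" "d k \<in> W" using d dW by auto
        have "B (d k) (P u) = B (P u) (d k)" by (intro B_commute k PW)
        also have "\<dots> = B u (d k)" using null[OF k(1)] u PW k by (simp add: B_diff)
        finally show "B w0 (d k) * B (d k) (P u) = B w0 (d k) * B u (d k)" by simp
      qed
      also have "(\<Sum>k<M. B u (d k) * B (d k) w0) = (\<Sum>k<M. B w0 (d k) * B u (d k))"
        using B_commute[OF w0(1)] dW by (intro sum.cong) auto
      finally show ?thesis by simp
    qed
    have decomp: "\<exists>a. \<exists>u\<in>U. v = (\<lambda>x. a *\<^sub>R r x + u x)" if v: "v \<in> W" for v
    proof -
      obtain e where e: "v = (\<lambda>x. \<Sum>i<Suc N. e i *\<^sub>R \<phi> i x)"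
        using Suc.prems(2) v by (auto simp: fun_span_def)
      \<comment> \<open>Chosen so that subtracting \<open>a\<close> times \<open>w0\<close> removes
        the generator with index N from \<open>v\<close>.\<close>
      define a where "a = e N / c N"
      have "(\<lambda>x. v x - a *\<^sub>R w0 x) = (\<lambda>x. \<Sum>i<N. (e i - a * c i) *\<^sub>R \<phi> i x)"
        using c0 by (simp add: e c a_def scaleR_sum_right scaleR_diff_left sum_subtractf scaleR_add_right)
      then have "(\<lambda>x. v x - a *\<^sub>R w0 x) \<in> fun_span N \<phi>"
        unfolding fun_span_def by (intro CollectI exI[of _ "\<lambda>i. e i - a * c i"])
      moreover have "(\<lambda>x. v x - a *\<^sub>R w0 x) \<in> W" by (intro diff_mem v scale_mem w0)
      ultimately have "(\<lambda>x. v x - a *\<^sub>R w0 x) \<in> U" by (simp add: U_def)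
      then have "(\<lambda>x. (v x - a *\<^sub>R w0 x) + a *\<^sub>R P w0 x) \<in> U"
        by (intro semi_inner_space.add_mem[OF U] semi_inner_space.scale_mem[OF U] PU)
      moreover have "v = (\<lambda>x. a *\<^sub>R r x + ((v x - a *\<^sub>R w0 x) + a *\<^sub>R P w0 x))"
        by (simp add: r_def algebra_simps)
      ultimately show ?thesis
        by (intro exI[of _ a] bexI[of _ "\<lambda>x. (v x - a *\<^sub>R w0 x) + a *\<^sub>R P w0 x"])
    qed
    have BBr: "B v w = a * b * B r r + B u u'"
      if "v = (\<lambda>x. a *\<^sub>R r x + u x)" "w = (\<lambda>x. b *\<^sub>R r x + u' x)" "u \<in> U" "u' \<in> U" for v w a b u u'
    proof -
      have uW: "u \<in> W" "u' \<in> W" using that by (auto simp: U_def)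
      have ar: "(\<lambda>x. a *\<^sub>R r x) \<in> W" "(\<lambda>x. b *\<^sub>R r x) \<in> W" using scale_mem[OF r] by auto
      have wW: "w \<in> W" unfolding that by (intro add_mem ar uW)
      have "B v w = a * B w r + B w u"
        using B_commute[OF wW] wW uW ar r unfolding that(1) by (simp add: B_add B_scale)
      also have "B w r = b * B r r"
        using uW ar r orth[OF that(4)] B_commute[OF uW(2) r] unfolding that(2) by (simp add: B_add B_scale)
      also have "B w u = B u u'"
        using uW ar r orth[OF that(3)] B_commute[OF uW] unfolding that(2) by (simp add: B_add B_scale)
      finally show ?thesis by simp
    qed
    \<comment> \<open>The new member is the residual \<open>r\<close> normalised, or the zero
      function if \<open>r\<close> is null. In the latter case \<open>r\<close> contributes nothing
      to the form, so the expansion remains exact.\<close>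
    define d' where "d' k = (if k < M then d k else (\<lambda>x. (if B r r = 0 then 0 else 1 / sqrt (B r r)) *\<^sub>R r x))" for k
    have d'W: "d' k \<in> W" for k
      using dW scale_mem[OF r] by (auto simp: d'_def)
    have "B v w = (\<Sum>k<Suc M. B v (d' k) * B (d' k) w)" if vw: "v \<in> W" "w \<in> W" for v w
    proof -
      obtain a u b u' where vw': "v = (\<lambda>x. a *\<^sub>R r x + u x)" "w = (\<lambda>x. b *\<^sub>R r x + u' x)" "u \<in> U" "u' \<in> U"
        using decomp vw by meson
      let ?s = "if B r r = 0 then 0 else 1 / sqrt (B r r)"
      have d'M: "d' M = (\<lambda>x. ?s *\<^sub>R r x + 0)" by (simp add: d'_def)
      have zU: "(\<lambda>x. 0) \<in> U" by (rule semi_inner_space.zero_mem[OF U])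
      have "B v (d' M) * B (d' M) w = (a * ?s * B r r) * (?s * b * B r r)"
        using BBr[OF vw'(1) d'M vw'(3) zU] BBr[OF d'M vw'(2) zU vw'(4)] vw'(3,4) B_zero B_commute[OF _ zero_mem]
        by (auto simp: U_def)
      also have "\<dots> = a * b * B r r" using B_nonneg[OF r] by (auto simp: field_simps)
      finally have last: "B v (d' M) * B (d' M) w = a * b * B r r" .
      have "(\<Sum>k<M. B v (d' k) * B (d' k) w) = (\<Sum>k<M. B u (d k) * B (d k) u')"
      proof (rule sum.cong[OF refl])
        fix k assume "k \<in> {..<M}"
        then have k: "k < M" "d k \<in> U" using d by auto
        have dk: "d k = (\<lambda>x. 0 *\<^sub>R r x + d k x)" by simp
        show "B v (d' k) * B (d' k) w = B u (d k) * B (d k) u'"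
          using BBr[OF vw'(1) dk vw'(3) k(2)] BBr[OF dk vw'(2) k(2) vw'(4)] k by (simp add: d'_def)
      qed
      also have "\<dots> = B u u'" by (rule expand[OF vw'(3,4), symmetric])
      finally show ?thesis using last BBr[OF vw'] by simp
    qed
    then show ?thesis using d'W by (intro exI[of _ "Suc M"] exI[of _ d']) blast
  qed
qed

text \<open>The representer is the sum of \<open>l (d k)\<close> times \<open>d k\<close> over a
  Gram-Schmidt family. Since \<open>v\<close> agrees with its expansion only up to a null function,
  \<open>l\<close> has to vanish on such functions; this is the hypothesis \<open>null\<close>, i.e.
  that \<open>l\<close> factors through the quotient by the kernel.\<close>

lemma Riesz_representation:
  assumes "semi_inner_space W B" "W \<subseteq> fun_span N \<phi>"
    and add: "\<And>f g. f \<in> W \<Longrightarrow> g \<in> W \<Longrightarrow> l (\<lambda>x. f x + g x) = l f + l g"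
    and scale: "\<And>c f. f \<in> W \<Longrightarrow> l (\<lambda>x. c *\<^sub>R f x) = c * l f"
    and null: "\<And>f. f \<in> W \<Longrightarrow> B f f = 0 \<Longrightarrow> l f = 0"
  shows "\<exists>z\<in>W. \<forall>v\<in>W. B z v = (l v :: real)"
proof -
  interpret semi_inner_space W B by fact
  obtain M d where Md: "\<forall>k<M::nat. d k \<in> W"
    "\<forall>v\<in>W. \<forall>w\<in>W. B v w = (\<Sum>k<M. B v (d k) * B (d k) w)"
    using Gram_Schmidt[OF assms(1,2)] by blast
  then have d: "\<And>k. k < M \<Longrightarrow> d k \<in> W"
    and expand: "\<And>v w. v \<in> W \<Longrightarrow> w \<in> W \<Longrightarrow> B v w = (\<Sum>k<M. B v (d k) * B (d k) w)" by blast+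
  have l_sum: "l (\<lambda>x. \<Sum>k<m. f k x) = (\<Sum>k<m. l (f k))" if "\<And>k. k < m \<Longrightarrow> f k \<in> W" for f and m :: nat
    using that
  proof (induction m)
    case 0
    show ?case using scale[OF zero_mem, of 0] by simp
  next
    case (Suc m)
    then show ?case using sum_mem[of "{..<m}" f] by (simp add: add)
  qed
  define z where "z x = (\<Sum>k<M. l (d k) *\<^sub>R d k x)" for x
  have z: "z \<in> W" unfolding z_def by (rule sum_mem) (auto intro: scale_mem d)
  have "B z v = l v" if v: "v \<in> W" for v
  proof -
    define P where "P x = (\<Sum>k<M. B v (d k) *\<^sub>R d k x)" for x
    have P: "P \<in> W" unfolding P_def by (rule sum_mem) (auto intro: scale_mem d)
    have BP: "B P w = B v w" if "w \<in> W" for w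
      unfolding P_def using that d v by (subst B_sum) (auto simp: B_scale expand[of v w] intro: scale_mem)
    let ?s = "\<lambda>x. v x - P x"
    have s: "?s \<in> W" using v P by (rule diff_mem)
    have "l ?s = 0" using v P s BP by (intro null) (simp_all add: B_diff)
    then have "l v = l P" using add[OF s P] by simp
    also have "\<dots> = (\<Sum>k<M. B v (d k) * l (d k))"
      unfolding P_def using d by (subst l_sum) (auto simp: scale intro: scale_mem)
    also have "\<dots> = (\<Sum>k<M. l (d k) * B (d k) v)"
      using d v by (intro sum.cong) (auto simp: B_commute)
    also have "\<dots> = B z v"
      unfolding z_def using d v by (subst B_sum) (auto simp: B_scale intro: scale_mem)
    finally show ?thesis by simp
  qed
  then show ?thesis using z by blast
qed

text \<open>Replacing \<open>l\<close> by its Riesz representer reduces this to the expansion of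
  \<open>B\<close>. The gain is that \<open>l\<close> may come from another form, or from pairing
  with a function outside \<open>W\<close>.\<close>

lemma linear_functional_expansion:
  assumes W: "semi_inner_space W B" "W \<subseteq> fun_span N \<phi>"
    and d: "\<forall>k<M::nat. d k \<in> W"
    and expand: "\<forall>v\<in>W. \<forall>w\<in>W. B v w = (\<Sum>k<M. B v (d k) * B (d k) w)"
    and l: "\<And>f g. f \<in> W \<Longrightarrow> g \<in> W \<Longrightarrow> l (\<lambda>x. f x + g x) = l f + l g"
      "\<And>c f. f \<in> W \<Longrightarrow> l (\<lambda>x. c *\<^sub>R f x) = c * l f"
      "\<And>f. f \<in> W \<Longrightarrow> B f f = 0 \<Longrightarrow> l f = 0"
    and v: "v \<in> W"
  shows "(l v :: real) = (\<Sum>k<M. B v (d k) * l (d k))"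
proof -
  obtain z where z: "z \<in> W" "\<forall>v\<in>W. B z v = l v"
    using Riesz_representation[OF W, of l] l by blast
  have "l v = (\<Sum>k<M. B z (d k) * B (d k) v)" using z v expand by metis
  also have "\<dots> = (\<Sum>k<M. B v (d k) * l (d k))"
  proof (rule sum.cong[OF refl])
    fix k assume "k \<in> {..<M}"
    then have k: "d k \<in> W" using d by simp
    show "B z (d k) * B (d k) v = B v (d k) * l (d k)"
      using z(2) k semi_inner_space.B_commute[OF W(1) k v] by (metis mult.commute)
  qed
  finally show ?thesis .
qed

section \<open>Square-integrable fields and weak gradients\<close>

lemma L2_iff: "f \<in> L2 \<Omega> \<longleftrightarrow> f \<in> borel_measurable (lebesgue_on \<Omega>) \<and> integrable (lebesgue_on \<Omega>) (\<lambda>x. (norm (f x))\<^sup>2)"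
  by (simp add: L2_def)

lemma L2_measurable: "f \<in> L2 \<Omega> \<Longrightarrow> f \<in> borel_measurable (lebesgue_on \<Omega>)"
  by (simp add: L2_def)

lemma integrable_l2_inner:
  assumes "f \<in> L2 \<Omega>" "g \<in> L2 \<Omega>"
  shows "integrable (lebesgue_on \<Omega>) (\<lambda>x. f x \<bullet> g x)"
proof (rule Bochner_Integration.integrable_bound)
  show "integrable (lebesgue_on \<Omega>) (\<lambda>x. (norm (f x))\<^sup>2 + (norm (g x))\<^sup>2)"
    using assms by (auto simp: L2_iff)
  have "\<bar>f x \<bullet> g x\<bar> \<le> (norm (f x))\<^sup>2 + (norm (g x))\<^sup>2" for x
  proof -
    have "\<bar>f x \<bullet> g x\<bar> \<le> norm (f x) * norm (g x)" by (rule Cauchy_Schwarz_ineq2)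
    also have "\<dots> \<le> (norm (f x))\<^sup>2 + (norm (g x))\<^sup>2"
      using sum_squares_bound[of "norm (f x)" "norm (g x)"] mult_nonneg_nonneg[OF norm_ge_zero norm_ge_zero, of "f x" "g x"]
      by linarith
    finally show ?thesis .
  qed
  then show "AE x in lebesgue_on \<Omega>. norm (f x \<bullet> g x) \<le> norm ((norm (f x))\<^sup>2 + (norm (g x))\<^sup>2)"
    by (intro AE_I2) simp
qed (use assms in \<open>auto simp: L2_iff intro: borel_measurable_inner\<close>)

lemma L2_add:
  assumes "f \<in> L2 \<Omega>" "g \<in> L2 \<Omega>"
  shows "(\<lambda>x. f x + g x) \<in> L2 \<Omega>"
proof -
  have "integrable (lebesgue_on \<Omega>) (\<lambda>x. (norm (f x))\<^sup>2 + (norm (g x))\<^sup>2 + 2 * (f x \<bullet> g x))"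
    using assms integrable_l2_inner[OF assms] by (auto simp: L2_iff)
  moreover have "(norm (f x + g x))\<^sup>2 = (norm (f x))\<^sup>2 + (norm (g x))\<^sup>2 + 2 * (f x \<bullet> g x)" for x
    by (simp add: power2_norm_eq_inner inner_add_left inner_add_right inner_commute)
  ultimately show ?thesis using assms by (auto simp: L2_iff)
qed

lemma L2_scale: "f \<in> L2 \<Omega> \<Longrightarrow> (\<lambda>x. c *\<^sub>R f x) \<in> L2 \<Omega>"
  by (auto simp: L2_iff power_mult_distrib)

lemma L2_zero: "(\<lambda>x. 0) \<in> L2 \<Omega>"
  by (simp add: L2_iff)

lemma semi_inner_space_L2: "semi_inner_space (L2 \<Omega>) (l2_inner \<Omega>)"
proof
  fix f g h :: "real^'a \<Rightarrow> 'b" assume fgh: "f \<in> L2 \<Omega>" "g \<in> L2 \<Omega>" "h \<in> L2 \<Omega>"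
  show "l2_inner \<Omega> (\<lambda>x. f x + g x) h = l2_inner \<Omega> f h + l2_inner \<Omega> g h"
    using integrable_l2_inner[of _ \<Omega> h] fgh by (simp add: l2_inner_def inner_add_left)
next
  fix f h :: "real^'a \<Rightarrow> 'b" and c assume "f \<in> L2 \<Omega>" "h \<in> L2 \<Omega>"
  show "l2_inner \<Omega> (\<lambda>x. c *\<^sub>R f x) h = c * l2_inner \<Omega> f h"
    by (simp add: l2_inner_def)
next
  fix f g :: "real^'a \<Rightarrow> 'b"
  show "l2_inner \<Omega> f g = l2_inner \<Omega> g f" by (simp add: l2_inner_def inner_commute)
  show "0 \<le> l2_inner \<Omega> f f" by (simp add: l2_inner_def)
qed (auto intro: L2_add L2_scale L2_zero)

interpretation l2: semi_inner_space "L2 \<Omega>" "l2_inner \<Omega>" for \<Omega> :: "(real^'n) set"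
  by (rule semi_inner_space_L2)

lemma l2_inner_nonneg: "0 \<le> l2_inner \<Omega> f f"
  by (simp add: l2_inner_def)

lemma l2_norm_power2: "(l2_norm \<Omega> f)\<^sup>2 = l2_inner \<Omega> f f"
  by (simp add: l2_norm_def l2_inner_nonneg)

lemma l2_norm_nonneg: "0 \<le> l2_norm \<Omega> f"
  by (simp add: l2_norm_def l2_inner_nonneg)

lemma l2_inner_commute: "l2_inner \<Omega> f g = l2_inner \<Omega> g f"
  by (simp add: l2_inner_def inner_commute)

lemma l2_Cauchy_Schwarz:
  assumes "f \<in> L2 \<Omega>" "g \<in> L2 \<Omega>"
  shows "\<bar>l2_inner \<Omega> f g\<bar> \<le> l2_norm \<Omega> f * l2_norm \<Omega> g"
  using real_sqrt_le_mono[OF l2.Cauchy_Schwarz[OF assms]] by (simp add: l2_norm_def real_sqrt_mult)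

lemma l2_inner_cong:
  assumes "f \<in> L2 \<Omega>" "f' \<in> L2 \<Omega>" "g \<in> L2 \<Omega>" "g' \<in> L2 \<Omega>"
    and "AE x in lebesgue_on \<Omega>. f x = f' x" "AE x in lebesgue_on \<Omega>. g x = g' x"
  shows "l2_inner \<Omega> f g = l2_inner \<Omega> f' g'"
  unfolding l2_inner_def
proof (rule integral_cong_AE)
  show "AE x in lebesgue_on \<Omega>. f x \<bullet> g x = f' x \<bullet> g' x"
    using assms(5,6) by eventually_elim simp
qed (use assms L2_measurable in \<open>auto intro!: borel_measurable_inner\<close>)

lemma l2_inner_cong_on:
  assumes "\<And>x. x \<in> \<Omega> \<Longrightarrow> f x = f' x" "\<And>x. x \<in> \<Omega> \<Longrightarrow> g x = g' x"
  shows "l2_inner \<Omega> f g = l2_inner \<Omega> f' g'"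
  unfolding l2_inner_def using assms by (intro Bochner_Integration.integral_cong) (auto simp: space_restrict_space)

lemma L2_cong_on:
  assumes "\<And>x. x \<in> \<Omega> \<Longrightarrow> f x = f' x" "f \<in> L2 \<Omega>"
  shows "f' \<in> L2 \<Omega>"
proof -
  have sp: "x \<in> \<Omega>" if "x \<in> space (lebesgue_on \<Omega>)" for x using that by (simp add: space_restrict_space)
  have "f \<in> borel_measurable (lebesgue_on \<Omega>) \<longleftrightarrow> f' \<in> borel_measurable (lebesgue_on \<Omega>)"
    by (rule measurable_cong) (simp add: assms(1) sp)
  moreover have "integrable (lebesgue_on \<Omega>) (\<lambda>x. (norm (f x))\<^sup>2) \<longleftrightarrow> integrable (lebesgue_on \<Omega>) (\<lambda>x. (norm (f' x))\<^sup>2)"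
    by (rule Bochner_Integration.integrable_cong) (simp_all add: assms(1) sp)
  ultimately show ?thesis using assms(2) by (simp add: L2_iff)
qed

lemma L2_component: "f \<in> L2 \<Omega> \<Longrightarrow> (\<lambda>x. f x $ i) \<in> L2 \<Omega>"
  for f :: "real^'n \<Rightarrow> ('b::euclidean_space)^'m"
proof -
  assume f: "f \<in> L2 \<Omega>"
  have m: "(\<lambda>x. f x $ i) \<in> borel_measurable (lebesgue_on \<Omega>)"
    using L2_measurable[OF f] by (rule borel_measurable_continuous_on[where f = "\<lambda>y. y $ i", rotated])
      (intro continuous_intros)
  have "integrable (lebesgue_on \<Omega>) (\<lambda>x. (norm (f x $ i))\<^sup>2)"
  proof (rule Bochner_Integration.integrable_bound)
    show "integrable (lebesgue_on \<Omega>) (\<lambda>x. (norm (f x))\<^sup>2)" using f by (simp add: L2_iff)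
    show "AE x in lebesgue_on \<Omega>. norm ((norm (f x $ i))\<^sup>2) \<le> norm ((norm (f x))\<^sup>2)"
      by (intro AE_I2) (simp add: power_mono Finite_Cartesian_Product.norm_nth_le)
  qed (use m in auto)
  then show ?thesis using m by (simp add: L2_iff)
qed

lemma L2_vec:
  fixes f :: "real^'n \<Rightarrow> ('b::euclidean_space)^'m"
  assumes f: "\<And>i. (\<lambda>x. f x $ i) \<in> L2 \<Omega>"
  shows "f \<in> L2 \<Omega>"
proof -
  have m: "f \<in> borel_measurable (lebesgue_on \<Omega>)"
  proof (subst borel_measurable_euclidean_space, rule ballI)
    fix b :: "'b^'m" assume "b \<in> Basis"
    then obtain i u where "b = axis i u" by (auto simp: Basis_vec_def)
    then show "(\<lambda>x. f x \<bullet> b) \<in> borel_measurable (lebesgue_on \<Omega>)"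
      using L2_measurable[OF f[of i]] by (auto simp: inner_axis)
  qed
  have "(norm (f x))\<^sup>2 = (\<Sum>i\<in>UNIV. (norm (f x $ i))\<^sup>2)" for x
    by (simp add: power2_norm_eq_inner inner_vec_def)
  then show ?thesis using m f by (simp add: L2_iff)
qed

lemma l2_inner_vec:
  fixes f g :: "real^'n \<Rightarrow> ('b::euclidean_space)^'m"
  assumes "f \<in> L2 \<Omega>" "g \<in> L2 \<Omega>"
  shows "l2_inner \<Omega> f g = (\<Sum>i\<in>UNIV. l2_inner \<Omega> (\<lambda>x. f x $ i) (\<lambda>x. g x $ i))"
  unfolding l2_inner_def inner_vec_def
  by (rule Bochner_Integration.integral_sum) (intro integrable_l2_inner L2_component assms)

lemma l2_norm_component_le:
  fixes f :: "real^'n \<Rightarrow> ('b::euclidean_space)^'m"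
  assumes "f \<in> L2 \<Omega>"
  shows "l2_norm \<Omega> (\<lambda>x. f x $ i) \<le> l2_norm \<Omega> f"
  unfolding l2_norm_def l2_inner_vec[OF assms assms]
  by (rule real_sqrt_le_mono, rule member_le_sum) (auto simp: l2_inner_nonneg)

lemma L2_bounded_continuous:
  fixes f :: "real^'n \<Rightarrow> 'b::euclidean_space"
  assumes \<Omega>: "open \<Omega>" "bounded \<Omega>" and f: "continuous_on \<Omega> f" and M: "\<And>x. x \<in> \<Omega> \<Longrightarrow> norm (f x) \<le> M"
  shows "f \<in> L2 \<Omega>"
proof -
  have m: "f \<in> borel_measurable (lebesgue_on \<Omega>)"
    by (rule continuous_imp_measurable_on_sets_lebesgue[OF f]) (use \<Omega> in auto)
  interpret finite_measure "lebesgue_on \<Omega>"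
    using \<Omega> by (intro finite_measure_lebesgue_on) (simp add: bounded_set_imp_lmeasurable)
  have "integrable (lebesgue_on \<Omega>) (\<lambda>x. (norm (f x))\<^sup>2)"
  proof (rule integrable_const_bound[where B = "M\<^sup>2"])
    show "AE x in lebesgue_on \<Omega>. norm ((norm (f x))\<^sup>2) \<le> M\<^sup>2"
      using M by (intro AE_I2) (simp add: space_restrict_space power_mono)
  qed (use m in auto)
  then show ?thesis using m by (simp add: L2_iff)
qed

lemma L2_imp_integrable:
  fixes f :: "real^'n \<Rightarrow> 'b::euclidean_space"
  assumes \<Omega>: "open \<Omega>" "bounded \<Omega>" and f: "f \<in> L2 \<Omega>"
  shows "integrable (lebesgue_on \<Omega>) f"
proof -
  interpret finite_measure "lebesgue_on \<Omega>"
    using \<Omega> by (intro finite_measure_lebesgue_on) (simp add: bounded_set_imp_lmeasurable)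
  show ?thesis
  proof (rule Bochner_Integration.integrable_bound)
    show "integrable (lebesgue_on \<Omega>) (\<lambda>x. 1 + (norm (f x))\<^sup>2)" using f by (auto simp: L2_iff)
    have "norm (f x) \<le> 1 + (norm (f x))\<^sup>2" for x
      using zero_le_power2[of "norm (f x) - 1/2"] by (simp add: power2_eq_square algebra_simps)
    then show "AE x in lebesgue_on \<Omega>. norm (f x) \<le> norm (1 + (norm (f x))\<^sup>2)"
      by (intro AE_I2) simp
  qed (rule L2_measurable[OF f])
qed

lemma L2_test_function:
  assumes \<Omega>: "open \<Omega>" and \<phi>: "test_function \<Omega> \<phi>"
  shows "\<phi> \<in> L2 \<Omega>" "partial j \<phi> \<in> L2 \<Omega>"
proof -
  have L2I: "f \<in> L2 \<Omega>" if c: "continuous_on UNIV f" and z: "\<And>x. x \<notin> closure {x. \<phi> x \<noteq> 0} \<Longrightarrow> f x = 0"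
    for f :: "real^'a \<Rightarrow> real"
  proof -
    have "continuous_on \<Omega> f" using c by (rule continuous_on_subset) auto
    then have "f \<in> borel_measurable (lebesgue_on \<Omega>)"
      by (rule continuous_imp_measurable_on_sets_lebesgue) (use \<Omega> in auto)
    moreover have "integrable (lebesgue_on \<Omega>) (\<lambda>x. (norm (f x))\<^sup>2)"
      by (rule integrable_on_compact_support[OF \<Omega>, of _ "closure {x. \<phi> x \<noteq> 0}"])
         (use \<phi> z \<open>continuous_on \<Omega> f\<close> in \<open>auto simp: test_function_def intro!: continuous_intros\<close>)
    ultimately show ?thesis by (simp add: L2_iff)
  qed
  show "\<phi> \<in> L2 \<Omega>" "partial j \<phi> \<in> L2 \<Omega>"
    by (rule L2I[OF test_functionD(2)[OF \<phi>] test_functionD(4)[OF \<phi>]], assumption)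
       (rule L2I[OF test_functionD(3)[OF \<phi>] test_functionD(5)[OF \<phi>]], assumption)
qed

lemma L2_grad_test_function: "open \<Omega> \<Longrightarrow> test_function \<Omega> \<phi> \<Longrightarrow> grad \<phi> \<in> L2 \<Omega>"
  by (rule L2_vec) (simp add: grad_def L2_test_function(2))

section \<open>Weak gradients of scalar functions\<close>

lemma has_weak_gradient_iff:
  "has_weak_gradient \<Omega> f g \<longleftrightarrow> f \<in> L2 \<Omega> \<and> g \<in> L2 \<Omega> \<and>
     (\<forall>\<phi> j. test_function \<Omega> \<phi> \<longrightarrow> l2_inner \<Omega> f (partial j \<phi>) = - l2_inner \<Omega> (\<lambda>x. g x $ j) \<phi>)"
  by (simp add: has_weak_gradient_def l2_inner_def)

text \<open>The two functions need to agree only almost everywhere. This covers both different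
  gradient representatives of one function and functions that are null without being zero.\<close>

lemma has_weak_gradient_unique:
  assumes \<Omega>: "open \<Omega>" "bounded \<Omega>"
    and g: "has_weak_gradient \<Omega> f g" and g': "has_weak_gradient \<Omega> f' g'"
    and eq: "AE x in lebesgue_on \<Omega>. f x = f' x"
  shows "AE x in lebesgue_on \<Omega>. g x = g' x"
proof -
  note D = g[unfolded has_weak_gradient_iff] g'[unfolded has_weak_gradient_iff]
  have "AE x in lebesgue_on \<Omega>. g x $ j - g' x $ j = 0" for j
  proof (rule fundamental_lemma_calculus_of_variations[OF \<Omega>(1)])
    have gj: "(\<lambda>x. g x $ j) \<in> L2 \<Omega>" "(\<lambda>x. g' x $ j) \<in> L2 \<Omega>" using D by (auto intro: L2_component)
    then have d: "(\<lambda>x. g x $ j - g' x $ j) \<in> L2 \<Omega>" by (rule l2.diff_mem)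
    then show "integrable (lebesgue_on \<Omega>) (\<lambda>x. g x $ j - g' x $ j)" by (rule L2_imp_integrable[OF \<Omega>])
    fix \<phi> assume \<phi>: "test_function \<Omega> \<phi>"
    note L = L2_test_function[OF \<Omega>(1) \<phi>]
    have "l2_inner \<Omega> (\<lambda>x. g x $ j - g' x $ j) \<phi> = l2_inner \<Omega> (\<lambda>x. g x $ j) \<phi> - l2_inner \<Omega> (\<lambda>x. g' x $ j) \<phi>"
      by (rule l2.B_diff[OF gj L(1)])
    also have "\<dots> = l2_inner \<Omega> f' (partial j \<phi>) - l2_inner \<Omega> f (partial j \<phi>)"
      using D \<phi> by simp
    also have "\<dots> = 0" using l2_inner_cong[of f \<Omega> f' "partial j \<phi>" "partial j \<phi>"] D L eq by simp
    finally show "(LINT x|lebesgue_on \<Omega>. (g x $ j - g' x $ j) * \<phi> x) = 0" by (simp add: l2_inner_def)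
  qed
  then have "AE x in lebesgue_on \<Omega>. \<forall>j. g x $ j - g' x $ j = 0" by (simp add: AE_all_countable)
  then show ?thesis by eventually_elim (simp add: vec_eq_iff)
qed

lemma has_weak_gradient_weak_grad: "f \<in> H1 \<Omega> \<Longrightarrow> has_weak_gradient \<Omega> f (weak_grad \<Omega> f)"
  unfolding H1_def weak_grad_def by (rule someI_ex[of "has_weak_gradient \<Omega> f"]) simp

lemma weak_grad_eq_AE:
  assumes "open \<Omega>" "bounded \<Omega>" "has_weak_gradient \<Omega> f g"
  shows "AE x in lebesgue_on \<Omega>. weak_grad \<Omega> f x = g x"
proof -
  have "f \<in> H1 \<Omega>" using assms(3) by (auto simp: H1_def)
  from has_weak_gradient_weak_grad[OF this] assms show ?thesis
    by (intro has_weak_gradient_unique[of \<Omega> f _ f]) auto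
qed

lemma has_weak_gradient_add:
  assumes "open \<Omega>" and g: "has_weak_gradient \<Omega> f g" and g': "has_weak_gradient \<Omega> f' g'"
  shows "has_weak_gradient \<Omega> (\<lambda>x. f x + f' x) (\<lambda>x. g x + g' x)"
  unfolding has_weak_gradient_iff
proof (intro conjI allI impI)
  note D = g[unfolded has_weak_gradient_iff] g'[unfolded has_weak_gradient_iff]
  show "(\<lambda>x. f x + f' x) \<in> L2 \<Omega>" "(\<lambda>x. g x + g' x) \<in> L2 \<Omega>"
    using D by (blast intro: L2_add)+
  fix \<phi> j assume \<phi>: "test_function \<Omega> \<phi>"
  note T = L2_test_function[OF assms(1) \<phi>]
  have "l2_inner \<Omega> (\<lambda>x. g x $ j + g' x $ j) \<phi> = l2_inner \<Omega> (\<lambda>x. g x $ j) \<phi> + l2_inner \<Omega> (\<lambda>x. g' x $ j) \<phi>"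
    using D by (intro l2.B_add L2_component T) auto
  moreover have "l2_inner \<Omega> (\<lambda>x. f x + f' x) (partial j \<phi>) = l2_inner \<Omega> f (partial j \<phi>) + l2_inner \<Omega> f' (partial j \<phi>)"
    using D by (intro l2.B_add T) auto
  ultimately show "l2_inner \<Omega> (\<lambda>x. f x + f' x) (partial j \<phi>) = - l2_inner \<Omega> (\<lambda>x. (g x + g' x) $ j) \<phi>"
    using D \<phi> by simp
qed

lemma has_weak_gradient_scale:
  assumes "open \<Omega>" and g: "has_weak_gradient \<Omega> f g"
  shows "has_weak_gradient \<Omega> (\<lambda>x. c *\<^sub>R f x) (\<lambda>x. c *\<^sub>R g x)"
  unfolding has_weak_gradient_iff
proof (intro conjI allI impI)
  note D = g[unfolded has_weak_gradient_iff]
  show "(\<lambda>x. c *\<^sub>R f x) \<in> L2 \<Omega>" "(\<lambda>x. c *\<^sub>R g x) \<in> L2 \<Omega>"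
    using D by (blast intro: L2_scale)+
  fix \<phi> j assume \<phi>: "test_function \<Omega> \<phi>"
  note T = L2_test_function[OF assms(1) \<phi>]
  have "l2_inner \<Omega> (\<lambda>x. c *\<^sub>R (g x $ j)) \<phi> = c * l2_inner \<Omega> (\<lambda>x. g x $ j) \<phi>"
    using D by (intro l2.B_scale L2_component T) auto
  moreover have "l2_inner \<Omega> (\<lambda>x. c *\<^sub>R f x) (partial j \<phi>) = c * l2_inner \<Omega> f (partial j \<phi>)"
    using D by (intro l2.B_scale T) auto
  ultimately show "l2_inner \<Omega> (\<lambda>x. c *\<^sub>R f x) (partial j \<phi>) = - l2_inner \<Omega> (\<lambda>x. (c *\<^sub>R g x) $ j) \<phi>"
    using D \<phi> by simp
qed

text \<open>The defect of the identity is continuous in \<open>v\<close> for the H1 norm and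
  vanishes for test functions by hypothesis; these are dense in
  \<open>H1_0 \<Omega>\<close>.\<close>

lemma H1_0_weak_parts:
  assumes \<Omega>: "open \<Omega>" and v: "v \<in> H1_0 \<Omega>" and L: "\<psi> \<in> L2 \<Omega>" "\<eta> \<in> L2 \<Omega>"
    and parts: "\<And>\<phi>. test_function \<Omega> \<phi> \<Longrightarrow> l2_inner \<Omega> \<psi> (partial j \<phi>) = - l2_inner \<Omega> \<eta> \<phi>"
  shows "l2_inner \<Omega> \<psi> (\<lambda>x. weak_grad \<Omega> v x $ j) = - l2_inner \<Omega> \<eta> v"
proof -
  have "has_weak_gradient \<Omega> v (weak_grad \<Omega> v)"
    using v by (intro has_weak_gradient_weak_grad) (simp add: H1_0_def)
  then have vL: "v \<in> L2 \<Omega>" "weak_grad \<Omega> v \<in> L2 \<Omega>" by (auto simp: has_weak_gradient_iff)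
  define d where "d = l2_inner \<Omega> \<psi> (\<lambda>x. weak_grad \<Omega> v x $ j) + l2_inner \<Omega> \<eta> v"
  define C where "C = l2_norm \<Omega> \<psi> + l2_norm \<Omega> \<eta>"
  have C: "0 \<le> C" by (simp add: C_def l2_norm_nonneg)
  have bound: "\<bar>d\<bar> \<le> C * \<epsilon>" if "\<epsilon> > 0" for \<epsilon>
  proof -
    have "\<epsilon>\<^sup>2 > 0" using that by simp
    then obtain \<phi> where \<phi>: "test_function \<Omega> \<phi>" and small: "(l2_norm \<Omega> (\<lambda>x. v x - \<phi> x))\<^sup>2 +
        (l2_norm \<Omega> (\<lambda>x. weak_grad \<Omega> v x - grad \<phi> x))\<^sup>2 < \<epsilon>\<^sup>2"
      using v unfolding H1_0_def by blast
    note T = L2_test_function[OF \<Omega> \<phi>] L2_grad_test_function[OF \<Omega> \<phi>]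
    have "(l2_norm \<Omega> (\<lambda>x. v x - \<phi> x))\<^sup>2 \<le> \<epsilon>\<^sup>2" "(l2_norm \<Omega> (\<lambda>x. weak_grad \<Omega> v x - grad \<phi> x))\<^sup>2 \<le> \<epsilon>\<^sup>2"
      using small zero_le_power2 by (smt (verit))+
    then have s: "l2_norm \<Omega> (\<lambda>x. v x - \<phi> x) \<le> \<epsilon>" "l2_norm \<Omega> (\<lambda>x. weak_grad \<Omega> v x - grad \<phi> x) \<le> \<epsilon>"
      using that by (auto intro: power2_le_imp_le)
    have gd: "(\<lambda>x. weak_grad \<Omega> v x - grad \<phi> x) \<in> L2 \<Omega>" by (rule l2.diff_mem[OF vL(2) T(3)])
    have "l2_norm \<Omega> (\<lambda>x. weak_grad \<Omega> v x $ j - partial j \<phi> x) \<le> \<epsilon>"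
      using l2_norm_component_le[OF gd, of j] s(2) by (simp add: grad_def)
    then have "\<bar>l2_inner \<Omega> \<psi> (\<lambda>x. weak_grad \<Omega> v x $ j - partial j \<phi> x)\<bar> \<le> l2_norm \<Omega> \<psi> * \<epsilon>"
      using l2_Cauchy_Schwarz[OF L(1) l2.diff_mem[OF L2_component[OF vL(2)] T(2)], of j j]
        mult_left_mono[OF _ l2_norm_nonneg] by (meson order_trans)
    moreover have "\<bar>l2_inner \<Omega> \<eta> (\<lambda>x. v x - \<phi> x)\<bar> \<le> l2_norm \<Omega> \<eta> * \<epsilon>"
      using l2_Cauchy_Schwarz[OF L(2) l2.diff_mem[OF vL(1) T(1)]] s(1)
        mult_left_mono[OF _ l2_norm_nonneg] by (meson order_trans)
    \<comment> \<open>A test function has no defect, so the defect of \<open>v\<close> is that of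
      \<open>v - \<phi>\<close>, which is small.\<close>
    moreover have "d = l2_inner \<Omega> \<psi> (\<lambda>x. weak_grad \<Omega> v x $ j - partial j \<phi> x) + l2_inner \<Omega> \<eta> (\<lambda>x. v x - \<phi> x)"
      using parts[OF \<phi>] l2.B_diff_right[OF L2_component[OF vL(2)] T(2) L(1), of j j]
        l2.B_diff_right[OF vL(1) T(1) L(2)] by (simp add: d_def)
    ultimately show ?thesis by (simp add: C_def algebra_simps)
  qed
  have "\<bar>d\<bar> \<le> 0"
  proof (rule field_le_epsilon)
    fix e :: real assume "e > 0"
    \<comment> \<open>The denominator is C + 1 because \<open>C\<close> may be zero.\<close>
    have "\<bar>d\<bar> \<le> C * (e / (C + 1))" using C \<open>e > 0\<close> by (intro bound) simp
    also have "\<dots> \<le> e" using C \<open>e > 0\<close> by (simp add: field_simps)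
    finally show "\<bar>d\<bar> \<le> 0 + e" by simp
  qed
  then show ?thesis by (simp add: d_def)
qed

lemma has_weak_gradient_classical:
  fixes f :: "real^'n \<Rightarrow> real"
  assumes "open \<Omega>" "\<And>x. x \<in> \<Omega> \<Longrightarrow> f differentiable (at x)"
    and "\<And>j. continuous_on \<Omega> (partial j f)" "f \<in> L2 \<Omega>" "\<And>j. partial j f \<in> L2 \<Omega>"
  shows "has_weak_gradient \<Omega> f (grad f)"
proof -
  have "grad f \<in> L2 \<Omega>" using assms(5) by (intro L2_vec) (simp add: grad_def)
  then show ?thesis
    using assms integration_by_parts_test_function[OF assms(1,2)]
    by (simp add: has_weak_gradient_def grad_def)
qed

section \<open>Vector fields and the form given by their gradients\<close>

definition H1_vec :: "(real^'n) set \<Rightarrow> (real^'n \<Rightarrow> real^'n) set" where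
  "H1_vec \<Omega> = {v. \<forall>i. (\<lambda>x. v x $ i) \<in> H1 \<Omega>}"

definition grad_inner :: "(real^'n) set \<Rightarrow> (real^'n \<Rightarrow> real^'n) \<Rightarrow> (real^'n \<Rightarrow> real^'n) \<Rightarrow> real" where
  "grad_inner \<Omega> v w = l2_inner \<Omega> (weak_grad_vec \<Omega> v) (weak_grad_vec \<Omega> w)"

locale bounded_open =
  fixes \<Omega> :: "(real^'n) set"
  assumes open_dom: "open \<Omega>" and bounded_dom: "bounded \<Omega>"
begin

lemma H1_vecI:
  assumes "\<And>i. has_weak_gradient \<Omega> (\<lambda>x. v x $ i) (\<lambda>x. G x $ i)"
  shows "v \<in> H1_vec \<Omega>"
  using assms by (auto simp: H1_vec_def H1_def)

lemma has_weak_gradient_component: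
  assumes "v \<in> H1_vec \<Omega>"
  shows "has_weak_gradient \<Omega> (\<lambda>x. v x $ i) (\<lambda>x. weak_grad_vec \<Omega> v x $ i)"
proof -
  have "(\<lambda>x. v x $ i) \<in> H1 \<Omega>" using assms by (simp add: H1_vec_def)
  from has_weak_gradient_weak_grad[OF this] show ?thesis by (simp add: weak_grad_vec_def)
qed

lemma weak_grad_vec_eq_AE:
  assumes "\<And>i. has_weak_gradient \<Omega> (\<lambda>x. v x $ i) (\<lambda>x. G x $ i)"
  shows "AE x in lebesgue_on \<Omega>. weak_grad_vec \<Omega> v x = G x"
proof -
  have "AE x in lebesgue_on \<Omega>. weak_grad \<Omega> (\<lambda>x. v x $ i) x = G x $ i" for i
    by (rule weak_grad_eq_AE[OF open_dom bounded_dom assms])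
  then have "AE x in lebesgue_on \<Omega>. \<forall>i. weak_grad \<Omega> (\<lambda>x. v x $ i) x = G x $ i"
    by (simp add: AE_all_countable)
  then show ?thesis by eventually_elim (simp add: weak_grad_vec_def vec_eq_iff)
qed

lemma H1_vec_L2: "v \<in> H1_vec \<Omega> \<Longrightarrow> v \<in> L2 \<Omega>"
  by (rule L2_vec) (use has_weak_gradient_component in \<open>simp add: has_weak_gradient_iff\<close>)

lemma weak_grad_vec_L2: "v \<in> H1_vec \<Omega> \<Longrightarrow> weak_grad_vec \<Omega> v \<in> L2 \<Omega>"
  by (rule L2_vec) (use has_weak_gradient_component in \<open>simp add: has_weak_gradient_iff\<close>)

lemma weak_grad_vec_add:
  assumes "v \<in> H1_vec \<Omega>" "w \<in> H1_vec \<Omega>"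
  shows "(\<lambda>x. v x + w x) \<in> H1_vec \<Omega>"
    and "AE x in lebesgue_on \<Omega>. weak_grad_vec \<Omega> (\<lambda>x. v x + w x) x = weak_grad_vec \<Omega> v x + weak_grad_vec \<Omega> w x"
proof -
  have "has_weak_gradient \<Omega> (\<lambda>x. (v x + w x) $ i) (\<lambda>x. (weak_grad_vec \<Omega> v x + weak_grad_vec \<Omega> w x) $ i)" for i
    using has_weak_gradient_add[OF open_dom has_weak_gradient_component[OF assms(1)] has_weak_gradient_component[OF assms(2)], of i i]
    by simp
  then show "(\<lambda>x. v x + w x) \<in> H1_vec \<Omega>"
    "AE x in lebesgue_on \<Omega>. weak_grad_vec \<Omega> (\<lambda>x. v x + w x) x = weak_grad_vec \<Omega> v x + weak_grad_vec \<Omega> w x"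
    by (rule H1_vecI, rule weak_grad_vec_eq_AE)
qed

lemma weak_grad_vec_scale:
  assumes "v \<in> H1_vec \<Omega>"
  shows "(\<lambda>x. c *\<^sub>R v x) \<in> H1_vec \<Omega>"
    and "AE x in lebesgue_on \<Omega>. weak_grad_vec \<Omega> (\<lambda>x. c *\<^sub>R v x) x = c *\<^sub>R weak_grad_vec \<Omega> v x"
proof -
  have "has_weak_gradient \<Omega> (\<lambda>x. (c *\<^sub>R v x) $ i) (\<lambda>x. (c *\<^sub>R weak_grad_vec \<Omega> v x) $ i)" for i
    using has_weak_gradient_scale[OF open_dom has_weak_gradient_component[OF assms(1)], of c i] by simp
  then show "(\<lambda>x. c *\<^sub>R v x) \<in> H1_vec \<Omega>"
    "AE x in lebesgue_on \<Omega>. weak_grad_vec \<Omega> (\<lambda>x. c *\<^sub>R v x) x = c *\<^sub>R weak_grad_vec \<Omega> v x"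
    by (rule H1_vecI, rule weak_grad_vec_eq_AE)
qed

lemma H1_vec_zero: "(\<lambda>x. 0) \<in> H1_vec \<Omega>"
  by (rule H1_vecI[where G = "\<lambda>x. 0"]) (simp add: has_weak_gradient_iff L2_zero l2_inner_def)

lemma semi_inner_space_grad: "semi_inner_space (H1_vec \<Omega>) (grad_inner \<Omega>)"
proof
  fix f g h assume fgh: "f \<in> H1_vec \<Omega>" "g \<in> H1_vec \<Omega>" "h \<in> H1_vec \<Omega>"
  note L = fgh[THEN weak_grad_vec_L2]
  have "grad_inner \<Omega> (\<lambda>x. f x + g x) h
      = l2_inner \<Omega> (\<lambda>x. weak_grad_vec \<Omega> f x + weak_grad_vec \<Omega> g x) (weak_grad_vec \<Omega> h)"
    unfolding grad_inner_def
    by (rule l2_inner_cong)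
       (use L weak_grad_vec_L2[OF weak_grad_vec_add(1)] weak_grad_vec_add(2) fgh in \<open>auto intro: L2_add\<close>)
  also have "\<dots> = grad_inner \<Omega> f h + grad_inner \<Omega> g h"
    unfolding grad_inner_def by (rule l2.B_add[OF L])
  finally show "grad_inner \<Omega> (\<lambda>x. f x + g x) h = grad_inner \<Omega> f h + grad_inner \<Omega> g h" .
next
  fix f h c assume fh: "f \<in> H1_vec \<Omega>" "h \<in> H1_vec \<Omega>"
  note L = fh[THEN weak_grad_vec_L2]
  have "grad_inner \<Omega> (\<lambda>x. c *\<^sub>R f x) h
      = l2_inner \<Omega> (\<lambda>x. c *\<^sub>R weak_grad_vec \<Omega> f x) (weak_grad_vec \<Omega> h)"
    unfolding grad_inner_def
    by (rule l2_inner_cong)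
       (use L weak_grad_vec_L2[OF weak_grad_vec_scale(1)] weak_grad_vec_scale(2) fh in \<open>auto intro: L2_scale\<close>)
  also have "\<dots> = c * grad_inner \<Omega> f h"
    unfolding grad_inner_def by (rule l2.B_scale[OF L])
  finally show "grad_inner \<Omega> (\<lambda>x. c *\<^sub>R f x) h = c * grad_inner \<Omega> f h" .
qed (auto simp: grad_inner_def l2_inner_nonneg H1_vec_zero intro: l2_inner_commute weak_grad_vec_add weak_grad_vec_scale)

sublocale grad: semi_inner_space "H1_vec \<Omega>" "grad_inner \<Omega>"
  by (rule semi_inner_space_grad)

lemma l2_inner_eq_0_imp_AE:
  fixes v :: "real^'n \<Rightarrow> 'b::euclidean_space"
  assumes "v \<in> L2 \<Omega>" "l2_inner \<Omega> v v = 0"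
  shows "AE x in lebesgue_on \<Omega>. v x = 0"
proof -
  have "AE x in lebesgue_on \<Omega>. v x \<bullet> v x = 0"
    using assms integrable_l2_inner[OF assms(1,1)] unfolding l2_inner_def
    by (subst (asm) integral_nonneg_eq_0_iff_AE) auto
  then show ?thesis by eventually_elim simp
qed

text \<open>A field that is null in L2 has an almost everywhere vanishing gradient, by uniqueness
  against the zero function. So the gradient product respects L2 classes, and it may be expanded
  along a family that is orthonormal for the L2 product.\<close>

lemma grad_inner_null:
  assumes v: "v \<in> H1_vec \<Omega>" and "l2_inner \<Omega> v v = 0" and w: "w \<in> H1_vec \<Omega>"
  shows "grad_inner \<Omega> v w = 0"
proof -
  have "AE x in lebesgue_on \<Omega>. v x = 0"
    using H1_vec_L2[OF v] assms(2) by (rule l2_inner_eq_0_imp_AE)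
  then have "AE x in lebesgue_on \<Omega>. v x $ i = 0" for i by eventually_elim simp
  moreover have "has_weak_gradient \<Omega> (\<lambda>x. 0) (\<lambda>x. 0)"
    by (simp add: has_weak_gradient_iff L2_zero l2_inner_def)
  ultimately have "AE x in lebesgue_on \<Omega>. weak_grad_vec \<Omega> v x $ i = 0" for i
    by (intro has_weak_gradient_unique[OF open_dom bounded_dom has_weak_gradient_component[OF v]])
  then have "AE x in lebesgue_on \<Omega>. \<forall>i. weak_grad_vec \<Omega> v x $ i = 0" by (simp add: AE_all_countable)
  then have "AE x in lebesgue_on \<Omega>. weak_grad_vec \<Omega> v x = 0" by eventually_elim (simp add: vec_eq_iff)
  then have "grad_inner \<Omega> v w = l2_inner \<Omega> (\<lambda>x. 0) (weak_grad_vec \<Omega> w)"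
    unfolding grad_inner_def by (intro l2_inner_cong weak_grad_vec_L2 v w L2_zero) auto
  then show ?thesis by (simp add: l2_inner_def)
qed

lemma weak_div_L2:
  assumes "v \<in> H1_vec \<Omega>"
  shows "weak_div \<Omega> v \<in> L2 \<Omega>"
proof -
  have "(\<lambda>x. \<Sum>i\<in>UNIV. weak_grad_vec \<Omega> v x $ i $ i) \<in> L2 \<Omega>"
    by (intro l2.sum_mem L2_component weak_grad_vec_L2 assms)
  then show ?thesis by (simp add: weak_div_def[abs_def] trace_def)
qed

lemma weak_div_add:
  assumes "v \<in> H1_vec \<Omega>" "w \<in> H1_vec \<Omega>" "q \<in> L2 \<Omega>"
  shows "l2_inner \<Omega> (weak_div \<Omega> (\<lambda>x. v x + w x)) q = l2_inner \<Omega> (weak_div \<Omega> v) q + l2_inner \<Omega> (weak_div \<Omega> w) q"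
proof -
  have "AE x in lebesgue_on \<Omega>. weak_div \<Omega> (\<lambda>x. v x + w x) x = weak_div \<Omega> v x + weak_div \<Omega> w x"
    using weak_grad_vec_add(2)[OF assms(1,2)] by eventually_elim (simp add: weak_div_def trace_add)
  then have "l2_inner \<Omega> (weak_div \<Omega> (\<lambda>x. v x + w x)) q = l2_inner \<Omega> (\<lambda>x. weak_div \<Omega> v x + weak_div \<Omega> w x) q"
    by (intro l2_inner_cong L2_add weak_div_L2 weak_grad_vec_add assms) auto
  then show ?thesis using weak_div_L2 assms by (simp add: l2.B_add)
qed

lemma weak_div_scale:
  assumes "v \<in> H1_vec \<Omega>" "q \<in> L2 \<Omega>"
  shows "l2_inner \<Omega> (weak_div \<Omega> (\<lambda>x. c *\<^sub>R v x)) q = c * l2_inner \<Omega> (weak_div \<Omega> v) q"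
proof -
  have "AE x in lebesgue_on \<Omega>. weak_div \<Omega> (\<lambda>x. c *\<^sub>R v x) x = c *\<^sub>R weak_div \<Omega> v x"
    using weak_grad_vec_scale(2)[OF assms(1), of c]
    by eventually_elim (simp add: weak_div_def trace_def sum_distrib_left)
  then have "l2_inner \<Omega> (weak_div \<Omega> (\<lambda>x. c *\<^sub>R v x)) q = l2_inner \<Omega> (\<lambda>x. c *\<^sub>R weak_div \<Omega> v x) q"
    by (intro l2_inner_cong L2_scale weak_div_L2 weak_grad_vec_scale assms) auto
  also have "\<dots> = c * l2_inner \<Omega> (weak_div \<Omega> v) q"
    by (intro l2.B_scale weak_div_L2 assms)
  finally show ?thesis .
qed

end

section \<open>Discretely divergence-free functions and the two projections\<close>

locale conforming = bounded_open \<Omega> for \<Omega> :: "(real^'n) set" +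
  fixes V :: "(real^'n \<Rightarrow> real^'n) set" and Q :: "(real^'n \<Rightarrow> real) set"
  assumes conforming: "conforming_pair \<Omega> V Q"
begin

abbreviation V0 where "V0 \<equiv> discrete_div_free \<Omega> V Q"
abbreviation P where "P \<equiv> helmholtz_proj \<Omega> V Q"
abbreviation S where "S \<equiv> stokes_proj \<Omega> V Q"

lemma V_span: "\<exists>N \<phi>. V = fun_span N \<phi>"
  using conforming unfolding conforming_pair_def finite_dim_space_def fun_span_def by blast

lemma V_zero: "(\<lambda>x. 0) \<in> V"
  and V_add: "f \<in> V \<Longrightarrow> g \<in> V \<Longrightarrow> (\<lambda>x. f x + g x) \<in> V"
  and V_scale: "f \<in> V \<Longrightarrow> (\<lambda>x. c *\<^sub>R f x) \<in> V"
proof -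
  obtain N \<phi> where V: "V = fun_span N \<phi>" using V_span by blast
  show "(\<lambda>x. 0) \<in> V" "f \<in> V \<Longrightarrow> g \<in> V \<Longrightarrow> (\<lambda>x. f x + g x) \<in> V"
    "f \<in> V \<Longrightarrow> (\<lambda>x. c *\<^sub>R f x) \<in> V"
    unfolding V by (fact fun_span_mem)+
qed

lemma Q_zero: "(\<lambda>x. 0) \<in> Q"
proof -
  obtain N \<phi> where "Q = fun_span N \<phi>"
    using conforming unfolding conforming_pair_def finite_dim_space_def fun_span_def by blast
  then show ?thesis by (simp add: fun_span_mem(1))
qed

lemma Q_L2: "q \<in> Q \<Longrightarrow> q \<in> L2 \<Omega>"
  using conforming by (auto simp: conforming_pair_def L2_zero_mean_def)

lemma V_H1_0: "v \<in> V \<Longrightarrow> (\<lambda>x. v x $ i) \<in> H1_0 \<Omega>"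
  using conforming by (auto simp: conforming_pair_def H1_0_vec_def)

lemma V_H1: "v \<in> V \<Longrightarrow> v \<in> H1_vec \<Omega>"
  using V_H1_0 by (auto simp: H1_0_def H1_vec_def)

lemma V_L2: "v \<in> V \<Longrightarrow> v \<in> L2 \<Omega>"
  by (intro H1_vec_L2 V_H1)

lemma V0_V: "v \<in> V0 \<Longrightarrow> v \<in> V"
  by (simp add: discrete_div_free_def)

lemma V0_zero: "(\<lambda>x. 0) \<in> V0"
proof -
  have "l2_inner \<Omega> (weak_div \<Omega> (\<lambda>x. 0)) q = 0" if "q \<in> Q" for q
    using weak_div_scale[OF V_H1[OF V_zero] Q_L2[OF that], of 0] by simp
  then show ?thesis using V_zero by (simp add: discrete_div_free_def)
qed

lemma V0_add: "f \<in> V0 \<Longrightarrow> g \<in> V0 \<Longrightarrow> (\<lambda>x. f x + g x) \<in> V0"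
  by (simp add: discrete_div_free_def V_add weak_div_add V_H1 Q_L2)

lemma V0_scale: "f \<in> V0 \<Longrightarrow> (\<lambda>x. c *\<^sub>R f x) \<in> V0"
  by (auto simp: discrete_div_free_def V_scale weak_div_scale V_H1 Q_L2)

lemma V0_L2: "semi_inner_space V0 (l2_inner \<Omega>)"
  by (rule l2.restrict) (auto simp: V0_zero V0_add V0_scale dest: V0_V V_L2)

lemma V0_grad: "semi_inner_space V0 (grad_inner \<Omega>)"
  by (rule grad.restrict) (auto simp: V0_zero V0_add V0_scale dest: V0_V V_H1)

lemma V0_span: "\<exists>N \<phi>. V0 \<subseteq> fun_span N \<phi>"
  using V_span V0_V by blast

text \<open>The choice in the definition is meaningful once a witness exists. Riesz representation
  provides it, as the L2 pairing with \<open>w\<close> vanishes on null functions by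
  Cauchy-Schwarz.\<close>

lemma helmholtz_proj:
  assumes w: "w \<in> L2 \<Omega>"
  shows "P w \<in> V0" "v \<in> V0 \<Longrightarrow> l2_inner \<Omega> (P w) v = l2_inner \<Omega> w v"
proof -
  obtain N \<phi> where span: "V0 \<subseteq> fun_span N \<phi>" using V0_span by blast
  have "\<exists>z\<in>V0. \<forall>v\<in>V0. l2_inner \<Omega> z v = l2_inner \<Omega> w v"
  proof (rule Riesz_representation[OF V0_L2 span])
    fix f g assume "f \<in> V0" "g \<in> V0"
    then have fg: "f \<in> L2 \<Omega>" "g \<in> L2 \<Omega>" by (auto dest: V0_V V_L2)
    show "l2_inner \<Omega> w (\<lambda>x. f x + g x) = l2_inner \<Omega> w f + l2_inner \<Omega> w g"
      using l2.B_add[OF fg w] by (simp add: l2_inner_commute)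
  next
    fix f c assume "f \<in> V0"
    then show "l2_inner \<Omega> w (\<lambda>x. c *\<^sub>R f x) = c * l2_inner \<Omega> w f"
      by (intro l2.B_scale_right w) (auto dest: V0_V V_L2)
  next
    fix f assume "f \<in> V0" "l2_inner \<Omega> f f = 0"
    then have "l2_inner \<Omega> f w = 0" using l2.B_null[OF V_L2 w] V0_V by blast
    then show "l2_inner \<Omega> w f = 0" by (simp add: l2_inner_commute)
  qed
  then have "\<exists>z. z \<in> V0 \<and> (\<forall>v\<in>V0. l2_inner \<Omega> z v = l2_inner \<Omega> w v)" by blast
  then have "P w \<in> V0 \<and> (\<forall>v\<in>V0. l2_inner \<Omega> (P w) v = l2_inner \<Omega> w v)"
    unfolding helmholtz_proj_def by (rule someI_ex)
  then show "P w \<in> V0" "v \<in> V0 \<Longrightarrow> l2_inner \<Omega> (P w) v = l2_inner \<Omega> w v" by auto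
qed

lemma stokes_proj:
  assumes w: "w \<in> H1_vec \<Omega>"
  shows "S w \<in> V0" "v \<in> V0 \<Longrightarrow> grad_inner \<Omega> (S w) v = grad_inner \<Omega> w v"
proof -
  obtain N \<phi> where span: "V0 \<subseteq> fun_span N \<phi>" using V0_span by blast
  have comm: "grad_inner \<Omega> f g = grad_inner \<Omega> g f" for f g
    by (simp add: grad_inner_def l2_inner_commute)
  have "\<exists>z\<in>V0. \<forall>v\<in>V0. grad_inner \<Omega> z v = grad_inner \<Omega> w v"
  proof (rule Riesz_representation[OF V0_grad span])
    fix f g assume "f \<in> V0" "g \<in> V0"
    then have fg: "f \<in> H1_vec \<Omega>" "g \<in> H1_vec \<Omega>" by (auto dest: V0_V V_H1)
    show "grad_inner \<Omega> w (\<lambda>x. f x + g x) = grad_inner \<Omega> w f + grad_inner \<Omega> w g"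
      using grad.B_add[OF fg w] by (simp add: comm)
  next
    fix f c assume "f \<in> V0"
    then show "grad_inner \<Omega> w (\<lambda>x. c *\<^sub>R f x) = c * grad_inner \<Omega> w f"
      by (intro grad.B_scale_right w) (auto dest: V0_V V_H1)
  next
    fix f assume "f \<in> V0" "grad_inner \<Omega> f f = 0"
    then have "grad_inner \<Omega> f w = 0" using grad.B_null[OF V_H1 w] V0_V by blast
    then show "grad_inner \<Omega> w f = 0" by (simp add: comm)
  qed
  then have "\<exists>z. z \<in> V0 \<and> (\<forall>v\<in>V0. grad_inner \<Omega> z v = grad_inner \<Omega> w v)" by blast
  then have "S w \<in> V0 \<and> (\<forall>v\<in>V0. grad_inner \<Omega> (S w) v = grad_inner \<Omega> w v)"
    unfolding stokes_proj_def grad_inner_def by (rule someI_ex)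
  then show "S w \<in> V0" "v \<in> V0 \<Longrightarrow> grad_inner \<Omega> (S w) v = grad_inner \<Omega> w v" by auto
qed

text \<open>Two families are required because two forms meet in the estimate. The coefficients that
  can be differentiated in time are the L2 products with \<open>e\<close>; the gradient norm is a
  sum of squares only along \<open>d\<close>. The mixed expansion of \<open>grad_inner\<close> links
  the two, and in the last expansion \<open>w\<close> is any L2 field, so that time derivatives are
  admissible there.\<close>

lemma V0_bases:
  obtains m n :: nat and e d where "\<And>i. i < m \<Longrightarrow> e i \<in> V0" "\<And>k. k < n \<Longrightarrow> d k \<in> V0"
    "\<And>v w. v \<in> V0 \<Longrightarrow> w \<in> H1_vec \<Omega> \<Longrightarrow> grad_inner \<Omega> v w = (\<Sum>i<m. l2_inner \<Omega> v (e i) * grad_inner \<Omega> (e i) w)"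
    "\<And>v. v \<in> V0 \<Longrightarrow> grad_inner \<Omega> v v = (\<Sum>k<n. (grad_inner \<Omega> v (d k))\<^sup>2)"
    "\<And>v w. w \<in> L2 \<Omega> \<Longrightarrow> v \<in> V0 \<Longrightarrow> l2_inner \<Omega> w v = (\<Sum>i<m. l2_inner \<Omega> v (e i) * l2_inner \<Omega> w (e i))"
proof -
  obtain N \<phi> where span: "V0 \<subseteq> fun_span N \<phi>" using V0_span by blast
  obtain m e where e: "\<forall>i<m::nat. e i \<in> V0"
    "\<forall>v\<in>V0. \<forall>w\<in>V0. l2_inner \<Omega> v w = (\<Sum>i<m. l2_inner \<Omega> v (e i) * l2_inner \<Omega> (e i) w)"
    using Gram_Schmidt[OF V0_L2 span] by blast
  obtain n d where d: "\<forall>k<n::nat. d k \<in> V0"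
    "\<forall>v\<in>V0. \<forall>w\<in>V0. grad_inner \<Omega> v w = (\<Sum>k<n. grad_inner \<Omega> v (d k) * grad_inner \<Omega> (d k) w)"
    using Gram_Schmidt[OF V0_grad span] by blast
  show ?thesis
  proof (rule that[of m e n d])
    show "e i \<in> V0" if "i < m" for i using e that by blast
    show "d k \<in> V0" if "k < n" for k using d that by blast
    show "grad_inner \<Omega> v v = (\<Sum>k<n. (grad_inner \<Omega> v (d k))\<^sup>2)" if v: "v \<in> V0" for v
    proof -
      have "grad_inner \<Omega> v v = (\<Sum>k<n. grad_inner \<Omega> v (d k) * grad_inner \<Omega> (d k) v)" using d(2) v by blast
      also have "\<dots> = (\<Sum>k<n. grad_inner \<Omega> v (d k) * grad_inner \<Omega> v (d k))"
        by (simp only: grad_inner_def l2_inner_commute[of _ "weak_grad_vec \<Omega> v"])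
      finally show ?thesis by (simp add: power2_eq_square)
    qed
    show "grad_inner \<Omega> v w = (\<Sum>i<m. l2_inner \<Omega> v (e i) * grad_inner \<Omega> (e i) w)"
      if v: "v \<in> V0" and w: "w \<in> H1_vec \<Omega>" for v w
      by (rule linear_functional_expansion[OF V0_L2 span e(1,2), of "\<lambda>v. grad_inner \<Omega> v w", OF _ _ _ v])
         (auto intro!: grad.B_add grad.B_scale grad_inner_null w dest: V0_V V_H1)
    show "l2_inner \<Omega> w v = (\<Sum>i<m. l2_inner \<Omega> v (e i) * l2_inner \<Omega> w (e i))"
      if w: "w \<in> L2 \<Omega>" and v: "v \<in> V0" for v w
    proof -
      have "l2_inner \<Omega> v w = (\<Sum>i<m. l2_inner \<Omega> v (e i) * l2_inner \<Omega> (e i) w)"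
        by (rule linear_functional_expansion[OF V0_L2 span e(1,2), of "\<lambda>v. l2_inner \<Omega> v w", OF _ _ _ v])
           (use V0_V V_L2 w in \<open>blast intro: l2.B_add l2.B_scale l2.B_null\<close>)+
      then show ?thesis by (simp only: l2_inner_commute[of _ w])
    qed
  qed
qed

end

section \<open>Scalar products along curves in L2\<close>

lemma l2_continuous_on_inner:
  assumes "l2_continuous_on \<Omega> I w" "\<And>t. t \<in> I \<Longrightarrow> w t \<in> L2 \<Omega>" "e \<in> L2 \<Omega>"
  shows "continuous_on I (\<lambda>t. l2_inner \<Omega> (w t) e)"
  unfolding continuous_on_def
proof
  fix t assume t: "t \<in> I"
  have "((\<lambda>s. l2_norm \<Omega> (\<lambda>x. w s x - w t x) * l2_norm \<Omega> e) \<longlongrightarrow> 0 * l2_norm \<Omega> e) (at t within I)"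
    using assms(1) t unfolding l2_continuous_on_def by (intro tendsto_mult tendsto_const) blast
  then have "((\<lambda>s. l2_norm \<Omega> (\<lambda>x. w s x - w t x) * l2_norm \<Omega> e) \<longlongrightarrow> 0) (at t within I)" by simp
  then have "((\<lambda>s. l2_inner \<Omega> (w s) e - l2_inner \<Omega> (w t) e) \<longlongrightarrow> 0) (at t within I)"
  proof (rule Lim_null_comparison[rotated])
    show "\<forall>\<^sub>F s in at t within I. norm (l2_inner \<Omega> (w s) e - l2_inner \<Omega> (w t) e) \<le> l2_norm \<Omega> (\<lambda>x. w s x - w t x) * l2_norm \<Omega> e"
      unfolding eventually_at_filter
    proof (intro always_eventually allI impI)
      fix s assume "s \<in> I"
      show "norm (l2_inner \<Omega> (w s) e - l2_inner \<Omega> (w t) e) \<le> l2_norm \<Omega> (\<lambda>x. w s x - w t x) * l2_norm \<Omega> e"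
        using l2_Cauchy_Schwarz[OF l2.diff_mem[OF assms(2)[OF \<open>s \<in> I\<close>] assms(2)[OF t]] assms(3)]
          l2.B_diff[OF assms(2)[OF \<open>s \<in> I\<close>] assms(2)[OF t] assms(3)] by simp
    qed
  qed
  then show "((\<lambda>t. l2_inner \<Omega> (w t) e) \<longlongrightarrow> l2_inner \<Omega> (w t) e) (at t within I)"
    by (simp add: LIM_zero_iff)
qed

lemma has_l2_derivative_inner:
  assumes "has_l2_derivative \<Omega> w w' t I" "\<And>t. t \<in> I \<Longrightarrow> w t \<in> L2 \<Omega>" "e \<in> L2 \<Omega>" "t \<in> I"
  shows "((\<lambda>s. l2_inner \<Omega> (w s) e) has_real_derivative l2_inner \<Omega> w' e) (at t within I)"
proof -
  let ?q = "\<lambda>s x. (w s x - w t x) /\<^sub>R (s - t)"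
  have w': "w' \<in> L2 \<Omega>" using assms(1) by (simp add: has_l2_derivative_def)
  have "((\<lambda>s. l2_norm \<Omega> (\<lambda>x. ?q s x - w' x) * l2_norm \<Omega> e) \<longlongrightarrow> 0 * l2_norm \<Omega> e) (at t within I)"
    using assms(1) unfolding has_l2_derivative_def by (intro tendsto_mult tendsto_const) blast
  then have "((\<lambda>s. l2_norm \<Omega> (\<lambda>x. ?q s x - w' x) * l2_norm \<Omega> e) \<longlongrightarrow> 0) (at t within I)" by simp
  then have "((\<lambda>s. (l2_inner \<Omega> (w s) e - l2_inner \<Omega> (w t) e) / (s - t) - l2_inner \<Omega> w' e) \<longlongrightarrow> 0) (at t within I)"
  proof (rule Lim_null_comparison[rotated])
    show "\<forall>\<^sub>F s in at t within I. norm ((l2_inner \<Omega> (w s) e - l2_inner \<Omega> (w t) e) / (s - t) - l2_inner \<Omega> w' e)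
        \<le> l2_norm \<Omega> (\<lambda>x. ?q s x - w' x) * l2_norm \<Omega> e"
      unfolding eventually_at_filter
    proof (intro always_eventually allI impI)
      fix s assume "s \<in> I"
      have d: "(\<lambda>x. w s x - w t x) \<in> L2 \<Omega>" by (rule l2.diff_mem[OF assms(2)[OF \<open>s \<in> I\<close>] assms(2)[OF assms(4)]])
      have q: "?q s \<in> L2 \<Omega>" by (rule l2.scale_mem[OF d])
      have "l2_inner \<Omega> (\<lambda>x. ?q s x - w' x) e = l2_inner \<Omega> (?q s) e - l2_inner \<Omega> w' e"
        by (rule l2.B_diff[OF q w' assms(3)])
      also have "l2_inner \<Omega> (?q s) e = inverse (s - t) * l2_inner \<Omega> (\<lambda>x. w s x - w t x) e"
        by (rule l2.B_scale[OF d assms(3)])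
      also have "l2_inner \<Omega> (\<lambda>x. w s x - w t x) e = l2_inner \<Omega> (w s) e - l2_inner \<Omega> (w t) e"
        by (rule l2.B_diff[OF assms(2)[OF \<open>s \<in> I\<close>] assms(2)[OF assms(4)] assms(3)])
      finally show "norm ((l2_inner \<Omega> (w s) e - l2_inner \<Omega> (w t) e) / (s - t) - l2_inner \<Omega> w' e)
        \<le> l2_norm \<Omega> (\<lambda>x. ?q s x - w' x) * l2_norm \<Omega> e"
        using l2_Cauchy_Schwarz[OF l2.diff_mem[OF q w'] assms(3)] by (simp add: divide_inverse mult.commute)
    qed
  qed
  then show ?thesis by (simp add: has_field_derivative_iff LIM_zero_iff)
qed

section \<open>Smooth fields on the space-time cylinder\<close>

lemma partial_component:
  fixes w :: "real^'n \<Rightarrow> real^'m"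
  assumes "w differentiable (at x)"
  shows "(\<lambda>y. w y $ i) differentiable (at x)" "partial j (\<lambda>y. w y $ i) x = partial j w x $ i"
proof -
  have "(w has_derivative frechet_derivative w (at x)) (at x)"
    using assms by (simp add: frechet_derivative_works)
  then have "((\<lambda>y. w y $ i) has_derivative (\<lambda>h. frechet_derivative w (at x) h $ i)) (at x)"
    by (rule bounded_linear.has_derivative[OF bounded_linear_vec_nth])
  then show "(\<lambda>y. w y $ i) differentiable (at x)" "partial j (\<lambda>y. w y $ i) x = partial j w x $ i"
    by (auto simp: differentiable_def partial_def frechet_derivative_at[symmetric])
qed

text \<open>Equality of \<open>g\<close> and \<open>w\<close> on the open set
  \<open>\<Omega>\<close> suffices for the unrestricted derivative in space. In the time direction
  \<open>I\<close> may be a closed interval, which is why the companion lemma speaks of the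
  derivative within \<open>I\<close>.\<close>

lemma has_derivative_slice:
  fixes g :: "real \<times> (real^'n) \<Rightarrow> 'b::real_normed_vector"
  assumes "g differentiable (at (t, x))" "open \<Omega>" "x \<in> \<Omega>" "\<And>y. y \<in> \<Omega> \<Longrightarrow> g (t, y) = w y"
  shows "w differentiable (at x)" "partial j w x = frechet_derivative g (at (t, x)) (0, axis j 1)"
proof -
  have g: "(g has_derivative frechet_derivative g (at (t, x))) (at (t, x))"
    using assms(1) by (simp add: frechet_derivative_works)
  have "((\<lambda>y. g (t, y)) has_derivative (\<lambda>h. frechet_derivative g (at (t, x)) (0, h))) (at x)"
    by (rule has_derivative_compose[of "\<lambda>y. (t, y)" "\<lambda>h. (0, h)" x UNIV g "frechet_derivative g (at (t, x))"])
       (auto intro!: derivative_eq_intros g)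
  then have "(w has_derivative (\<lambda>h. frechet_derivative g (at (t, x)) (0, h))) (at x)"
    by (rule has_derivative_transform_within_open[OF _ assms(2,3)]) (simp add: assms(4))
  then show "w differentiable (at x)" "partial j w x = frechet_derivative g (at (t, x)) (0, axis j 1)"
    by (auto simp: differentiable_def partial_def frechet_derivative_at[symmetric])
qed

lemma has_vector_derivative_slice:
  fixes g :: "real \<times> (real^'n) \<Rightarrow> 'b::real_normed_vector"
  assumes "g differentiable (at (t, x))" "t \<in> I" "\<And>s. s \<in> I \<Longrightarrow> g (s, x) = w s"
  shows "(w has_vector_derivative frechet_derivative g (at (t, x)) (1, 0)) (at t within I)"
proof -
  have g: "(g has_derivative frechet_derivative g (at (t, x))) (at (t, x))"
    using assms(1) by (simp add: frechet_derivative_works)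
  have deriv: "((\<lambda>s. g (s, x)) has_derivative (\<lambda>h. frechet_derivative g (at (t, x)) (h, 0))) (at t within I)"
    by (rule has_derivative_compose[of "\<lambda>s. (s, x)" "\<lambda>h. (h, 0)" t I g "frechet_derivative g (at (t, x))"])
       (auto intro!: derivative_eq_intros g)
  have "frechet_derivative g (at (t, x)) (h, 0) = h *\<^sub>R frechet_derivative g (at (t, x)) (1, 0)" for h
    using linear_scale[OF linear_frechet_derivative[OF assms(1)], of h "(1, 0)"] by simp
  then have "((\<lambda>s. g (s, x)) has_vector_derivative frechet_derivative g (at (t, x)) (1, 0)) (at t within I)"
    unfolding has_vector_derivative_def by (intro has_derivative_eq_rhs[OF deriv] ext)
  then show ?thesis
    by (rule has_vector_derivative_transform[rotated 2]) (use assms(2,3) in simp_all)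
qed

lemma has_vector_derivative_imp_tendsto:
  assumes "(f has_vector_derivative v) (at t within I)"
  shows "((\<lambda>s. (f s - f t) /\<^sub>R (s - t)) \<longlongrightarrow> v) (at t within I)"
proof -
  have "((\<lambda>s. norm ((f s - f t) - (s - t) *\<^sub>R v) / norm (s - t)) \<longlongrightarrow> 0) (at t within I)"
    using assms by (simp add: has_vector_derivative_def has_derivative_iff_norm)
  moreover have eq: "norm ((f s - f t) - (s - t) *\<^sub>R v) / norm (s - t) = norm ((f s - f t) /\<^sub>R (s - t) - v)" if "s \<noteq> t" for s
  proof -
    have "(f s - f t) /\<^sub>R (s - t) - v = ((f s - f t) - (s - t) *\<^sub>R v) /\<^sub>R (s - t)"
      using that by (simp add: scaleR_diff_right)
    then show ?thesis by (simp add: divide_inverse mult.commute)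
  qed
  ultimately have "((\<lambda>s. norm ((f s - f t) /\<^sub>R (s - t) - v)) \<longlongrightarrow> 0) (at t within I)"
    by (elim Lim_transform_eventually) (auto simp only: eventually_at_filter eq intro!: always_eventually)
  then show ?thesis by (simp add: tendsto_norm_zero_iff LIM_zero_iff)
qed

text \<open>\<open>partial j (u t)\<close> is controlled only on \<open>\<Omega>\<close>, because
  the values of \<open>u t\<close> beyond its closure are arbitrary. \<open>ut\<close>,
  \<open>G\<close> and \<open>H\<close> are derivatives of the smooth extension: they coincide with
  the derivatives of \<open>u\<close> where those are meaningful and are continuous on the whole
  closed cylinder, whence the uniform bounds when that cylinder is compact.\<close>

lemma smooth_up_to_slices:
  fixes u :: "real \<Rightarrow> real^'n \<Rightarrow> 'b::real_normed_vector"
  assumes smooth: "smooth_up_to (I \<times> closure \<Omega>) (\<lambda>(t, x). u t x)" and \<Omega>: "open \<Omega>"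
  obtains ut G H where
    "continuous_on (I \<times> closure \<Omega>) (\<lambda>(t, x). u t x)" "continuous_on (I \<times> closure \<Omega>) ut"
    "\<And>j. continuous_on (I \<times> closure \<Omega>) (G j)" "\<And>j k. continuous_on (I \<times> closure \<Omega>) (H j k)"
    "\<And>t x. t \<in> I \<Longrightarrow> x \<in> closure \<Omega> \<Longrightarrow> ((\<lambda>s. u s x) has_vector_derivative ut (t, x)) (at t within I)"
    "\<And>t x. t \<in> I \<Longrightarrow> x \<in> \<Omega> \<Longrightarrow> u t differentiable (at x)"
    "\<And>t x j. t \<in> I \<Longrightarrow> x \<in> \<Omega> \<Longrightarrow> partial j (u t) x = G j (t, x)"
    "\<And>t x j. t \<in> I \<Longrightarrow> x \<in> \<Omega> \<Longrightarrow> partial j (u t) differentiable (at x)"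
    "\<And>t x j k. t \<in> I \<Longrightarrow> x \<in> \<Omega> \<Longrightarrow> partial k (partial j (u t)) x = H j k (t, x)"
proof -
  obtain U g where U: "open U" "I \<times> closure \<Omega> \<subseteq> U" "smooth_on U g"
    and g: "\<forall>z\<in>I \<times> closure \<Omega>. g z = (case z of (t, x) \<Rightarrow> u t x)"
    using smooth unfolding smooth_up_to_def by blast
  have gu: "g (t, x) = u t x" if "t \<in> I" "x \<in> closure \<Omega>" for t x using g that by auto
  have \<Omega>cl: "x \<in> closure \<Omega>" if "x \<in> \<Omega>" for x using that closure_subset by blast
  define D where "D b z = frechet_derivative g (at z) b" for b z
  define DD where "DD b c z = frechet_derivative (D b) (at z) c" for b c z
  have C: "Ck_on 0 U g" "Ck_on (Suc 0) U g" "Ck_on (Suc (Suc 0)) U g"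
    using U(3) unfolding smooth_on_def by blast+
  have basis: "(1, 0) \<in> (Basis :: (real \<times> (real^'n)) set)" "(0, axis j 1) \<in> (Basis :: (real \<times> (real^'n)) set)" for j
    by (auto simp: Basis_prod_def axis_in_Basis_iff)
  have dg: "g differentiable (at z)" if "z \<in> U" for z using C(2) that by simp
  have cD: "continuous_on U (D b)" if "b \<in> Basis" for b
    using C(2) that by (simp add: D_def[abs_def])
  have dD: "D b differentiable (at z)" if "b \<in> Basis" "z \<in> U" for b z
    using C(3) that by (simp add: D_def[abs_def])
  have cDD: "continuous_on U (DD b c)" if "b \<in> Basis" "c \<in> Basis" for b c
    using C(3) that by (simp add: DD_def[abs_def] D_def[abs_def])
  have inU: "(t, x) \<in> U" if "t \<in> I" "x \<in> closure \<Omega>" for t x using U(2) that by auto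
  have D1: "u t differentiable (at x)" "partial j (u t) x = D (0, axis j 1) (t, x)"
    if "t \<in> I" "x \<in> \<Omega>" for t x j
    unfolding D_def
    by (rule has_derivative_slice[OF dg \<Omega> that(2)]; use that inU gu \<Omega>cl in blast)+
  show ?thesis
  proof (rule that[of "D (1, 0)" "\<lambda>j. D (0, axis j 1)" "\<lambda>j k. DD (0, axis j 1) (0, axis k 1)"])
    show "continuous_on (I \<times> closure \<Omega>) (\<lambda>(t, x). u t x)"
      by (rule continuous_on_eq[of _ g]) (use C(1) U(2) g in \<open>auto intro: continuous_on_subset\<close>)
    show "continuous_on (I \<times> closure \<Omega>) (D (1, 0))"
      "\<And>j. continuous_on (I \<times> closure \<Omega>) (D (0, axis j 1))"
      "\<And>j k. continuous_on (I \<times> closure \<Omega>) (DD (0, axis j 1) (0, axis k 1))"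
      by (rule continuous_on_subset[OF _ U(2)], intro cD cDD basis)+
    fix t x j k assume t: "t \<in> I"
    show "((\<lambda>s. u s x) has_vector_derivative D (1, 0) (t, x)) (at t within I)" if "x \<in> closure \<Omega>"
      unfolding D_def by (rule has_vector_derivative_slice[OF dg t]) (use inU gu t that in auto)
    assume x: "x \<in> \<Omega>"
    show "u t differentiable (at x)" "partial j (u t) x = D (0, axis j 1) (t, x)" using D1[OF t x] by auto
    show "partial j (u t) differentiable (at x)"
      "partial k (partial j (u t)) x = DD (0, axis j 1) (0, axis k 1) (t, x)"
      unfolding DD_def
      by (rule has_derivative_slice[OF dD[OF basis(2)] \<Omega> x]; use t x inU \<Omega>cl D1 in auto)+
  qed
qed

section \<open>Differentiation under the spatial integral\<close>

context bounded_open
begin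

lemma compact_cylinder_bound:
  fixes G :: "real \<times> (real^'n) \<Rightarrow> 'b::real_normed_vector"
  assumes "continuous_on ({a..b} \<times> closure \<Omega>) G"
  obtains M where "\<And>t x. t \<in> {a..b} \<Longrightarrow> x \<in> closure \<Omega> \<Longrightarrow> norm (G (t, x)) \<le> M"
proof -
  have "compact (closure \<Omega>)" using bounded_dom by (simp only: compact_closure)
  then have "compact (G ` ({a..b} \<times> closure \<Omega>))"
    by (intro compact_continuous_image assms compact_Times compact_Icc)
  then obtain M where M: "\<forall>y\<in>G ` ({a..b} \<times> closure \<Omega>). norm y \<le> M"
    using compact_imp_bounded bounded_iff by metis
  show ?thesis
  proof (rule that[of M])
    fix t x assume "t \<in> {a..b}" "x \<in> closure \<Omega>"
    then have "G (t, x) \<in> G ` ({a..b} \<times> closure \<Omega>)" by (intro imageI SigmaI)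
    then show "norm (G (t, x)) \<le> M" using M by blast
  qed
qed

lemma dom_closure: "x \<in> \<Omega> \<Longrightarrow> x \<in> closure \<Omega>"
  using closure_subset by blast

lemma L2_slice:
  fixes G :: "real \<times> (real^'n) \<Rightarrow> 'b::euclidean_space"
  assumes G: "continuous_on ({a..b} \<times> closure \<Omega>) G" and t: "t \<in> {a..b}"
  shows "(\<lambda>x. G (t, x)) \<in> L2 \<Omega>"
proof -
  obtain M where M: "\<And>t x. t \<in> {a..b} \<Longrightarrow> x \<in> closure \<Omega> \<Longrightarrow> norm (G (t, x)) \<le> M"
    by (rule compact_cylinder_bound[OF G]) blast
  show ?thesis
  proof (rule L2_bounded_continuous[OF open_dom bounded_dom])
    have "continuous_on ((\<lambda>x. (t, x)) ` \<Omega>) G"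
      by (rule continuous_on_subset[OF G]) (use t dom_closure in blast)
    then show "continuous_on \<Omega> (\<lambda>x. G (t, x))"
      by (rule continuous_on_compose2) (auto intro: continuous_intros)
    show "norm (G (t, x)) \<le> M" if "x \<in> \<Omega>" for x using M t dom_closure[OF that] by blast
  qed
qed

text \<open>Dominated convergence with majorant \<open>M * norm (e x)\<close>, which is integrable
  because L2 is contained in L1 on a bounded domain.\<close>

lemma integral_inner_tendsto:
  fixes e :: "real^'n \<Rightarrow> 'b::euclidean_space"
  assumes e: "e \<in> L2 \<Omega>" and w: "\<And>n. w n \<in> L2 \<Omega>" "w' \<in> L2 \<Omega>"
    and bound: "\<And>n x. x \<in> \<Omega> \<Longrightarrow> norm (w n x) \<le> M" and lim: "\<And>x. x \<in> \<Omega> \<Longrightarrow> (\<lambda>n. w n x) \<longlonglongrightarrow> w' x"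
  shows "(\<lambda>n. l2_inner \<Omega> (w n) e) \<longlonglongrightarrow> l2_inner \<Omega> w' e"
  unfolding l2_inner_def
proof (rule integral_dominated_convergence[where w = "\<lambda>x. M * norm (e x)"])
  show "integrable (lebesgue_on \<Omega>) (\<lambda>x. M * norm (e x))"
    by (intro integrable_mult_right integrable_norm L2_imp_integrable[OF open_dom bounded_dom e])
  show "AE x in lebesgue_on \<Omega>. (\<lambda>n. w n x \<bullet> e x) \<longlonglongrightarrow> w' x \<bullet> e x"
    by (intro AE_I2 tendsto_inner tendsto_const lim) (simp add: space_restrict_space)
  show "AE x in lebesgue_on \<Omega>. norm (w n x \<bullet> e x) \<le> M * norm (e x)" for n
  proof (rule AE_I2)
    fix x assume "x \<in> space (lebesgue_on \<Omega>)"
    then have x: "x \<in> \<Omega>" by (simp add: space_restrict_space)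
    have "norm (w n x \<bullet> e x) \<le> norm (w n x) * norm (e x)" using Cauchy_Schwarz_ineq2 by simp
    also have "\<dots> \<le> M * norm (e x)" by (intro mult_right_mono bound x) simp
    finally show "norm (w n x \<bullet> e x) \<le> M * norm (e x)" .
  qed
qed (rule borel_measurable_inner; intro L2_measurable w e)+

lemma continuous_on_l2_inner_slice:
  fixes G :: "real \<times> (real^'n) \<Rightarrow> 'b::euclidean_space"
  assumes G: "continuous_on ({a..b} \<times> closure \<Omega>) G" and e: "e \<in> L2 \<Omega>"
  shows "continuous_on {a..b} (\<lambda>t. l2_inner \<Omega> (\<lambda>x. G (t, x)) e)"
  unfolding continuous_on_sequentially o_def
proof (intro allI ballI impI, elim conjE)
  fix X t assume t: "t \<in> {a..b}" and X: "\<forall>n. X n \<in> {a..b}" "X \<longlonglongrightarrow> t"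
  obtain M where M: "\<And>t x. t \<in> {a..b} \<Longrightarrow> x \<in> closure \<Omega> \<Longrightarrow> norm (G (t, x)) \<le> M"
    by (rule compact_cylinder_bound[OF G]) blast
  show "(\<lambda>n. l2_inner \<Omega> (\<lambda>x. G (X n, x)) e) \<longlonglongrightarrow> l2_inner \<Omega> (\<lambda>x. G (t, x)) e"
  proof (rule integral_inner_tendsto[OF e])
    show "(\<lambda>x. G (X n, x)) \<in> L2 \<Omega>" for n using X by (intro L2_slice[OF G]) blast
    show "(\<lambda>x. G (t, x)) \<in> L2 \<Omega>" by (rule L2_slice[OF G t])
    show "norm (G (X n, x)) \<le> M" if "x \<in> \<Omega>" for n x using M X dom_closure[OF that] by blast
    show "(\<lambda>n. G (X n, x)) \<longlonglongrightarrow> G (t, x)" if "x \<in> \<Omega>" for x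
      by (rule continuous_on_tendsto_compose[OF G])
         (use t X dom_closure[OF that] in \<open>auto intro!: tendsto_intros\<close>)
  qed
qed

lemma l2_inner_has_derivative:
  fixes w :: "real \<Rightarrow> real^'n \<Rightarrow> 'b::euclidean_space"
  assumes w: "continuous_on ({a..b} \<times> closure \<Omega>) (\<lambda>(t, x). w t x)"
    and w': "continuous_on ({a..b} \<times> closure \<Omega>) w'"
    and deriv: "\<And>t x. t \<in> {a..b} \<Longrightarrow> x \<in> closure \<Omega> \<Longrightarrow>
      ((\<lambda>s. w s x) has_vector_derivative w' (t, x)) (at t within {a..b})"
    and e: "e \<in> L2 \<Omega>" and t: "t \<in> {a..b}"
  shows "((\<lambda>s. l2_inner \<Omega> (w s) e) has_real_derivative l2_inner \<Omega> (\<lambda>x. w' (t, x)) e) (at t within {a..b})"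
  unfolding has_field_derivative_iff tendsto_at_iff_sequentially o_def
proof (intro allI impI)
  fix X assume X: "\<forall>n. X n \<in> {a..b} - {t}" "X \<longlonglongrightarrow> t"
  obtain M where M: "\<And>t x. t \<in> {a..b} \<Longrightarrow> x \<in> closure \<Omega> \<Longrightarrow> norm (w' (t, x)) \<le> M"
    by (rule compact_cylinder_bound[OF w']) blast
  have wL: "w s \<in> L2 \<Omega>" if "s \<in> {a..b}" for s using L2_slice[OF w that] by simp
  have Xab: "X n \<in> {a..b}" "X n \<noteq> t" for n using X(1) by auto
  let ?q = "\<lambda>n x. (w (X n) x - w t x) /\<^sub>R (X n - t)"
  have d: "(\<lambda>x. w (X n) x - w t x) \<in> L2 \<Omega>" for n by (rule l2.diff_mem[OF wL[OF Xab(1)] wL[OF t]])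
  have "(\<lambda>n. l2_inner \<Omega> (?q n) e) \<longlonglongrightarrow> l2_inner \<Omega> (\<lambda>x. w' (t, x)) e"
  proof (rule integral_inner_tendsto[OF e])
    show "?q n \<in> L2 \<Omega>" for n by (rule l2.scale_mem[OF d])
    show "(\<lambda>x. w' (t, x)) \<in> L2 \<Omega>" by (rule L2_slice[OF w' t])
    show "norm (?q n x) \<le> M" if "x \<in> \<Omega>" for n x
    proof -
      have x: "x \<in> closure \<Omega>" by (rule dom_closure[OF that])
      \<comment> \<open>The mean value inequality in time bounds all difference quotients by the
        maximum of \<open>w'\<close> on the compact cylinder, as dominated convergence
        requires.\<close>
      have "norm (w (X n) x - w t x) \<le> M * norm (X n - t)"
      proof (rule differentiable_bound[of "{a..b}" _ "\<lambda>s h. h *\<^sub>R w' (s, x)"])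
        show "((\<lambda>s. w s x) has_derivative (\<lambda>h. h *\<^sub>R w' (s, x))) (at s within {a..b})" if "s \<in> {a..b}" for s
          using deriv[OF that x] by (simp add: has_vector_derivative_def)
        show "onorm (\<lambda>h. h *\<^sub>R w' (s, x)) \<le> M" if "s \<in> {a..b}" for s
          using M[OF that x]
          by (intro onorm_bound) (auto simp: mult.commute[of M] mult_left_mono intro: order_trans[OF norm_ge_zero])
      qed (use Xab t in auto)
      moreover have "norm (?q n x) = norm (w (X n) x - w t x) / norm (X n - t)"
        by (simp add: divide_inverse mult.commute)
      ultimately show ?thesis using Xab(2)[of n] by (simp add: pos_divide_le_eq)
    qed
    show "(\<lambda>n. ?q n x) \<longlonglongrightarrow> w' (t, x)" if "x \<in> \<Omega>" for x
    proof -
      have "((\<lambda>s. (w s x - w t x) /\<^sub>R (s - t)) \<longlongrightarrow> w' (t, x)) (at t within {a..b})"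
        using deriv[OF t dom_closure[OF that]] by (rule has_vector_derivative_imp_tendsto)
      then show ?thesis using X unfolding tendsto_at_iff_sequentially o_def by blast
    qed
  qed
  moreover have "l2_inner \<Omega> (?q n) e = (l2_inner \<Omega> (w (X n)) e - l2_inner \<Omega> (w t) e) / (X n - t)" for n
    using l2.B_scale[OF d e] l2.B_diff[OF wL[OF Xab(1)] wL[OF t] e] by (simp add: divide_inverse mult.commute)
  ultimately show "(\<lambda>n. (l2_inner \<Omega> (w (X n)) e - l2_inner \<Omega> (w t) e) / (X n - t)) \<longlonglongrightarrow> l2_inner \<Omega> (\<lambda>x. w' (t, x)) e"
    by simp
qed

end

section \<open>The energy estimate\<close>

text \<open>The function \<open>h\<close> is nonincreasing: its derivative has the right sign at
  interior times, and it is continuous up to both ends. Asking for the derivative only in the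
  interior fits a semi-discrete solution that is differentiable for positive times and has a
  one-sided derivative at T.\<close>

lemma energy_integration:
  fixes y E R :: "real \<Rightarrow> real"
  assumes T: "0 < T" and cont: "continuous_on {0..T} y" "continuous_on {0..T} E" "continuous_on {0..T} R"
    and deriv: "\<And>t. 0 < t \<Longrightarrow> t < T \<Longrightarrow> \<exists>y'. (y has_real_derivative y') (at t) \<and> y' \<le> \<nu> * (R t - E t)"
  shows "y T + \<nu> * (LINT t|lebesgue_on {0..T}. E t) \<le> y 0 + \<nu> * (LINT t|lebesgue_on {0..T}. R t)"
proof -
  have cD: "continuous_on {0..T} (\<lambda>t. R t - E t)" by (intro continuous_intros cont)
  define h where "h t = y t - \<nu> * integral {0..t} (\<lambda>t. R t - E t)" for t
  have "h T \<le> h 0"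
  proof (rule DERIV_nonpos_imp_decreasing_open[where f = h and a = 0 and b = T])
    fix t assume t: "0 < t" "t < T"
    obtain y' where y': "(y has_real_derivative y') (at t)" "y' \<le> \<nu> * (R t - E t)" using deriv[OF t] by blast
    have "((\<lambda>t. integral {0..t} (\<lambda>t. R t - E t)) has_real_derivative R t - E t) (at t within {0..T})"
      using t by (intro integral_has_real_derivative cD) auto
    then have "((\<lambda>t. integral {0..t} (\<lambda>t. R t - E t)) has_real_derivative R t - E t) (at t)"
      using t by (simp add: at_within_Icc_at)
    then have "(h has_real_derivative y' - \<nu> * (R t - E t)) (at t)"
      unfolding h_def by (intro derivative_intros y' DERIV_cmult)
    then show "\<exists>z. (h has_real_derivative z) (at t) \<and> z \<le> 0" using y'(2) by (intro exI conjI) auto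
  next
    have "(\<lambda>t. R t - E t) integrable_on {0..T}" by (rule integrable_continuous_interval[OF cD])
    then show "continuous_on {0..T} h"
      unfolding h_def by (intro continuous_intros cont indefinite_integral_continuous_1)
  qed (use T in simp)
  moreover have "integral {0..T} (\<lambda>t. R t - E t) = (LINT t|lebesgue_on {0..T}. R t) - (LINT t|lebesgue_on {0..T}. E t)"
    using cont(2,3)[THEN continuous_imp_integrable_real]
    by (simp add: lebesgue_integral_eq_integral Henstock_Kurzweil_Integration.integral_diff
        integrable_continuous_interval cont)
  ultimately show ?thesis by (simp add: h_def algebra_simps)
qed

section \<open>Weak forms of the continuous and the semi-discrete problem\<close>

context conforming
begin

text \<open>Entry by entry, integrate by parts classically against test functions and pass to
  \<open>v\<close> by density; no boundary term appears because the components of \<open>v\<close>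
  lie in \<open>H1_0 \<Omega>\<close>. The third claim identifies the chosen weak gradient with the
  classical Jacobian.\<close>

lemma laplacian_weak:
  assumes v: "v \<in> V"
    and w: "\<And>x. x \<in> \<Omega> \<Longrightarrow> w differentiable (at x)" "\<And>x j. x \<in> \<Omega> \<Longrightarrow> partial j w differentiable (at x)"
    and cont: "\<And>j k. continuous_on \<Omega> (partial k (partial j w))"
    and L: "w \<in> L2 \<Omega>" "\<And>j. partial j w \<in> L2 \<Omega>" "\<And>j k. partial k (partial j w) \<in> L2 \<Omega>"
  shows "w \<in> H1_vec \<Omega>" "l2_inner \<Omega> (laplacian w) v = - grad_inner \<Omega> w v"
    "AE x in lebesgue_on \<Omega>. weak_grad_vec \<Omega> w x = (\<chi> i j. partial j w x $ i)"
proof -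
  have contp: "continuous_on \<Omega> (partial j w)" for j
    using w(2) by (auto intro!: continuous_at_imp_continuous_on differentiable_imp_continuous_within)
  have pc: "partial j (\<lambda>x. w x $ i) x = partial j w x $ i" if "x \<in> \<Omega>" for i j x
    by (rule partial_component(2)[OF w(1)[OF that]])
  have pc2: "partial k (\<lambda>x. partial j w x $ i) x = partial k (partial j w) x $ i" if "x \<in> \<Omega>" for i j k x
    by (rule partial_component(2)[OF w(2)[OF that]])
  have wg: "has_weak_gradient \<Omega> (\<lambda>x. w x $ i) (grad (\<lambda>x. w x $ i))" for i
  proof (rule has_weak_gradient_classical[OF open_dom])
    show "(\<lambda>x. w x $ i) differentiable (at x)" if "x \<in> \<Omega>" for x
      by (rule partial_component(1)[OF w(1)[OF that]])
    show "continuous_on \<Omega> (partial j (\<lambda>x. w x $ i))" for j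
      by (rule continuous_on_eq[of _ "\<lambda>x. partial j w x $ i"]) (auto simp: pc intro!: continuous_intros contp)
    show "(\<lambda>x. w x $ i) \<in> L2 \<Omega>" by (rule L2_component[OF L(1)])
    show "partial j (\<lambda>x. w x $ i) \<in> L2 \<Omega>" for j
      by (rule L2_cong_on[OF _ L2_component[OF L(2)[of j], of i]]) (simp add: pc)
  qed
  show wH: "w \<in> H1_vec \<Omega>"
    by (rule H1_vecI[where G = "\<lambda>x. \<chi> i. grad (\<lambda>x. w x $ i) x"]) (simp add: wg)
  have "AE x in lebesgue_on \<Omega>. weak_grad_vec \<Omega> w x = (\<chi> i. grad (\<lambda>x. w x $ i) x)"
    by (rule weak_grad_vec_eq_AE) (simp add: wg)
  moreover have "AE x in lebesgue_on \<Omega>. (\<chi> i. grad (\<lambda>x. w x $ i) x) = (\<chi> i j. partial j w x $ i)"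
    by (rule AE_I2) (simp add: grad_def pc space_restrict_space)
  ultimately show ae: "AE x in lebesgue_on \<Omega>. weak_grad_vec \<Omega> w x = (\<chi> i j. partial j w x $ i)"
    by eventually_elim simp
  let ?G = "\<lambda>x. \<chi> i j. partial j w x $ i"
  have GL: "?G \<in> L2 \<Omega>" by (rule L2_vec, simp, rule L2_vec, simp) (rule L2_component[OF L(2)])
  have vL: "v \<in> L2 \<Omega>" "weak_grad_vec \<Omega> v \<in> L2 \<Omega>" using v by (auto intro: V_L2 weak_grad_vec_L2 V_H1)
  have parts: "l2_inner \<Omega> (\<lambda>x. partial j w x $ i) (\<lambda>x. weak_grad_vec \<Omega> v x $ i $ j)
      = - l2_inner \<Omega> (\<lambda>x. partial j (partial j w) x $ i) (\<lambda>x. v x $ i)" for i j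
    unfolding weak_grad_vec_def vec_lambda_beta
  proof (rule H1_0_weak_parts[OF open_dom V_H1_0[OF v] L2_component[OF L(2)] L2_component[OF L(3)]])
    fix \<phi> assume \<phi>: "test_function \<Omega> \<phi>"
    have "l2_inner \<Omega> (\<lambda>x. partial j w x $ i) (partial j \<phi>) = - l2_inner \<Omega> (partial j (\<lambda>x. partial j w x $ i)) \<phi>"
      unfolding l2_inner_def inner_real_def
    proof (rule integration_by_parts_test_function[OF open_dom _ _ \<phi>])
      show "(\<lambda>x. partial j w x $ i) differentiable (at x)" if "x \<in> \<Omega>" for x
        by (rule partial_component(1)[OF w(2)[OF that]])
      show "continuous_on \<Omega> (partial j (\<lambda>x. partial j w x $ i))"
        by (rule continuous_on_eq[of _ "\<lambda>x. partial j (partial j w) x $ i"]) (auto simp: pc2 intro!: continuous_intros cont)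
    qed
    also have "l2_inner \<Omega> (partial j (\<lambda>x. partial j w x $ i)) \<phi> = l2_inner \<Omega> (\<lambda>x. partial j (partial j w) x $ i) \<phi>"
      by (rule l2_inner_cong_on) (simp_all add: pc2)
    finally show "l2_inner \<Omega> (\<lambda>x. partial j w x $ i) (partial j \<phi>) = - l2_inner \<Omega> (\<lambda>x. partial j (partial j w) x $ i) \<phi>" .
  qed
  have "grad_inner \<Omega> w v = l2_inner \<Omega> ?G (weak_grad_vec \<Omega> v)"
    unfolding grad_inner_def by (rule l2_inner_cong[OF weak_grad_vec_L2[OF wH] GL vL(2) vL(2) ae]) simp
  also have "\<dots> = (\<Sum>i\<in>UNIV. \<Sum>j\<in>UNIV. l2_inner \<Omega> (\<lambda>x. partial j w x $ i) (\<lambda>x. weak_grad_vec \<Omega> v x $ i $ j))"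
    using l2_inner_vec[OF L2_component[OF GL] L2_component[OF vL(2)]]
    by (simp add: l2_inner_vec[OF GL vL(2)])
  also have "\<dots> = - (\<Sum>i\<in>UNIV. \<Sum>j\<in>UNIV. l2_inner \<Omega> (\<lambda>x. partial j (partial j w) x $ i) (\<lambda>x. v x $ i))"
    by (simp add: parts sum_negf)
  also have "(\<Sum>i\<in>UNIV. \<Sum>j\<in>UNIV. l2_inner \<Omega> (\<lambda>x. partial j (partial j w) x $ i) (\<lambda>x. v x $ i))
      = (\<Sum>j\<in>UNIV. l2_inner \<Omega> (partial j (partial j w)) v)"
    by (subst sum.swap) (simp add: l2_inner_vec[OF L(3) vL(1)])
  also have "\<dots> = l2_inner \<Omega> (laplacian w) v"
    unfolding laplacian_def[abs_def] by (rule l2.B_sum[symmetric]) (auto intro: L vL)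
  finally show "l2_inner \<Omega> (laplacian w) v = - grad_inner \<Omega> w v" by simp
qed

text \<open>\<open>pressure_robust\<close> speaks of the chosen weak gradient. A C^1 function with
  square-integrable derivatives has its classical gradient as a weak one, so the two agree almost
  everywhere.\<close>

lemma pressure_gradient_orthogonal:
  assumes robust: "pressure_robust \<Omega> V Q" and v: "v \<in> V0"
    and q: "\<And>x. x \<in> \<Omega> \<Longrightarrow> q differentiable (at x)" "\<And>j. continuous_on \<Omega> (partial j q)"
      "q \<in> L2 \<Omega>" "\<And>j. partial j q \<in> L2 \<Omega>"
  shows "grad q \<in> L2 \<Omega>" "l2_inner \<Omega> (grad q) v = 0"
proof -
  have wg: "has_weak_gradient \<Omega> q (grad q)" by (rule has_weak_gradient_classical[OF open_dom q])
  then have qH: "q \<in> H1 \<Omega>" by (auto simp: H1_def)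
  show gL: "grad q \<in> L2 \<Omega>" using wg by (simp add: has_weak_gradient_iff)
  have "weak_grad \<Omega> q \<in> L2 \<Omega>" using has_weak_gradient_weak_grad[OF qH] by (simp add: has_weak_gradient_iff)
  then have "l2_inner \<Omega> (grad q) v = l2_inner \<Omega> (weak_grad \<Omega> q) v"
    using weak_grad_eq_AE[OF open_dom bounded_dom wg] gL V_L2[OF V0_V[OF v]]
    by (intro l2_inner_cong) auto
  then show "l2_inner \<Omega> (grad q) v = 0" using robust qH v by (simp add: pressure_robust_def)
qed

text \<open>\<open>Gm\<close> is a representative of the gradient of \<open>u\<close> that is
  jointly continuous in time and space. It stands in for
  \<open>weak_grad_vec \<Omega> (u t)\<close>, whose representatives at different times are
  unrelated, and makes the gradient products of \<open>u t\<close> continuous in time.\<close>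

lemma smooth_solution_weak:
  assumes sol: "smooth_stokes_solution \<Omega> T \<nu> f u0 u p" and T: "0 < T" and robust: "pressure_robust \<Omega> V Q"
  obtains ut Gm where
    "continuous_on ({0..T} \<times> closure \<Omega>) (\<lambda>(t, x). u t x)" "continuous_on ({0..T} \<times> closure \<Omega>) ut"
    "\<And>t x. t \<in> {0..T} \<Longrightarrow> x \<in> closure \<Omega> \<Longrightarrow> ((\<lambda>s. u s x) has_vector_derivative ut (t, x)) (at t within {0..T})"
    "continuous_on ({0..T} \<times> closure \<Omega>) Gm"
    "\<And>t. t \<in> {0..T} \<Longrightarrow> u t \<in> H1_vec \<Omega>"
    "\<And>t v. t \<in> {0..T} \<Longrightarrow> v \<in> H1_vec \<Omega> \<Longrightarrow> grad_inner \<Omega> (u t) v = l2_inner \<Omega> (\<lambda>x. Gm (t, x)) (weak_grad_vec \<Omega> v)"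
    "\<And>t v. t \<in> {0<..T} \<Longrightarrow> v \<in> V0 \<Longrightarrow> l2_inner \<Omega> (f t) v = l2_inner \<Omega> (\<lambda>x. ut (t, x)) v + \<nu> * grad_inner \<Omega> (u t) v"
proof -
  let ?K = "{0..T} \<times> closure \<Omega>"
  have smooth: "smooth_up_to ?K (\<lambda>(t, x). u t x)" "smooth_up_to ?K (\<lambda>(t, x). p t x)"
    and eq: "\<And>t x. t \<in> {0<..T} \<Longrightarrow> x \<in> \<Omega> \<Longrightarrow> vector_derivative (\<lambda>s. u s x) (at t within {0..T})
          - \<nu> *\<^sub>R laplacian (u t) x + grad (p t) x = f t x"
    using sol by (auto simp: smooth_stokes_solution_def)
  obtain ut G H where u: "continuous_on ?K (\<lambda>(t, x). u t x)" "continuous_on ?K ut"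
    "\<And>j. continuous_on ?K (G j)" "\<And>j k. continuous_on ?K (H j k)"
    and ut: "\<And>t x. t \<in> {0..T} \<Longrightarrow> x \<in> closure \<Omega> \<Longrightarrow> ((\<lambda>s. u s x) has_vector_derivative ut (t, x)) (at t within {0..T})"
    and du: "\<And>t x. t \<in> {0..T} \<Longrightarrow> x \<in> \<Omega> \<Longrightarrow> u t differentiable (at x)"
    "\<And>t x j. t \<in> {0..T} \<Longrightarrow> x \<in> \<Omega> \<Longrightarrow> partial j (u t) x = G j (t, x)"
    "\<And>t x j. t \<in> {0..T} \<Longrightarrow> x \<in> \<Omega> \<Longrightarrow> partial j (u t) differentiable (at x)"
    "\<And>t x j k. t \<in> {0..T} \<Longrightarrow> x \<in> \<Omega> \<Longrightarrow> partial k (partial j (u t)) x = H j k (t, x)"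
    by (rule smooth_up_to_slices[OF smooth(1) open_dom]) blast
  obtain pt Gp Hp where p: "continuous_on ?K (\<lambda>(t, x). p t x)" "\<And>j. continuous_on ?K (Gp j)"
    and dp: "\<And>t x. t \<in> {0..T} \<Longrightarrow> x \<in> \<Omega> \<Longrightarrow> p t differentiable (at x)"
    "\<And>t x j. t \<in> {0..T} \<Longrightarrow> x \<in> \<Omega> \<Longrightarrow> partial j (p t) x = Gp j (t, x)"
    by (rule smooth_up_to_slices[OF smooth(2) open_dom]) blast
  have slice: "continuous_on \<Omega> (\<lambda>x. F (t, x))" if "continuous_on ?K F" "t \<in> {0..T}"
    for F :: "real \<times> (real^'n) \<Rightarrow> 'c::topological_space" and t
    by (rule continuous_on_compose2[OF that(1)]) (use that(2) dom_closure in \<open>auto intro!: continuous_intros\<close>)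
  have uL: "u t \<in> L2 \<Omega>" "\<And>j. partial j (u t) \<in> L2 \<Omega>" "\<And>j k. partial k (partial j (u t)) \<in> L2 \<Omega>"
    "\<And>j k. continuous_on \<Omega> (partial k (partial j (u t)))" if t: "t \<in> {0..T}" for t
  proof -
    show "u t \<in> L2 \<Omega>" using L2_slice[OF u(1) t] by simp
    show "partial j (u t) \<in> L2 \<Omega>" for j
      by (rule L2_cong_on[OF _ L2_slice[OF u(3)[of j] t]]) (simp only: du(2)[OF t])
    show "partial k (partial j (u t)) \<in> L2 \<Omega>" for j k
      by (rule L2_cong_on[OF _ L2_slice[OF u(4)[of j k] t]]) (simp only: du(4)[OF t])
    show "continuous_on \<Omega> (partial k (partial j (u t)))" for j k
      by (rule continuous_on_eq[OF slice[OF u(4)[of j k] t]]) (simp only: du(4)[OF t])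
  qed
  have pL: "p t \<in> L2 \<Omega>" "\<And>j. partial j (p t) \<in> L2 \<Omega>" "\<And>j. continuous_on \<Omega> (partial j (p t))"
    if t: "t \<in> {0..T}" for t
  proof -
    show "p t \<in> L2 \<Omega>" using L2_slice[OF p(1) t] by simp
    show "partial j (p t) \<in> L2 \<Omega>" for j
      by (rule L2_cong_on[OF _ L2_slice[OF p(2)[of j] t]]) (simp only: dp(2)[OF t])
    show "continuous_on \<Omega> (partial j (p t))" for j
      by (rule continuous_on_eq[OF slice[OF p(2)[of j] t]]) (simp only: dp(2)[OF t])
  qed
  note lap = laplacian_weak[OF _ du(1) du(3) uL(4,1,2,3)]
  define Gm :: "real \<times> (real^'n) \<Rightarrow> real^'n^'n" where "Gm z = (\<chi> i j. G j z $ i)" for z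
  have Gm: "continuous_on ?K Gm"
    unfolding Gm_def[abs_def] by (intro continuous_intros u(3))
  show ?thesis
  proof (rule that[OF u(1,2) ut Gm])
    fix t assume t: "t \<in> {0..T}"
    show uH: "u t \<in> H1_vec \<Omega>" by (rule lap(1)[OF V_zero]) (rule t | assumption)+
    fix v assume v: "v \<in> H1_vec \<Omega>"
    have "AE x in lebesgue_on \<Omega>. weak_grad_vec \<Omega> (u t) x = (\<chi> i j. partial j (u t) x $ i)"
      by (rule lap(3)[OF V_zero]) (rule t | assumption)+
    moreover have "AE x in lebesgue_on \<Omega>. (\<chi> i j. partial j (u t) x $ i) = Gm (t, x)"
      by (rule AE_I2) (simp add: Gm_def du(2)[OF t] space_restrict_space)
    ultimately have "AE x in lebesgue_on \<Omega>. weak_grad_vec \<Omega> (u t) x = Gm (t, x)"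
      by eventually_elim simp
    then show "grad_inner \<Omega> (u t) v = l2_inner \<Omega> (\<lambda>x. Gm (t, x)) (weak_grad_vec \<Omega> v)"
      unfolding grad_inner_def
      by (intro l2_inner_cong weak_grad_vec_L2 uH v L2_slice[OF Gm t]) auto
  next
    fix t v assume t0: "t \<in> {0<..T}" and v: "v \<in> V0"
    then have t: "t \<in> {0..T}" by auto
    have vV: "v \<in> V" and vL: "v \<in> L2 \<Omega>" using v by (auto intro: V_L2 dest: V0_V)
    have utL: "(\<lambda>x. ut (t, x)) \<in> L2 \<Omega>" by (rule L2_slice[OF u(2) t])
    have lapL: "laplacian (u t) \<in> L2 \<Omega>"
      unfolding laplacian_def[abs_def] by (intro l2.sum_mem uL t)
    have gL: "grad (p t) \<in> L2 \<Omega>" and g0: "l2_inner \<Omega> (grad (p t)) v = 0"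
      by (rule pressure_gradient_orthogonal[OF robust v dp(1)[OF t] pL(3)[OF t] pL(1)[OF t] pL(2)[OF t]], assumption)+
    have "f t x = (ut (t, x) - \<nu> *\<^sub>R laplacian (u t) x) + grad (p t) x" if x: "x \<in> \<Omega>" for x
    proof -
      \<comment> \<open>The derivative within a nondegenerate interval is unique, also the one-sided
        one at t = T, so the operator returns \<open>ut\<close>.\<close>
      have "vector_derivative (\<lambda>s. u s x) (at t within {0..T}) = ut (t, x)"
        using vector_derivative_within_cbox[of 0 T t "\<lambda>s. u s x"] ut[OF t dom_closure[OF x]] T t by simp
      then show ?thesis using eq[OF t0 x] by simp
    qed
    then have "l2_inner \<Omega> (f t) v = l2_inner \<Omega> (\<lambda>x. (ut (t, x) - \<nu> *\<^sub>R laplacian (u t) x) + grad (p t) x) v"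
      by (intro l2_inner_cong_on) auto
    also have "\<dots> = l2_inner \<Omega> (\<lambda>x. ut (t, x) - \<nu> *\<^sub>R laplacian (u t) x) v + l2_inner \<Omega> (grad (p t)) v"
      by (intro l2.B_add l2.diff_mem l2.scale_mem utL lapL gL vL)
    also have "l2_inner \<Omega> (\<lambda>x. ut (t, x) - \<nu> *\<^sub>R laplacian (u t) x) v
        = l2_inner \<Omega> (\<lambda>x. ut (t, x)) v - l2_inner \<Omega> (\<lambda>x. \<nu> *\<^sub>R laplacian (u t) x) v"
      by (intro l2.B_diff l2.scale_mem utL lapL vL)
    also have "l2_inner \<Omega> (\<lambda>x. \<nu> *\<^sub>R laplacian (u t) x) v = \<nu> * l2_inner \<Omega> (laplacian (u t)) v"
      by (intro l2.B_scale lapL vL)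
    also have "l2_inner \<Omega> (laplacian (u t)) v = - grad_inner \<Omega> (u t) v"
      by (rule lap(2)[OF vV]) (rule t | assumption)+
    finally show "l2_inner \<Omega> (f t) v = l2_inner \<Omega> (\<lambda>x. ut (t, x)) v + \<nu> * grad_inner \<Omega> (u t) v"
      using g0 by simp
  qed
qed

text \<open>The coupled equation separates by its test functions: v = 0 leaves the divergence
  constraint, q = 0 the momentum equation, from which the pressure drops out for \<open>v\<close> in
  \<open>V0\<close>.\<close>

lemma semidiscrete_weak:
  assumes sol: "semidiscrete_stokes_solution \<Omega> T \<nu> f u0 V Q uh duh ph" and t: "t \<in> {0<..T}"
  shows "uh t \<in> V0"
    and "v \<in> V0 \<Longrightarrow> l2_inner \<Omega> (duh t) v + \<nu> * grad_inner \<Omega> (uh t) v = l2_inner \<Omega> (f t) v"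
proof -
  have uhV: "uh t \<in> V" and phQ: "ph t \<in> Q" and eq: "\<And>v q. v \<in> V \<Longrightarrow> q \<in> Q \<Longrightarrow>
      l2_inner \<Omega> (duh t) v + \<nu> * grad_inner \<Omega> (uh t) v - l2_inner \<Omega> (ph t) (weak_div \<Omega> v)
        + l2_inner \<Omega> (weak_div \<Omega> (uh t)) q = l2_inner \<Omega> (f t) v"
    using sol t by (auto simp: semidiscrete_stokes_solution_def grad_inner_def)
  have comm: "l2_inner \<Omega> (ph t) (weak_div \<Omega> v) = l2_inner \<Omega> (weak_div \<Omega> v) (ph t)" for v
    by (rule l2_inner_commute)
  have grad0: "grad_inner \<Omega> (uh t) (\<lambda>x. 0) = 0"
    using grad.B_scale_right[OF H1_vec_zero V_H1[OF uhV], of 0] by simp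
  \<comment> \<open>Even the weak divergence of the zero function is a chosen representative. That
    the pressure term vanishes is therefore taken from \<open>V0_zero\<close>, and likewise
    \<open>grad0\<close> from the scaling law.\<close>
  have "l2_inner \<Omega> (weak_div \<Omega> (uh t)) q = 0" if q: "q \<in> Q" for q
    using eq[OF V_zero q] grad0 comm[of "\<lambda>x. 0"] V0_zero phQ
    by (simp add: discrete_div_free_def l2_inner_def)
  then show "uh t \<in> V0" using uhV by (simp add: discrete_div_free_def)
  show "l2_inner \<Omega> (duh t) v + \<nu> * grad_inner \<Omega> (uh t) v = l2_inner \<Omega> (f t) v" if v: "v \<in> V0"
  proof -
    have "l2_inner \<Omega> (ph t) (weak_div \<Omega> v) = 0" using v phQ comm by (simp add: discrete_div_free_def)
    moreover have "l2_inner \<Omega> (weak_div \<Omega> (uh t)) (\<lambda>x. 0) = 0" by (simp add: l2_inner_def)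
    ultimately show ?thesis using eq[OF V0_V[OF v] Q_zero] by simp
  qed
qed

end

theorem theorem1:
  fixes \<Omega> :: "(real^'n) set" and T \<nu> :: real
    and f u :: "real \<Rightarrow> real^'n \<Rightarrow> real^'n" and p :: "real \<Rightarrow> real^'n \<Rightarrow> real"
    and u0 :: "real^'n \<Rightarrow> real^'n"
    and V :: "(real^'n \<Rightarrow> real^'n) set" and Q :: "(real^'n \<Rightarrow> real) set"
    and uh duh :: "real \<Rightarrow> real^'n \<Rightarrow> real^'n" and ph :: "real \<Rightarrow> real^'n \<Rightarrow> real"
  assumes dim: "CARD('n) \<in> {2, 3}"
    and domain: "open \<Omega>" "\<Omega> \<noteq> {}" "bounded \<Omega>" "convex \<Omega>" "polytope (closure \<Omega>)"
    and T_pos: "T > 0" and nu_pos: "\<nu> > 0"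
    and u0_div_free: "\<forall>x\<in>\<Omega>. divergence u0 x = 0"
    and continuous_sol: "smooth_stokes_solution \<Omega> T \<nu> f u0 u p"
    and spaces: "conforming_pair \<Omega> V Q" "inf_sup_stable \<Omega> V Q" "pressure_robust \<Omega> V Q"
    and discrete_sol: "semidiscrete_stokes_solution \<Omega> T \<nu> f u0 V Q uh duh ph"
  shows "let eh = (\<lambda>t x. uh t x - helmholtz_proj \<Omega> V Q (u t) x);
             E = (\<lambda>t. (l2_norm \<Omega> (weak_grad_vec \<Omega> (eh t)))\<^sup>2);
             R = (\<lambda>t. (l2_norm \<Omega> (weak_grad_vec \<Omega>
                   (\<lambda>x. stokes_proj \<Omega> V Q (u t) x - helmholtz_proj \<Omega> V Q (u t) x)))\<^sup>2)
         in integrable (lebesgue_on {0..T}) E \<and> integrable (lebesgue_on {0..T}) R \<and>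
            (l2_norm \<Omega> (eh T))\<^sup>2 + \<nu> * (LINT t|lebesgue_on {0..T}. E t)
              \<le> \<nu> * (LINT t|lebesgue_on {0..T}. R t)"
proof -
  interpret conforming \<Omega> V Q
    using domain(1,3) spaces(1) by unfold_locales
  note sol = semidiscrete_weak[OF discrete_sol]
  obtain ut Gm where u_cont: "continuous_on ({0..T} \<times> closure \<Omega>) (\<lambda>(t, x). u t x)"
    and ut_cont: "continuous_on ({0..T} \<times> closure \<Omega>) ut"
    and u_deriv: "\<And>t x. t \<in> {0..T} \<Longrightarrow> x \<in> closure \<Omega> \<Longrightarrow>
      ((\<lambda>s. u s x) has_vector_derivative ut (t, x)) (at t within {0..T})"
    and Gm: "continuous_on ({0..T} \<times> closure \<Omega>) Gm"
    and uH: "\<And>t. t \<in> {0..T} \<Longrightarrow> u t \<in> H1_vec \<Omega>"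
    and u_grad: "\<And>t v. t \<in> {0..T} \<Longrightarrow> v \<in> H1_vec \<Omega> \<Longrightarrow>
      grad_inner \<Omega> (u t) v = l2_inner \<Omega> (\<lambda>x. Gm (t, x)) (weak_grad_vec \<Omega> v)"
    and u_weak: "\<And>t v. t \<in> {0<..T} \<Longrightarrow> v \<in> V0 \<Longrightarrow>
      l2_inner \<Omega> (f t) v = l2_inner \<Omega> (\<lambda>x. ut (t, x)) v + \<nu> * grad_inner \<Omega> (u t) v"
    by (rule smooth_solution_weak[OF continuous_sol T_pos spaces(3)]) blast
  have uL: "u t \<in> L2 \<Omega>" if "t \<in> {0..T}" for t by (rule H1_vec_L2[OF uH[OF that]])
  have uhV: "uh t \<in> V" if "t \<in> {0..T}" for t
    using discrete_sol that by (simp add: semidiscrete_stokes_solution_def)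
  have uhL: "uh t \<in> L2 \<Omega>" if "t \<in> {0..T}" for t by (rule V_L2[OF uhV[OF that]])
  have uh_cont: "l2_continuous_on \<Omega> {0..T} uh"
    and uh_deriv: "\<And>t. t \<in> {0<..T} \<Longrightarrow> has_l2_derivative \<Omega> uh (duh t) t {0..T}"
    and uh0: "AE x in lebesgue_on \<Omega>. uh 0 x = P u0 x"
    using discrete_sol by (simp_all add: semidiscrete_stokes_solution_def)
  have duhL: "duh t \<in> L2 \<Omega>" if "t \<in> {0<..T}" for t
    using uh_deriv[OF that] by (simp add: has_l2_derivative_def)
  obtain m n :: nat and e d where e: "\<And>i. i < m \<Longrightarrow> e i \<in> V0" and d: "\<And>k. k < n \<Longrightarrow> d k \<in> V0"
    and grad_expand: "\<And>v w. v \<in> V0 \<Longrightarrow> w \<in> H1_vec \<Omega> \<Longrightarrow>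
      grad_inner \<Omega> v w = (\<Sum>i<m. l2_inner \<Omega> v (e i) * grad_inner \<Omega> (e i) w)"
    and grad_Parseval: "\<And>v. v \<in> V0 \<Longrightarrow> grad_inner \<Omega> v v = (\<Sum>k<n. (grad_inner \<Omega> v (d k))\<^sup>2)"
    and l2_expand: "\<And>v w. w \<in> L2 \<Omega> \<Longrightarrow> v \<in> V0 \<Longrightarrow>
      l2_inner \<Omega> w v = (\<Sum>i<m. l2_inner \<Omega> v (e i) * l2_inner \<Omega> w (e i))"
    by (rule V0_bases) blast
  have V0L: "v \<in> L2 \<Omega>" and V0H: "v \<in> H1_vec \<Omega>" if "v \<in> V0" for v
    using that by (auto intro: V_L2 V_H1 dest: V0_V)
  define eh where "eh t x = uh t x - P (u t) x" for t x
  define r where "r t x = S (u t) x - P (u t) x" for t x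
  \<comment> \<open>The coefficient of the error along \<open>e i\<close>, with
    \<open>P (u t)\<close> replaced by \<open>u t\<close>; both have the same product with
    \<open>e i\<close>, but only the latter is visibly differentiable in time.\<close>
  define c where "c i t = l2_inner \<Omega> (uh t) (e i) - l2_inner \<Omega> (u t) (e i)" for i t
  define y where "y t = (\<Sum>i<m. (c i t)\<^sup>2)" for t
  \<comment> \<open>\<open>E\<close> and \<open>R\<close> are the two integrands in coordinates. In
    \<open>R\<close> the Stokes projection is again replaced by \<open>u t\<close>, and the gradient
    of \<open>P (u t)\<close> is expressed by L2 coefficients of \<open>u t\<close>.\<close>
  define E where "E t = (\<Sum>k<n. (\<Sum>i<m. c i t * grad_inner \<Omega> (e i) (d k))\<^sup>2)" for t
  define R where "R t = (\<Sum>k<n. (grad_inner \<Omega> (u t) (d k) -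
    (\<Sum>i<m. l2_inner \<Omega> (u t) (e i) * grad_inner \<Omega> (e i) (d k)))\<^sup>2)" for t
  have PV0: "P (u t) \<in> V0" and SV0: "S (u t) \<in> V0" if "t \<in> {0..T}" for t
    using that by (auto intro: helmholtz_proj(1)[OF uL] stokes_proj(1)[OF uH])
  have Pe: "l2_inner \<Omega> (P (u t)) (e i) = l2_inner \<Omega> (u t) (e i)" if "t \<in> {0..T}" "i < m" for t i
    by (rule helmholtz_proj(2)[OF uL[OF that(1)] e[OF that(2)]])
  have ehV0: "eh t \<in> V0" if "t \<in> {0<..T}" for t
    unfolding eh_def by (rule semi_inner_space.diff_mem[OF V0_L2]) (use that sol(1) PV0 in auto)
  \<comment> \<open>Membership in \<open>V0\<close> was read off the equation and so holds for
    positive times; at t = 0 membership in \<open>V\<close> is enough.\<close>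
  have ehV: "eh t \<in> V" if "t \<in> {0..T}" for t
  proof -
    have "(\<lambda>x. uh t x + (-1) *\<^sub>R P (u t) x) \<in> V"
      by (intro V_add V_scale uhV V0_V PV0 that)
    then show ?thesis by (simp add: eh_def[abs_def])
  qed
  have eh_e: "l2_inner \<Omega> (eh t) (e i) = c i t" if t: "t \<in> {0..T}" and i: "i < m" for t i
  proof -
    have "l2_inner \<Omega> (eh t) (e i) = l2_inner \<Omega> (uh t) (e i) - l2_inner \<Omega> (P (u t)) (e i)"
      unfolding eh_def by (rule l2.B_diff[OF uhL[OF t] V0L[OF PV0[OF t]] V0L[OF e[OF i]]])
    then show ?thesis by (simp add: c_def Pe[OF t i])
  qed
  have c0: "c i 0 = 0" if i: "i < m" for i
  proof -
    have 0: "0 \<in> {0..T}" using T_pos by simp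
    have on: "u 0 x = u0 x" if "x \<in> \<Omega>" for x
      using continuous_sol that by (simp add: smooth_stokes_solution_def)
    have u0L: "u0 \<in> L2 \<Omega>" by (rule L2_cong_on[OF on uL[OF 0]])
    have "l2_inner \<Omega> (uh 0) (e i) = l2_inner \<Omega> (P u0) (e i)"
      by (rule l2_inner_cong[OF uhL[OF 0] V0L[OF helmholtz_proj(1)[OF u0L]] V0L[OF e[OF i]] V0L[OF e[OF i]] uh0]) simp
    also have "\<dots> = l2_inner \<Omega> u0 (e i)" by (rule helmholtz_proj(2)[OF u0L e[OF i]])
    also have "\<dots> = l2_inner \<Omega> (u 0) (e i)" by (rule l2_inner_cong_on) (simp_all add: on)
    finally show ?thesis by (simp add: c_def)
  qed
  have eh0: "l2_inner \<Omega> (eh 0) (eh 0) = 0"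
  proof -
    have 0: "0 \<in> {0..T}" using T_pos by simp
    have on: "u 0 x = u0 x" if "x \<in> \<Omega>" for x
      using continuous_sol that by (simp add: smooth_stokes_solution_def)
    \<comment> \<open>The two fields agree only on \<open>\<Omega>\<close>, but the L2 product sees
      nothing else. The predicates under the choice operator coincide, so the chosen projections are
      equal as functions.\<close>
    have Pu0: "P (u 0) = P u0"
      unfolding helmholtz_proj_def using l2_inner_cong_on[of \<Omega> "u 0" u0] on by simp
    have "AE x in lebesgue_on \<Omega>. eh 0 x = 0" using uh0 by eventually_elim (simp add: eh_def Pu0)
    then have "l2_inner \<Omega> (eh 0) (eh 0) = l2_inner \<Omega> (\<lambda>x. 0) (\<lambda>x. 0 :: real^'n)"
      by (intro l2_inner_cong V_L2 ehV 0 L2_zero)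
    then show ?thesis by (simp add: l2_inner_def)
  qed
  have E_eq: "grad_inner \<Omega> (eh t) (eh t) = E t" if t: "t \<in> {0..T}" for t
  \<comment> \<open>At t = 0 the error is null in L2, so its gradient is null as well, in accordance
    with the vanishing coefficients.\<close>
  proof (cases "t = 0")
    case True
    then have "grad_inner \<Omega> (eh t) (eh t) = 0"
      using grad_inner_null[OF V_H1[OF ehV] _ V_H1[OF ehV]] eh0 t by blast
    then show ?thesis using True by (simp add: E_def c0)
  next
    case False
    then have eh: "eh t \<in> V0" using t by (intro ehV0) auto
    have "grad_inner \<Omega> (eh t) (d k) = (\<Sum>i<m. c i t * grad_inner \<Omega> (e i) (d k))" if "k < n" for k
      using grad_expand[OF eh V0H[OF d[OF that]]] eh_e[OF t] by simp
    then show ?thesis by (simp add: grad_Parseval[OF eh] E_def)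
  qed
  have rV0: "r t \<in> V0" if "t \<in> {0..T}" for t
    unfolding r_def by (rule semi_inner_space.diff_mem[OF V0_L2 SV0[OF that] PV0[OF that]])
  have R_eq: "grad_inner \<Omega> (r t) (r t) = R t" if t: "t \<in> {0..T}" for t
  proof -
    have "grad_inner \<Omega> (r t) (d k) = grad_inner \<Omega> (u t) (d k) -
        (\<Sum>i<m. l2_inner \<Omega> (u t) (e i) * grad_inner \<Omega> (e i) (d k))" if k: "k < n" for k
    proof -
      have "grad_inner \<Omega> (r t) (d k) = grad_inner \<Omega> (S (u t)) (d k) - grad_inner \<Omega> (P (u t)) (d k)"
        unfolding r_def by (intro grad.B_diff V0H SV0 PV0 d t k)
      then show ?thesis
        using stokes_proj(2)[OF uH[OF t] d[OF k]] grad_expand[OF PV0[OF t] V0H[OF d[OF k]]] Pe[OF t] by simp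
    qed
    then show ?thesis by (simp add: grad_Parseval[OF rV0[OF t]] R_def)
  qed
  have y_eq: "l2_inner \<Omega> (eh t) (eh t) = y t" if t: "t \<in> {0<..T}" for t
    using l2_expand[OF V0L[OF ehV0[OF t]] ehV0[OF t]] eh_e t by (simp add: y_def power2_eq_square)
  have u_cont_e: "continuous_on {0..T} (\<lambda>t. l2_inner \<Omega> (u t) (e i))" if "i < m" for i
    using continuous_on_l2_inner_slice[OF u_cont V0L[OF e[OF that]]] by simp
  have c_cont: "continuous_on {0..T} (c i)" if i: "i < m" for i
    unfolding c_def
    by (intro continuous_on_diff u_cont_e[OF i] l2_continuous_on_inner[OF uh_cont uhL V0L[OF e[OF i]]])
  have u_grad_cont: "continuous_on {0..T} (\<lambda>t. grad_inner \<Omega> (u t) (d k))" if k: "k < n" for k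
    by (rule continuous_on_eq[OF continuous_on_l2_inner_slice[OF Gm weak_grad_vec_L2[OF V0H[OF d[OF k]]]]])
       (simp only: u_grad[OF _ V0H[OF d[OF k]]])
  have cont: "continuous_on {0..T} y" "continuous_on {0..T} E" "continuous_on {0..T} R"
    unfolding y_def E_def R_def
    by (intro continuous_on_sum continuous_on_power continuous_on_diff continuous_on_mult
        continuous_on_const c_cont u_cont_e u_grad_cont; simp)+
  have "y T + \<nu> * (LINT t|lebesgue_on {0..T}. E t) \<le> y 0 + \<nu> * (LINT t|lebesgue_on {0..T}. R t)"
  proof (rule energy_integration[OF T_pos cont])
    fix t assume "0 < t" "t < T"
    then have t0: "t \<in> {0<..T}" and t: "t \<in> {0..T}" by auto
    let ?ut = "\<lambda>x. ut (t, x)"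
    have utL: "?ut \<in> L2 \<Omega>" by (rule L2_slice[OF ut_cont t])
    define c' where "c' i = l2_inner \<Omega> (duh t) (e i) - l2_inner \<Omega> ?ut (e i)" for i
    have "(c i has_real_derivative c' i) (at t)" if i: "i < m" for i
    proof -
      have "(c i has_real_derivative c' i) (at t within {0..T})"
        unfolding c_def c'_def
        by (intro DERIV_diff has_l2_derivative_inner[OF uh_deriv[OF t0] uhL V0L[OF e[OF i]] t]
            l2_inner_has_derivative[OF u_cont ut_cont u_deriv V0L[OF e[OF i]] t])
      then show ?thesis using \<open>0 < t\<close> \<open>t < T\<close> by (simp add: at_within_Icc_at)
    qed
    then have "(y has_real_derivative (\<Sum>i<m. 2 * (c i t * c' i))) (at t)"
      unfolding y_def by (auto intro!: DERIV_sum derivative_eq_intros)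
    moreover have "(\<Sum>i<m. 2 * (c i t * c' i)) \<le> \<nu> * (R t - E t)"
    proof -
      have eh: "eh t \<in> V0" by (rule ehV0[OF t0])
      note H = V0H[OF eh] V0H[OF PV0[OF t]] V0H[OF SV0[OF t]] V0H[OF rV0[OF t]]
      \<comment> \<open>The coefficient sums are folded back into scalar products.
        \<open>duh t\<close> and the time derivative of \<open>u\<close> enter only as L2 fields; it
        is the test function \<open>eh t\<close> that lies in \<open>V0\<close>.\<close>
      have "(\<Sum>i<m. 2 * (c i t * c' i)) = 2 * (l2_inner \<Omega> (duh t) (eh t) - l2_inner \<Omega> ?ut (eh t))"
        using l2_expand[OF duhL[OF t0] eh] l2_expand[OF utL eh] eh_e[OF t]
        by (simp add: c'_def sum_distrib_left sum_subtractf right_diff_distrib)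
      \<comment> \<open>Subtracting the two weak equations cancels the common right-hand side
        \<open>f t\<close>.\<close>
      also have "l2_inner \<Omega> (duh t) (eh t) - l2_inner \<Omega> ?ut (eh t)
          = \<nu> * (grad_inner \<Omega> (u t) (eh t) - grad_inner \<Omega> (uh t) (eh t))"
        using sol(2)[OF t0 eh] u_weak[OF t0 eh] by (simp add: algebra_simps)
      also have "grad_inner \<Omega> (u t) (eh t) = grad_inner \<Omega> (S (u t)) (eh t)"
        using stokes_proj(2)[OF uH[OF t] eh] by simp
      also have "grad_inner \<Omega> (uh t) (eh t) = grad_inner \<Omega> (eh t) (eh t) + grad_inner \<Omega> (P (u t)) (eh t)"
        using grad.B_diff[OF V_H1[OF uhV[OF t]] H(2) H(1)] by (simp add: eh_def[abs_def])
      also have "grad_inner \<Omega> (S (u t)) (eh t) - (grad_inner \<Omega> (eh t) (eh t) + grad_inner \<Omega> (P (u t)) (eh t))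
          = grad_inner \<Omega> (r t) (eh t) - E t"
        using grad.B_diff[OF H(3) H(2) H(1)] E_eq[OF t] by (simp add: r_def[abs_def])
      finally have eq: "(\<Sum>i<m. 2 * (c i t * c' i)) = \<nu> * (2 * grad_inner \<Omega> (r t) (eh t) - 2 * E t)" by simp
      \<comment> \<open>Young's inequality in the form 0 \<le> |grad (r - eh)|^2. It bounds twice
        the mixed product by R + E, so one of the two copies of E remains on the left; this is why
        both constants in the estimate are exactly 1.\<close>
      let ?s = "\<lambda>x. r t x - eh t x"
      have s: "?s \<in> H1_vec \<Omega>" by (rule grad.diff_mem[OF H(4) H(1)])
      have "0 \<le> grad_inner \<Omega> ?s ?s" by (rule grad.B_nonneg[OF s])
      also have "\<dots> = R t - 2 * grad_inner \<Omega> (r t) (eh t) + E t"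
        using grad.B_diff[OF H(4) H(1) s] grad.B_diff_right[OF H(4) H(1) H(4)] grad.B_diff_right[OF H(4) H(1) H(1)]
          grad.B_commute[OF H(1) H(4)] E_eq[OF t] R_eq[OF t] by simp
      finally show ?thesis unfolding eq using nu_pos by (intro mult_left_mono) auto
    qed
    ultimately show "\<exists>y'. (y has_real_derivative y') (at t) \<and> y' \<le> \<nu> * (R t - E t)" by blast
  qed
  moreover have "y 0 = 0" by (simp add: y_def c0)
  moreover have "y T = (l2_norm \<Omega> (eh T))\<^sup>2" using y_eq[of T] T_pos by (simp add: l2_norm_power2)
  \<comment> \<open>Replaces the coordinate expressions by the actual gradient norms at all times of
    the closed interval, so that integrability and integrals carry over from the continuous
    functions \<open>E\<close> and \<open>R\<close>.\<close>
  moreover have on: "(l2_norm \<Omega> (weak_grad_vec \<Omega> (eh t)))\<^sup>2 = E t" "(l2_norm \<Omega> (weak_grad_vec \<Omega> (r t)))\<^sup>2 = R t"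
    if "t \<in> {0..T}" for t
    using E_eq[OF that] R_eq[OF that] by (simp_all only: l2_norm_power2 grad_inner_def)
  have space: "t \<in> {0..T}" if "t \<in> space (lebesgue_on {0..T})" for t
    using that by (simp add: space_restrict_space)
  have "integrable (lebesgue_on {0..T}) (\<lambda>t. (l2_norm \<Omega> (weak_grad_vec \<Omega> (eh t)))\<^sup>2)
      \<longleftrightarrow> integrable (lebesgue_on {0..T}) E"
    "integrable (lebesgue_on {0..T}) (\<lambda>t. (l2_norm \<Omega> (weak_grad_vec \<Omega> (r t)))\<^sup>2)
      \<longleftrightarrow> integrable (lebesgue_on {0..T}) R"
    by (rule Bochner_Integration.integrable_cong[OF refl on(1)[OF space]], assumption)
       (rule Bochner_Integration.integrable_cong[OF refl on(2)[OF space]], assumption)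
  moreover have "(LINT t|lebesgue_on {0..T}. (l2_norm \<Omega> (weak_grad_vec \<Omega> (eh t)))\<^sup>2) = (LINT t|lebesgue_on {0..T}. E t)"
    "(LINT t|lebesgue_on {0..T}. (l2_norm \<Omega> (weak_grad_vec \<Omega> (r t)))\<^sup>2) = (LINT t|lebesgue_on {0..T}. R t)"
    by (rule Bochner_Integration.integral_cong[OF refl on(1)[OF space]], assumption)
       (rule Bochner_Integration.integral_cong[OF refl on(2)[OF space]], assumption)
  moreover note cont(2,3)[THEN continuous_imp_integrable_real]
  ultimately show ?thesis
    unfolding Let_def eh_def[abs_def] r_def[abs_def] by simp
qed

end
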